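(* Let $G$ be a connected outer-$1$-planar graph with maximum degree at most $4$ that is not isomorphic to the $5$-cycle $C_5$. Then $G$ is proper conflict-free (degree+$2$)-choosable.
   Context: All graphs are simple and finite. A graph is outer-$1$-planar if it admits a drawing in the plane with all vertices on the outer face and with at most one crossing per edge. A proper conflict-free coloring of a graph $G$ is a proper vertex coloring $\phi$ such that for every non-isolated vertex $v$ some color appears exactly once on the open neighborhood $N(v)$. For a non-negative integer $k$, $G$ is proper conflict-free (degree+$k$)-choosable if for every list assignment $L$ of $G$ with $|L(v)| = d_G(v)+k$ for all $v\in V(G)$, there is a proper conflict-free coloring $\phi$ of $G$ with $\phi(v)\in L(v)$ for all $v\in V(G)$. *)

theory Defs
  imports "HOL-Analysis.Analysis" "Graph_Theory.Graph_Theory"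
begin

text \<open>
  Following \<^theory>\<open>Graph_Theory.Pair_Digraph\<close>, a finite simple graph is a
  \<^locale>\<open>pair_graph\<close>: a finite symmetric loop-free digraph whose arcs are pairs of vertices.
  An undirected edge is thus a pair of opposite arcs, so \<^const>\<open>out_degree\<close> is the degree.
\<close>

definition uedges :: "'a pair_pre_digraph \<Rightarrow> 'a set set" where
  "uedges G = {{u, v} | u v. (u, v) \<in> parcs G}"

definition nbhd :: "'a pair_pre_digraph \<Rightarrow> 'a \<Rightarrow> 'a set" where
  "nbhd G v = {u. (v, u) \<in> parcs G}"

text \<open>The cycle on \<open>n\<close> vertices, intended for \<open>n \<ge> 3\<close>.\<close>

definition cycle_graph :: "nat \<Rightarrow> nat pair_pre_digraph" where
  "cycle_graph n = \<lparr> pverts = {..<n},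
     parcs = {(i, j). i < n \<and> j < n \<and> (j = Suc i mod n \<or> i = Suc j mod n)} \<rparr>"


definition plane_drawing ::
    "'a pair_pre_digraph \<Rightarrow> ('a \<Rightarrow> complex) \<Rightarrow> ('a set \<Rightarrow> real \<Rightarrow> complex) \<Rightarrow> bool" where
  "plane_drawing G p \<gamma> \<longleftrightarrow>
     inj_on p (pverts G) \<and>
     (\<forall>e \<in> uedges G. arc (\<gamma> e) \<and>
        {pathstart (\<gamma> e), pathfinish (\<gamma> e)} = p ` e \<and>
        path_image (\<gamma> e) \<inter> p ` pverts G = p ` e)"

definition drawn_set ::
    "'a pair_pre_digraph \<Rightarrow> ('a \<Rightarrow> complex) \<Rightarrow> ('a set \<Rightarrow> real \<Rightarrow> complex) \<Rightarrow> complex set" where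
  "drawn_set G p \<gamma> = p ` pverts G \<union> (\<Union>e \<in> uedges G. path_image (\<gamma> e))"

text \<open>
  Every common point of the relative interiors of two edges counts as a crossing, whether or not
  the edges share an end. Crossings of \<open>e\<close> are recorded together with the other edge, so that a
  point lying on three edges contributes two crossings to each of them.
\<close>

definition crossings ::
    "'a pair_pre_digraph \<Rightarrow> ('a \<Rightarrow> complex) \<Rightarrow> ('a set \<Rightarrow> real \<Rightarrow> complex) \<Rightarrow> 'a set
      \<Rightarrow> ('a set \<times> complex) set" where
  "crossings G p \<gamma> e = {(f, x). f \<in> uedges G \<and> f \<noteq> e \<and>
     x \<in> path_image (\<gamma> e) - p ` e \<and> x \<in> path_image (\<gamma> f) - p ` f}"

text \<open>
  The outer face of a drawing is the unbounded component of its complement, which is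
  \<^const>\<open>outside\<close> of the (compact) drawn set; a vertex is on a face if it lies on its boundary.
\<close>

definition outer_1_planar :: "'a pair_pre_digraph \<Rightarrow> bool" where
  "outer_1_planar G \<longleftrightarrow> (\<exists>p \<gamma>. plane_drawing G p \<gamma> \<and>
     (\<forall>v \<in> pverts G. p v \<in> frontier (outside (drawn_set G p \<gamma>))) \<and>
     (\<forall>e \<in> uedges G. finite (crossings G p \<gamma> e) \<and> card (crossings G p \<gamma> e) \<le> 1))"


definition proper_conflict_free_coloring :: "'a pair_pre_digraph \<Rightarrow> ('a \<Rightarrow> 'c) \<Rightarrow> bool" where
  "proper_conflict_free_coloring G \<phi> \<longleftrightarrow>
     (\<forall>(u, v) \<in> parcs G. \<phi> u \<noteq> \<phi> v) \<and>
     (\<forall>v \<in> pverts G. nbhd G v \<noteq> {} \<longrightarrow> (\<exists>c. \<exists>!u. u \<in> nbhd G v \<and> \<phi> u = c))"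

text \<open>The type argument is the type of colors, which a type variable leaves arbitrary.\<close>

definition pcf_degree_plus_choosable :: "'c itself \<Rightarrow> nat \<Rightarrow> 'a pair_pre_digraph \<Rightarrow> bool" where
  "pcf_degree_plus_choosable _ k G \<longleftrightarrow>
     (\<forall>L :: 'a \<Rightarrow> 'c set.
        (\<forall>v \<in> pverts G. finite (L v) \<and> card (L v) = out_degree G v + k) \<longrightarrow>
        (\<exists>\<phi>. proper_conflict_free_coloring G \<phi> \<and> (\<forall>v \<in> pverts G. \<phi> v \<in> L v)))"

end

theory Submission
  imports Defs "HOL-Complex_Analysis.Complex_Analysis"
begin

text \<open>
  A simple closed curve that separates the drawn set from points of the outer face close to the
  vertices is obtained as the image of a circle under a Riemann map of the inverted outer face.
  Short segments from the vertices to this curve order the vertices cyclically so that edges with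
  interleaved ends cross. It therefore suffices to colour graphs with linearly ordered vertices in
  which the ends of every edge interleave with those of at most one other edge.

  When such a graph is coloured vertex by vertex, only the last neighbour of a vertex \<open>u\<close> has to
  respect the condition at \<open>u\<close>. As degrees are at most 4, it has to avoid a single colour for
  this, and none at all if there are at least two other neighbours and their colours are distinct.
  Counting colours in this way excludes several configurations from a smallest counterexample.
  Call an interval of vertices closed if its inner vertices have no neighbours outside of it.
  By induction on their size, closed intervals have one of five simple shapes; for the interval
  of all vertices only cycles remain. They are colourable except for the 5-cycle with lists of
  size 4.
\<close>

section \<open>Conflict-free sets and chains\<close>

text \<open>A vertex of degree \<open>k\<close> that is coloured last may have to avoid
  \<open>2 * k\<close> colours: \<open>k\<close> for properness and one for each neighbourhood that
  it completes. It has \<open>k + 2\<close> colours, so a vertex of degree two is just one colour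
  short. Hence the reductions remove paths of such vertices, sometimes together with one or two
  vertices joining them, and gain the missing colour by making the neighbourhood at one end rainbow
  beforehand. Smaller graphs are always induced subgraphs with unchanged lists. No edge is added, so
  the vertex order stays admissible, and degrees only drop relative to the lists. Any two vertices
  of a 5-cycle are at distance at most two, so it needs five colours. Attached to the rest at two
  non-adjacent vertices it cannot be reduced by itself either, and it is carried through the
  induction as a shape of its own. On the topological side the obstacle is that the outer face
  surrounds the drawing. An inversion at a point of the drawing moves infinity to 0 and turns the
  outer face into a simply connected domain.\<close>

definition conflict_free :: "('v \<Rightarrow> 'c) \<Rightarrow> 'v set \<Rightarrow> bool" where
  "conflict_free \<phi> A \<longleftrightarrow> (\<exists>u\<in>A. \<forall>w\<in>A. \<phi> w = \<phi> u \<longrightarrow> w = u)"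

lemma conflict_freeI: "u \<in> A \<Longrightarrow> (\<And>w. w \<in> A \<Longrightarrow> w \<noteq> u \<Longrightarrow> \<phi> w \<noteq> \<phi> u) \<Longrightarrow> conflict_free \<phi> A"
  unfolding conflict_free_def by blast

lemma conflict_free_cong: "(\<And>x. x \<in> A \<Longrightarrow> \<phi> x = \<psi> x) \<Longrightarrow> conflict_free \<phi> A \<longleftrightarrow> conflict_free \<psi> A"
  unfolding conflict_free_def by auto

lemma conflict_free_singleton [simp]: "conflict_free \<phi> {v}"
  unfolding conflict_free_def by auto

lemma conflict_free_doubleton: "u \<noteq> v \<Longrightarrow> conflict_free \<phi> {u, v} \<longleftrightarrow> \<phi> u \<noteq> \<phi> v"
  unfolding conflict_free_def by auto

lemma conflict_free_two_colors: "finite A \<Longrightarrow> card A = 2 \<Longrightarrow> conflict_free \<phi> A \<longleftrightarrow> inj_on \<phi> A"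
  by (elim card_2_iff[THEN iffD1, elim_format] exE conjE) (simp add: conflict_free_doubleton)

text \<open>For the at most two neighbours that an end of a removed path keeps, being conflict-free
  in the smaller graph already means being rainbow. This is the source of the \<open>safe\<close>
  neighbourhoods in the reductions.\<close>

lemma inj_on_cf_small:
  assumes "finite A" "card A \<le> 2" "A \<noteq> {} \<Longrightarrow> conflict_free \<phi> A"
  shows "inj_on \<phi> A"
proof -
  consider "A = {}" | "card A = 1" | "card A = 2"
    using assms(1,2) by (metis One_nat_def card_0_eq le_SucE le_zero_eq numeral_2_eq_2)
  then show ?thesis
  proof cases
    case 2 then show ?thesis by (auto simp: card_1_singleton_iff)
  next
    case 3
    then have "A \<noteq> {}" by auto
    then show ?thesis using assms(1,3) 3 conflict_free_two_colors by blast
  qed simp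
qed

text \<open>The bound 4 is sharp: four coloured neighbours with colours \<open>a, a, b, b\<close> forbid two
  colours.\<close>

lemma conflict_free_one_forbidden:
  assumes "finite A" "card A \<le> 4" "v \<in> A"
  obtains r where "\<And>c. c \<noteq> r \<Longrightarrow> conflict_free (\<phi>(v := c)) A"
proof -
  define B where "B = A - {v}"
  have A: "A = insert v B" and v: "v \<notin> B" and fB: "finite B" and "card B \<le> 3"
    using assms by (auto simp: B_def)
  then have "card B = 0 \<or> card B = 1 \<or> card B = 2 \<or> card B = 3" by linarith
  then have "\<exists>r. \<forall>c. c \<noteq> r \<longrightarrow> conflict_free (\<phi>(v := c)) A"
  proof (elim disjE)
    assume "card B = 0"
    then have "B = {}" using fB by simp
    then show ?thesis using A by simp
  next
    assume "card B = 1"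
    then obtain x where "B = {x}" by (auto simp: card_1_singleton_iff)
    then have "conflict_free (\<phi>(v := c)) A" if "c \<noteq> \<phi> x" for c
      using that v A by (intro conflict_freeI[of v]) auto
    then show ?thesis by blast
  next
    assume "card B = 2"
    then obtain x y where B: "B = {x, y}" "x \<noteq> y" by (auto simp: card_2_iff)
    show ?thesis
    proof (cases "\<phi> x = \<phi> y")
      case True
      then have "conflict_free (\<phi>(v := c)) A" if "c \<noteq> \<phi> x" for c
        using that v A B by (intro conflict_freeI[of v]) auto
      then show ?thesis by blast
    next
      case False
      have "conflict_free (\<phi>(v := c)) A" for c
        using False v A B
        by (cases "c = \<phi> x") ((rule conflict_freeI[of y]; auto), (rule conflict_freeI[of x]; auto))
      then show ?thesis by blast
    qed
  next
    assume "card B = 3"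
    then obtain x y z where B: "B = {x, y, z}" "x \<noteq> y" "x \<noteq> z" "y \<noteq> z"
      by (auto simp: card_3_iff)
    \<comment> \<open>If two of the three agree, then either all agree and \<open>v\<close> only has
      to differ from them, or the third colour is unique and \<open>v\<close> only has to leave it
      so.\<close>
    have *: "\<exists>r. \<forall>c. c \<noteq> r \<longrightarrow> conflict_free (\<phi>(v := c)) A"
      if "B = {x, y, z}" "x \<noteq> y" "x \<noteq> z" "y \<noteq> z" "\<phi> x = \<phi> y" for x y z
    proof (cases "\<phi> z = \<phi> x")
      case True
      then have "conflict_free (\<phi>(v := c)) A" if "c \<noteq> \<phi> x" for c
        using that v A \<open>B = {x, y, z}\<close> \<open>\<phi> x = \<phi> y\<close> by (intro conflict_freeI[of v]) auto
      then show ?thesis by blast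
    next
      case False
      then have "conflict_free (\<phi>(v := c)) A" if "c \<noteq> \<phi> z" for c
        using that v A \<open>B = {x, y, z}\<close> \<open>\<phi> x = \<phi> y\<close> by (intro conflict_freeI[of z]) auto
      then show ?thesis by blast
    qed
    show ?thesis
    proof (cases "\<phi> x = \<phi> y \<or> \<phi> x = \<phi> z \<or> \<phi> y = \<phi> z")
      case True
      then show ?thesis
      proof (elim disjE)
        assume "\<phi> x = \<phi> y" then show ?thesis using *[of x y z] B by simp
      next
        assume "\<phi> x = \<phi> z"
        moreover have "B = {x, z, y}" using B by auto
        ultimately show ?thesis using *[of x z y] B by simp
      next
        assume "\<phi> y = \<phi> z"
        moreover have "B = {y, z, x}" using B by auto
        ultimately show ?thesis using *[of y z x] B by simp
      qed
    next
      case False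
      have "conflict_free (\<phi>(v := c)) A" for c
        using False v A B
        by (cases "c = \<phi> x") ((rule conflict_freeI[of y]; auto), (rule conflict_freeI[of x]; auto))
      then show ?thesis by blast
    qed
  qed
  then show ?thesis using that by blast
qed

text \<open>A neighbourhood whose coloured part is \<open>safe\<close> stays conflict-free whatever colour
  its last vertex receives.\<close>

definition safe :: "('v \<Rightarrow> 'c) \<Rightarrow> 'v set \<Rightarrow> bool" where
  "safe \<phi> A \<longleftrightarrow> inj_on \<phi> A \<and> (\<exists>u\<in>A. \<exists>w\<in>A. u \<noteq> w)"

lemma safe_cong: "(\<And>x. x \<in> A \<Longrightarrow> \<phi> x = \<psi> x) \<Longrightarrow> safe \<phi> A \<longleftrightarrow> safe \<psi> A"
  unfolding safe_def by (metis inj_on_cong)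

text \<open>The colour of \<open>v\<close> can agree with only one of two differently coloured
  vertices, and the other one keeps a unique colour.\<close>

lemma conflict_free_safe:
  assumes "safe \<phi> (A - {v})"
  shows "conflict_free \<phi> A"
proof -
  obtain u w where uw: "u \<in> A - {v}" "w \<in> A - {v}" "u \<noteq> w" and inj: "inj_on \<phi> (A - {v})"
    using assms unfolding safe_def by blast
  then have ne: "\<phi> u \<noteq> \<phi> w" by (auto simp: inj_on_def)
  show ?thesis
  proof (cases "\<phi> v = \<phi> u")
    case True
    show ?thesis
    proof (rule conflict_freeI[of w])
      fix x assume "x \<in> A" "x \<noteq> w"
      then show "\<phi> x \<noteq> \<phi> w"
        using True ne inj_onD[OF inj, of x w] uw by (cases "x = v") auto
    qed (use uw in auto)
  next
    case False
    show ?thesis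
    proof (rule conflict_freeI[of u])
      fix x assume "x \<in> A" "x \<noteq> u"
      then show "\<phi> x \<noteq> \<phi> u"
        using False inj_onD[OF inj, of x u] uw by (cases "x = v") auto
    qed (use uw in auto)
  qed
qed

lemma safe_insertI: "inj_on \<phi> (insert x A) \<Longrightarrow> x \<notin> A \<Longrightarrow> A \<noteq> {} \<Longrightarrow> safe \<phi> (insert x A)"
  unfolding safe_def by (auto simp del: inj_on_insert)

text \<open>The ends may coincide here, so that a path returning to its starting vertex is covered
  too; \<open>chain\<close> is the version with distinct ends.\<close>

fun path_nbrs :: "('v \<Rightarrow> 'v set) \<Rightarrow> 'v \<Rightarrow> 'v list \<Rightarrow> 'v \<Rightarrow> bool" where
  "path_nbrs N s [] t \<longleftrightarrow> True"
| "path_nbrs N s (x # xs) t \<longleftrightarrow> N x = {s, hd (xs @ [t])} \<and> path_nbrs N x xs t"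

lemma path_nbrs_append: "path_nbrs N s (xs @ y # ys) t \<longleftrightarrow> path_nbrs N s xs y \<and> N y = {last (s # xs), hd (ys @ [t])} \<and> path_nbrs N y ys t"
  by (induction xs arbitrary: s) (auto simp: hd_append)

lemma path_nbrs_rev: "path_nbrs N s xs t \<Longrightarrow> path_nbrs N t (rev xs) s"
proof (induction xs arbitrary: s)
  case (Cons x xs)
  then have "path_nbrs N t (rev xs) x" "N x = {s, hd (xs @ [t])}" by auto
  moreover have "last (t # rev xs) = hd (xs @ [t])" by (cases xs) auto
  ultimately show ?case by (auto simp: path_nbrs_append insert_commute)
qed auto

definition chain :: "('v \<Rightarrow> 'v set) \<Rightarrow> 'v \<Rightarrow> 'v list \<Rightarrow> 'v \<Rightarrow> bool" where
  "chain N s xs t \<longleftrightarrow> xs \<noteq> [] \<and> distinct (s # xs @ [t]) \<and> path_nbrs N s xs t"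

lemma chain_rev: "chain N s xs t \<Longrightarrow> chain N t (rev xs) s"
  unfolding chain_def by (auto simp: path_nbrs_rev)

lemma path_nbrs_nbrs:
  assumes "path_nbrs N s xs t" "x \<in> set xs"
  shows "N x \<subseteq> {s, t} \<union> set xs" "N x \<noteq> {}"
  using assms
proof (induction xs arbitrary: s)
  case (Cons y xs)
  {
    case 1 then show ?case using Cons.IH(1)[of y] by (cases xs) auto
  next
    case 2 then show ?case using Cons.IH(2)[of y] by auto
  }
qed auto

lemma path_nbrs_next:
  assumes "path_nbrs N s xs t" "x \<in> set xs" "distinct (s # xs @ [t])"
  obtains w where "w \<in> N x" "w \<in> set xs \<or> w = t"
  using assms by (induction xs arbitrary: s) (force simp: hd_append split: if_splits)+

lemma chain_nbrs_left:
  assumes "chain N s xs t" "x \<in> set xs" "s \<in> N x"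
  shows "x = hd xs"
proof -
  obtain y ys where xs: "xs = y # ys" using assms unfolding chain_def by (cases xs) auto
  have "x = y"
  proof (rule ccontr)
    assume "x \<noteq> y"
    then have x: "x \<in> set ys" using assms xs by auto
    then have "N x \<subseteq> {y, t} \<union> set ys"
      using assms xs path_nbrs_nbrs[of N y ys t x] unfolding chain_def by auto
    then show False using assms xs unfolding chain_def by auto
  qed
  then show ?thesis using xs by simp
qed

lemma chain_hd: "chain N s xs t \<Longrightarrow> s \<in> N (hd xs)"
  unfolding chain_def by (cases xs) auto

lemma chain_nbrs_right:
  assumes "chain N s xs t" "x \<in> set xs" "t \<in> N x"
  shows "x = last xs"
  using chain_nbrs_left[OF chain_rev[OF assms(1)], of x] assms by (simp add: hd_rev)

lemma chain_last: "chain N s xs t \<Longrightarrow> t \<in> N (last xs)"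
  using chain_hd[OF chain_rev] by (metis hd_rev)

section \<open>Partial colourings\<close>

lemma pick_color:
  assumes "finite F" "card F < card M"
  obtains c where "c \<in> M" "c \<notin> F"
  using assms by (meson card_mono linorder_not_less subsetI)

lemma pick_fresh:
  assumes "length xs < card M"
  obtains c where "c \<in> M" "c \<notin> set xs"
proof -
  have "card (set xs) < card M" using assms card_length[of xs] by linarith
  then show ?thesis using pick_color[of "set xs" M] that by blast
qed

text \<open>The lists are bounded from below only, so that an induced subgraph with the same lists
  is again an instance.\<close>

locale list_graph =
  fixes V :: "'v set" and N :: "'v \<Rightarrow> 'v set" and L :: "'v \<Rightarrow> 'c set"
  assumes finite_V: "finite V"
    and N_sub: "N v \<subseteq> V"
    and N_outside: "v \<notin> V \<Longrightarrow> N v = {}"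
    and N_sym: "u \<in> N v \<Longrightarrow> v \<in> N u"
    and N_irrefl: "v \<notin> N v"
    and N_card: "card (N v) \<le> 4"
    and L_card: "v \<in> V \<Longrightarrow> card (N v) + 2 \<le> card (L v)"
begin

lemma finite_N [simp]: "finite (N v)"
  using finite_V N_sub finite_subset by blast

lemma N_commute: "u \<in> N v \<longleftrightarrow> v \<in> N u"
  using N_sym by blast

lemma in_V_if_nbr: "u \<in> N v \<Longrightarrow> u \<in> V" "u \<in> N v \<Longrightarrow> v \<in> V"
  using N_sub N_outside by blast+

text \<open>\<open>sub W \<phi>\<close> says that \<open>\<phi>\<close> solves the problem on the subgraph induced by \<open>W\<close>, while
  \<open>good D \<phi>\<close> says that \<open>\<phi>\<close> is a partial solution on the whole graph whose coloured vertices
  form the set \<open>D\<close>: only completely coloured neighbourhoods have to be conflict-free.\<close>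

definition sub :: "'v set \<Rightarrow> ('v \<Rightarrow> 'c) \<Rightarrow> bool" where
  "sub W \<phi> \<longleftrightarrow> (\<forall>v\<in>W. \<phi> v \<in> L v \<and> (\<forall>u\<in>N v \<inter> W. \<phi> u \<noteq> \<phi> v) \<and>
     (N v \<inter> W \<noteq> {} \<longrightarrow> conflict_free \<phi> (N v \<inter> W)))"

definition good :: "'v set \<Rightarrow> ('v \<Rightarrow> 'c) \<Rightarrow> bool" where
  "good D \<phi> \<longleftrightarrow> D \<subseteq> V \<and> (\<forall>v\<in>D. \<phi> v \<in> L v \<and> (\<forall>u\<in>N v \<inter> D. \<phi> u \<noteq> \<phi> v)) \<and>
     (\<forall>v. N v \<noteq> {} \<longrightarrow> N v \<subseteq> D \<longrightarrow> conflict_free \<phi> (N v))"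

lemma sub_if_good: "good V \<phi> \<Longrightarrow> sub V \<phi>"
  unfolding good_def sub_def using N_sub by (metis inf.absorb1)

text \<open>A coloured vertex with completely coloured neighbourhood has the same neighbourhood in
  the subgraph on \<open>D\<close>. Only uncoloured vertices can bring a new condition.\<close>

lemma good_if_sub:
  assumes "sub D \<phi>" "D \<subseteq> V" "\<And>v. v \<in> V - D \<Longrightarrow> N v \<noteq> {} \<Longrightarrow> N v \<subseteq> D \<Longrightarrow> conflict_free \<phi> (N v)"
  shows "good D \<phi>"
  unfolding good_def
proof (intro conjI allI impI)
  fix v assume v: "N v \<noteq> {}" "N v \<subseteq> D"
  then have "v \<in> V" using N_outside by blast
  show "conflict_free \<phi> (N v)"
  proof (cases "v \<in> D")
    case True
    then show ?thesis using assms(1) v unfolding sub_def by (metis inf.absorb1)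
  qed (use assms(3) v \<open>v \<in> V\<close> in blast)
qed (use assms in \<open>auto simp: sub_def\<close>)

lemma good_proper: "good D \<phi> \<Longrightarrow> u \<in> D \<Longrightarrow> v \<in> D \<Longrightarrow> u \<in> N v \<Longrightarrow> \<phi> u \<noteq> \<phi> v"
  unfolding good_def by blast

lemma good_conflict_free: "good D \<phi> \<Longrightarrow> N v \<noteq> {} \<Longrightarrow> N v \<subseteq> D \<Longrightarrow> conflict_free \<phi> (N v)"
  unfolding good_def by blast

lemma good_step:
  assumes g: "good D \<phi>" and v: "v \<in> V" "v \<notin> D" and c: "c \<in> L v" "c \<notin> \<phi> ` (N v \<inter> D)"
    and cl: "\<And>u. u \<in> N v \<Longrightarrow> N u \<subseteq> insert v D \<Longrightarrow> conflict_free (\<phi>(v := c)) (N u)"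
  shows "good (insert v D) (\<phi>(v := c))"
  unfolding good_def
proof (intro conjI allI impI ballI)
  fix u assume u: "N u \<noteq> {}" "N u \<subseteq> insert v D"
  show "conflict_free (\<phi>(v := c)) (N u)"
  proof (cases "v \<in> N u")
    case True then show ?thesis using cl[of u] u N_commute by blast
  next
    case False
    then have "conflict_free \<phi> (N u)" using g u unfolding good_def by blast
    then show ?thesis using False by (subst conflict_free_cong[of _ _ \<phi>]) auto
  qed
next
  fix x y assume "x \<in> insert v D" "y \<in> N x \<inter> insert v D"
  then show "(\<phi>(v := c)) y \<noteq> (\<phi>(v := c)) x"
    using g v c N_irrefl N_commute unfolding good_def by (cases "x = v"; cases "y = v") auto
qed (use g v c in \<open>auto simp: good_def\<close>)

lemma chain_vertex:
  assumes "chain N s xs t" "x \<in> set xs"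
  shows "x \<in> V" "card (N x) = 2" "4 \<le> card (L x)"
proof -
  have "path_nbrs N s xs t \<Longrightarrow> x \<in> set xs \<Longrightarrow> distinct (s # xs @ [t]) \<Longrightarrow> card (N x) = 2"
    for s
    by (induction xs arbitrary: s) (auto simp: hd_append card_insert_if split: if_splits)
  then show c: "card (N x) = 2" using assms unfolding chain_def by blast
  then show "x \<in> V" using N_outside by fastforce
  then show "4 \<le> card (L x)" using L_card[of x] c by auto
qed

lemma chain_nbrs:
  assumes "chain N s xs t"
  shows "N s \<inter> set xs = {hd xs}" "N t \<inter> set xs = {last xs}"
    "u \<notin> {s, t} \<union> set xs \<Longrightarrow> N u \<inter> set xs = {}"
proof -
  have ne: "xs \<noteq> []" using assms unfolding chain_def by simp
  show "N s \<inter> set xs = {hd xs}" "N t \<inter> set xs = {last xs}"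
    using chain_nbrs_left[OF assms] chain_hd[OF assms] chain_nbrs_right[OF assms] chain_last[OF assms] ne
      N_commute by auto
  show "u \<notin> {s, t} \<union> set xs \<Longrightarrow> N u \<inter> set xs = {}"
    using path_nbrs_nbrs(1)[of N s xs t] assms N_commute unfolding chain_def by blast
qed

text \<open>The chain is coloured from \<open>s\<close> towards \<open>t\<close>. Behind its first
  vertex \<open>x\<close> the rest is a chain starting at \<open>x\<close>, and the neighbourhood of
  \<open>x\<close> takes over the role of \<open>N s\<close>; for this recursion the first colour is
  a parameter. It has to avoid \<open>\<phi> t\<close> if \<open>t\<close> is the next vertex or the
  one after it.\<close>

lemma chain_extend:
  assumes "chain N s xs t" "good D \<phi>" "s \<in> D" "t \<in> D" "D \<inter> set xs = {}"
    and "c \<in> L (hd xs)" "c \<noteq> \<phi> s" "length xs \<le> 2 \<Longrightarrow> c \<noteq> \<phi> t"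
    and "N s \<subseteq> insert (hd xs) D \<Longrightarrow> conflict_free (\<phi>(hd xs := c)) (N s)"
    and "N t \<subseteq> insert (last xs) D \<Longrightarrow> safe \<phi> (N t \<inter> D)"
  obtains \<phi>' where "good (D \<union> set xs) \<phi>'" "\<And>u. u \<in> D \<Longrightarrow> \<phi>' u = \<phi> u" "\<phi>' (hd xs) = c"
proof -
  have "\<exists>\<phi>'. good (D \<union> set xs) \<phi>' \<and> (\<forall>u\<in>D. \<phi>' u = \<phi> u) \<and> \<phi>' (hd xs) = c"
    using assms
  proof (induction xs arbitrary: s D \<phi> c)
    case Nil then show ?case by (simp add: chain_def)
  next
    case (Cons x xs)
    have x: "x \<in> V" using chain_vertex[OF Cons.prems(1)] by auto
    have st: "s \<noteq> t" and dist: "distinct (s # x # xs @ [t])"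
      using Cons.prems(1) unfolding chain_def by auto
    have Nt: "N t \<inter> set (x # xs) = {last (x # xs)}" using chain_nbrs[OF Cons.prems(1)] by blast
    show ?case
    proof (cases "xs = []")
      case True
      have Nx: "N x = {s, t}" using Cons.prems(1) True unfolding chain_def by auto
      have "conflict_free (\<phi>(x := c)) (N u)" if u: "u \<in> N x" "N u \<subseteq> insert x D" for u
      proof (cases "u = s")
        case True then show ?thesis using Cons.prems(9) u by (simp add: fun_upd_def)
      next
        case False
        then have ut: "u = t" using u Nx by auto
        then have "safe \<phi> (N t \<inter> D)" using Cons.prems(10) u \<open>xs = []\<close> by simp
        moreover have "N t \<inter> D = N t - {x}" using u ut Cons.prems(5) by auto
        ultimately have "safe (\<phi>(x := c)) (N t - {x})" by (subst safe_cong[of _ _ \<phi>]) auto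
        then show ?thesis unfolding ut by (rule conflict_free_safe)
      qed
      then have "good (insert x D) (\<phi>(x := c))"
        using Cons.prems x Nx True by (intro good_step) auto
      then show ?thesis using True Cons.prems(5) by (intro exI[of _ "\<phi>(x := c)"]) (auto simp: fun_upd_def)
    next
      case False
      define y where "y = hd xs"
      have y: "y \<in> set xs" using False y_def by simp
      have Nx: "N x = {s, y}" using Cons.prems(1) False unfolding chain_def y_def by auto
      have chain': "chain N x xs t" using Cons.prems(1) False unfolding chain_def by auto
      have yD: "y \<notin> D" "x \<notin> D" using y Cons.prems(5) by auto
      have Ny: "length xs = 1 \<Longrightarrow> N y = {x, t}" "length xs \<ge> 2 \<Longrightarrow> \<not> N y \<subseteq> insert x D"
      proof -
        obtain zs where xs: "xs = y # zs" using False y_def by (cases xs) auto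
        { assume "length xs = 1"
          then show "N y = {x, t}" using xs chain' unfolding chain_def by auto }
        { assume "length xs \<ge> 2"
          then obtain z ws where "zs = z # ws" using xs by (cases zs) auto
          then have "N y = {x, z}" "z \<notin> D" "z \<noteq> x" using xs chain' Cons.prems(5) dist
            unfolding chain_def by auto
          then show "\<not> N y \<subseteq> insert x D" by auto }
      qed
      have "conflict_free (\<phi>(x := c)) (N u)" if u: "u \<in> N x" "N u \<subseteq> insert x D" for u
      proof (cases "u = s")
        case True then show ?thesis using Cons.prems(9) u by (simp add: fun_upd_def)
      next
        case False
        then have uy: "u = y" using u Nx by auto
        then have "\<not> length xs \<ge> 2" using Ny(2) u(2) by auto
        moreover have "length xs \<noteq> 0" using \<open>xs \<noteq> []\<close> by simp
        ultimately have l: "length xs = 1" by linarith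
        then have "N u = {x, t}" "x \<noteq> t" using Ny(1) uy dist by auto
        then show ?thesis using Cons.prems(8) l by (simp add: conflict_free_doubleton)
      qed
      then have g: "good (insert x D) (\<phi>(x := c))"
        using Cons.prems x Nx yD by (intro good_step) auto
      \<comment> \<open>The colour of \<open>y\<close> must differ from that of \<open>x\<close> for
        properness, from that of \<open>s\<close> because of \<open>N x = {s, y}\<close>, and from
        that of \<open>t\<close> in case the end is near.\<close>
      have "4 \<le> card (L y)" using chain_vertex[OF Cons.prems(1)] y by auto
      then obtain d where d: "d \<in> L y" "d \<notin> set [c, \<phi> s, \<phi> t]"
        using pick_fresh[of "[c, \<phi> s, \<phi> t]" "L y"] by auto
      have "\<exists>\<phi>'. good (insert x D \<union> set xs) \<phi>' \<and> (\<forall>u\<in>insert x D. \<phi>' u = (\<phi>(x := c)) u) \<and> \<phi>' (hd xs) = d"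
      proof (rule Cons.IH[OF chain' g])
        show "N x \<subseteq> insert (hd xs) (insert x D) \<Longrightarrow> conflict_free ((\<phi>(x := c))(hd xs := d)) (N x)"
          using Nx d yD Cons.prems(3) dist y unfolding y_def[symmetric]
          by (subst Nx, subst conflict_free_doubleton) auto
        assume "N t \<subseteq> insert (last xs) (insert x D)"
        moreover have "x \<notin> N t"
        proof
          assume "x \<in> N t"
          then have "x = last xs" using Nt False by auto
          then show False using last_in_set[OF False] dist by auto
        qed
        ultimately have "N t \<subseteq> insert (last xs) D" by blast
        then have "safe \<phi> (N t \<inter> D)" using Cons.prems(10) False by simp
        then show "safe (\<phi>(x := c)) (N t \<inter> insert x D)"
          using \<open>x \<notin> N t\<close> yD by (subst safe_cong[of _ _ \<phi>]) auto
      qed (use Cons.prems d y_def yD dist in auto)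
      then obtain \<phi>' where "good (insert x D \<union> set xs) \<phi>'" "\<forall>u\<in>insert x D. \<phi>' u = (\<phi>(x := c)) u"
        by blast
      then show ?thesis using yD by (intro exI[of _ \<phi>']) auto
    qed
  qed
  then show ?thesis using that by blast
qed

text \<open>The first vertex has four colours and avoids three: those of both ends and the one that
  could spoil \<open>N s\<close>. Nothing is left to protect \<open>N t\<close>, hence the premise
  at that end only.\<close>

lemma chain_solve:
  assumes ch: "chain N s xs t" and g: "good D \<phi>" and D: "s \<in> D" "t \<in> D" "D \<inter> set xs = {}"
    and t: "N t \<subseteq> insert (last xs) D \<Longrightarrow> safe \<phi> (N t \<inter> D)"
  obtains \<phi>' where "good (D \<union> set xs) \<phi>'" "\<And>u. u \<in> D \<Longrightarrow> \<phi>' u = \<phi> u"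
proof -
  have ne: "xs \<noteq> []" using ch by (simp add: chain_def)
  have "hd xs \<in> N s" using chain_hd[OF ch] N_commute by blast
  then obtain r where r: "\<And>c. c \<noteq> r \<Longrightarrow> conflict_free (\<phi>(hd xs := c)) (N s)"
    using conflict_free_one_forbidden[of "N s" "hd xs" \<phi>] N_card by auto
  have "4 \<le> card (L (hd xs))" using chain_vertex[OF ch] ne by auto
  then obtain c where c: "c \<in> L (hd xs)" "c \<notin> set [\<phi> s, \<phi> t, r]"
    using pick_fresh[of "[\<phi> s, \<phi> t, r]" "L (hd xs)"] by auto
  show ?thesis
    by (rule chain_extend[OF ch g D, of c]) (use c r t that in auto)
qed

end

section \<open>Links\<close>

text \<open>The possible shapes of the part of the graph between two vertices \<open>s\<close> and \<open>t\<close>: no edge,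
  an edge, a path of 2-vertices without or with the edge \<open>st\<close>, and a 5-cycle through \<open>s\<close> and \<open>t\<close>
  whose other three vertices have degree 2.\<close>

datatype 'v link = NoLink | Edge | Path "'v list" | Ear "'v list" | Pent 'v 'v 'v

fun link_verts :: "'v link \<Rightarrow> 'v set" where
  "link_verts NoLink = {}"
| "link_verts Edge = {}"
| "link_verts (Path xs) = set xs"
| "link_verts (Ear xs) = set xs"
| "link_verts (Pent x y z) = {x, y, z}"

fun rev_link :: "'v link \<Rightarrow> 'v link" where
  "rev_link NoLink = NoLink"
| "rev_link Edge = Edge"
| "rev_link (Path xs) = Path (rev xs)"
| "rev_link (Ear xs) = Ear (rev xs)"
| "rev_link (Pent x y z) = Pent x z y"

text \<open>The neighbours of the left end within the link, the right end included if adjacent. In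
  \<open>Pent x y z\<close> the vertex \<open>x\<close> is the common neighbour of the ends, while
  \<open>y\<close> and \<open>z\<close> form the longer way from left to right.\<close>

fun left_nbrs :: "'v link \<Rightarrow> 'v \<Rightarrow> 'v set" where
  "left_nbrs NoLink t = {}"
| "left_nbrs Edge t = {t}"
| "left_nbrs (Path xs) t = {hd xs}"
| "left_nbrs (Ear xs) t = {t, hd xs}"
| "left_nbrs (Pent x y z) t = {x, y}"

abbreviation right_nbrs :: "'v link \<Rightarrow> 'v \<Rightarrow> 'v set" where
  "right_nbrs l s \<equiv> left_nbrs (rev_link l) s"

lemma link_verts_rev [simp]: "link_verts (rev_link l) = link_verts l"
  by (cases l) auto

lemma rev_link_rev [simp]: "rev_link (rev_link l) = l"
  by (cases l) auto

lemma rev_link_eq [simp]: "rev_link l = NoLink \<longleftrightarrow> l = NoLink" "rev_link l = Edge \<longleftrightarrow> l = Edge"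
  by (cases l; simp)+

lemma finite_link_verts [simp]: "finite (link_verts l)"
  by (cases l) auto

lemma finite_left_nbrs [simp]: "finite (left_nbrs l t)"
  by (cases l) auto

context list_graph
begin

fun link :: "'v link \<Rightarrow> 'v \<Rightarrow> 'v \<Rightarrow> bool" where
  "link NoLink s t \<longleftrightarrow> t \<notin> N s"
| "link Edge s t \<longleftrightarrow> t \<in> N s"
| "link (Path xs) s t \<longleftrightarrow> chain N s xs t \<and> t \<notin> N s"
| "link (Ear xs) s t \<longleftrightarrow> chain N s xs t \<and> t \<in> N s"
| "link (Pent x y z) s t \<longleftrightarrow> chain N s [x] t \<and> chain N s [y, z] t \<and> x \<noteq> y \<and> x \<noteq> z \<and> t \<notin> N s"

lemma chain2_swap: "chain N s [y, z] t \<Longrightarrow> chain N t [z, y] s"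
  using chain_rev[of N s "[y, z]" t] by simp

lemma chain1_swap: "chain N s [x] t \<Longrightarrow> chain N t [x] s"
  using chain_rev[of N s "[x]" t] by simp

lemma link_rev: "link l s t \<Longrightarrow> link (rev_link l) t s"
  using N_commute by (cases l) (auto intro: chain_rev chain1_swap chain2_swap)

lemma link_chain:
  assumes "link l s t" "x \<in> link_verts l"
  obtains xs where "chain N s xs t" "x \<in> set xs" "set xs \<subseteq> link_verts l"
proof (cases l)
  case (Pent u v w)
  then show ?thesis using that[of "[u]"] that[of "[v, w]"] assms by auto
qed (use assms that in auto)

lemma link_nbrs_left:
  assumes "link l s t"
  shows "N s \<inter> (link_verts l \<union> {t}) = left_nbrs l t"
proof (cases l)
  case (Path xs)
  then show ?thesis using assms chain_nbrs(1)[of s xs t] by auto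
next
  case (Ear xs)
  then show ?thesis using assms chain_nbrs(1)[of s xs t] by auto
next
  case (Pent x y z)
  then show ?thesis using assms chain_nbrs(1)[of s "[x]" t] chain_nbrs(1)[of s "[y, z]" t] by auto
qed (use assms in auto)

lemma link_nbrs_right: "link l s t \<Longrightarrow> N t \<inter> (link_verts l \<union> {s}) = right_nbrs l s"
  using link_nbrs_left[OF link_rev] by simp

lemma link_inner_nbrs:
  assumes "link l s t" "x \<in> link_verts l"
  shows "N x \<subseteq> {s, t} \<union> link_verts l" "card (N x) = 2" "x \<in> V" "x \<noteq> s" "x \<noteq> t"
proof -
  obtain xs where xs: "chain N s xs t" "x \<in> set xs" "set xs \<subseteq> link_verts l" using link_chain[OF assms] .
  then show "N x \<subseteq> {s, t} \<union> link_verts l" "x \<noteq> s" "x \<noteq> t"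
    using path_nbrs_nbrs(1)[of N s xs t x] unfolding chain_def by auto
  show "card (N x) = 2" "x \<in> V" using chain_vertex[OF xs(1,2)] by auto
qed

lemma link_far_nbrs: "link l s t \<Longrightarrow> u \<notin> {s, t} \<union> link_verts l \<Longrightarrow> N u \<inter> link_verts l = {}"
  using link_inner_nbrs(1) N_commute by blast

lemma link_inner_next:
  assumes "link l s t" "x \<in> link_verts l"
  obtains w where "w \<in> N x" "w \<in> link_verts l \<union> {t}"
proof -
  obtain xs where xs: "chain N s xs t" "x \<in> set xs" "set xs \<subseteq> link_verts l" using link_chain[OF assms] .
  then obtain w where "w \<in> N x" "w \<in> set xs \<or> w = t"
    unfolding chain_def by (meson path_nbrs_next)
  then show ?thesis using that xs(3) by blast
qed

lemma link_inner_prev: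
  assumes "link l s t" "x \<in> link_verts l"
  obtains w where "w \<in> N x" "w \<in> link_verts l \<union> {s}"
  using link_inner_next[OF link_rev[OF assms(1)], of x] assms(2) by auto

lemma left_nbrs_nonempty: "l \<noteq> NoLink \<Longrightarrow> left_nbrs l t \<noteq> {}"
  by (cases l) auto

lemma left_nbrs_subset: "link l s t \<Longrightarrow> left_nbrs l t \<subseteq> link_verts l \<union> {t}"
  using link_nbrs_left by blast

lemma inner_not_ends: "link l s t \<Longrightarrow> s \<notin> link_verts l \<and> t \<notin> link_verts l"
  using link_inner_nbrs(4,5) by blast

text \<open>The colours of the ends are fixed and the neighbourhood of \<open>s\<close> may be completed;
  the premise on \<open>t\<close> makes completing the neighbourhood of \<open>t\<close> harmless.\<close>

lemma link_solve:
  assumes l: "link l s t" and g: "good D \<phi>" and D: "s \<in> D" "t \<in> D" "D \<inter> link_verts l = {}"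
    and st: "\<phi> s \<noteq> \<phi> t"
    and pe: "\<And>xs. l = Path xs \<or> l = Ear xs \<Longrightarrow> N t \<subseteq> D \<union> link_verts l \<Longrightarrow> safe \<phi> (N t \<inter> D)"
    and pent: "\<And>x y z. l = Pent x y z \<Longrightarrow> N t \<subseteq> D \<union> link_verts l \<Longrightarrow>
      inj_on \<phi> (N t \<inter> D) \<and> N t \<inter> D \<noteq> {} \<and> (\<exists>e\<in>L x. e \<noteq> \<phi> s \<and> e \<noteq> \<phi> t \<and> e \<notin> \<phi> ` (N t \<inter> D))"
  obtains \<phi>' where "good (D \<union> link_verts l) \<phi>'" "\<And>u. u \<in> D \<Longrightarrow> \<phi>' u = \<phi> u"
proof -
  note finish = that
  have *: thesis if l': "l = Path xs \<or> l = Ear xs" for xs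
  proof -
    have ch: "chain N s xs t" using l l' by auto
    then have "xs \<noteq> []" by (simp add: chain_def)
    then have "insert (last xs) D \<subseteq> D \<union> link_verts l" using l' by auto
    then have safe: "N t \<subseteq> insert (last xs) D \<Longrightarrow> safe \<phi> (N t \<inter> D)"
      using pe[OF l'] by blast
    have "D \<inter> set xs = {}" and i: "link_verts l = set xs" using D(3) l' by auto
    then obtain \<phi>' where "good (D \<union> set xs) \<phi>'" "\<And>u. u \<in> D \<Longrightarrow> \<phi>' u = \<phi> u"
      using chain_solve[OF ch g D(1,2) _ safe] by blast
    then show ?thesis using finish[of \<phi>'] i by simp
  qed
  show ?thesis
  proof (cases l)
    case (Pent x y z)
    have cx: "chain N s [x] t" and cy: "chain N s [y, z] t" and ne: "x \<noteq> y" "x \<noteq> z"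
      using l Pent by auto
    have Nx: "N x = {s, t}" and Nyz: "N y = {s, z}" "N z = {y, t}" using cx cy unfolding chain_def by auto
    have x: "x \<in> V" "4 \<le> card (L x)" using chain_vertex[OF cx] by auto
    have Nt: "x \<in> N t" "z \<in> N t" "x \<in> N s" "y \<in> N s"
      using Nx Nyz N_commute by auto
    have notD: "x \<notin> D" "y \<notin> D" "z \<notin> D" using D Pent by auto
    \<comment> \<open>The short side of the pentagon is coloured first. Its colour \<open>e\<close>
      must not repeat one at \<open>N t\<close> in case the link completes that neighbourhood; then
      the long side is a chain with a safe end.\<close>
    obtain e where e: "e \<in> L x" "e \<noteq> \<phi> s" "e \<noteq> \<phi> t"
      and e': "N t \<subseteq> D \<union> link_verts l \<Longrightarrow> e \<notin> \<phi> ` (N t \<inter> D)"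
    proof (cases "N t \<subseteq> D \<union> link_verts l")
      case True
      then show ?thesis using pent[OF Pent] that by blast
    next
      case False
      then show ?thesis using pick_fresh[of "[\<phi> s, \<phi> t]" "L x"] x(2) that by auto
    qed
    have yz: "y \<noteq> z" using cy unfolding chain_def by auto
    have g': "good (insert x D) (\<phi>(x := e))"
    proof (rule good_step[OF g x(1) notD(1) e(1)])
      show "e \<notin> \<phi> ` (N x \<inter> D)" using Nx e by auto
      show "conflict_free (\<phi>(x := e)) (N u)" if "u \<in> N x" "N u \<subseteq> insert x D" for u
      proof -
        have "y \<in> N u \<or> z \<in> N u" using that Nx Nt by auto
        then show ?thesis using that notD ne by auto
      qed
    qed
    have st: "s \<noteq> t" using cx unfolding chain_def by auto
    have "x \<noteq> s" "x \<noteq> t" using cx unfolding chain_def by auto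
    have safe: "safe (\<phi>(x := e)) (N t \<inter> insert x D)" if "N t \<subseteq> insert (last [y, z]) (insert x D)"
    proof -
      have "N t \<subseteq> D \<union> link_verts l" using that Pent by auto
      then have *: "inj_on \<phi> (N t \<inter> D)" "N t \<inter> D \<noteq> {}" "e \<notin> \<phi> ` (N t \<inter> D)"
        using pent[OF Pent] e' by blast+
      have eq: "N t \<inter> insert x D = insert x (N t \<inter> D)" using Nt by auto
      have "inj_on (\<phi>(x := e)) (insert x (N t \<inter> D))"
        using * notD by (auto simp: inj_on_def)
      moreover obtain u where "u \<in> N t \<inter> D" "u \<noteq> x" using *(2) notD(1) by auto
      ultimately show ?thesis unfolding safe_def eq by auto
    qed
    obtain \<phi>' where \<phi>': "good (insert x D \<union> set [y, z]) \<phi>'"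
        "\<And>u. u \<in> insert x D \<Longrightarrow> \<phi>' u = (\<phi>(x := e)) u"
      by (rule chain_solve[OF cy g']) (use D notD ne safe in auto)
    have "insert x D \<union> set [y, z] = D \<union> link_verts l" using Pent by auto
    moreover have "\<phi>' u = \<phi> u" if "u \<in> D" for u using \<phi>'(2)[of u] that notD(1) by auto
    ultimately show ?thesis using \<phi>'(1) finish[of \<phi>'] by simp
  qed (use g that * in auto)
qed

end

section \<open>Cycles\<close>

text \<open>Each position avoids three of at least four colours. At position 1 truncated subtraction
  turns \<open>i - 2\<close> into 0, which repeats the condition for \<open>i - 1\<close>.\<close>

lemma greedy_sequence:
  fixes M :: "nat \<Rightarrow> 'c set"
  assumes "\<And>i. 1 \<le> i \<Longrightarrow> i \<le> m \<Longrightarrow> 4 \<le> card (M i)"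
  shows "\<exists>f. f 0 = c \<and> (\<forall>i\<in>{1..m}. f i \<in> M i \<and> f i \<noteq> f (i - 1) \<and> f i \<noteq> f (i - 2) \<and> f i \<noteq> c)"
  using assms
proof (induction m)
  case 0 then show ?case by (intro exI[of _ "\<lambda>_. c"]) auto
next
  case (Suc m)
  then obtain f where f: "f 0 = c"
    "\<forall>i\<in>{1..m}. f i \<in> M i \<and> f i \<noteq> f (i - 1) \<and> f i \<noteq> f (i - 2) \<and> f i \<noteq> c"
    by (metis le_SucI)
  obtain x where x: "x \<in> M (Suc m)" "x \<notin> set [f m, f (m - 1), c]"
    using pick_fresh[of "[f m, f (m - 1), c]" "M (Suc m)"] Suc.prems[of "Suc m"] by auto
  show ?case
  proof (intro exI[of _ "f(Suc m := x)"] conjI ballI)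
    fix i assume i: "i \<in> {1..Suc m}"
    let ?f = "f(Suc m := x)"
    show "?f i \<in> M i" "?f i \<noteq> ?f (i - 1)" "?f i \<noteq> ?f (i - 2)" "?f i \<noteq> c"
      using i x f by (cases "i = Suc m"; auto)+
  qed (use f in auto)
qed

lemma mod_succ:
  fixes n i :: nat
  assumes "3 \<le> n" "i < n"
  shows "(i + 1) mod n = (if i = n - 1 then 0 else i + 1)"
    "(i + 2) mod n = (if i = n - 1 then 1 else if i = n - 2 then 0 else i + 2)"
proof -
  show "(i + 1) mod n = (if i = n - 1 then 0 else i + 1)" using assms by auto
  show "(i + 2) mod n = (if i = n - 1 then 1 else if i = n - 2 then 0 else i + 2)"
  proof -
    consider "i = n - 1" | "i = n - 2" | "i + 2 < n" using assms by linarith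
    then show ?thesis
    proof cases
      case 1
      then have "i + 2 = n + 1" using assms by linarith
      then show ?thesis using 1 assms by (metis One_nat_def Suc_lessD less_le_trans mod_add_self1 mod_less numeral_3_eq_3 lessI)
    next
      case 2
      then have "i + 2 = n" using assms by linarith
      then show ?thesis using 2 assms by auto
    qed (use assms in auto)
  qed
qed

text \<open>Proper conflict-free colourings of a cycle are proper colourings of its square.\<close>

definition spread :: "nat \<Rightarrow> (nat \<Rightarrow> 'c) \<Rightarrow> bool" where
  "spread n f \<longleftrightarrow> (\<forall>i<n. f i \<noteq> f ((i + 1) mod n) \<and> f i \<noteq> f ((i + 2) mod n))"

lemma spreadI:
  assumes "3 \<le> n" "\<And>i. i + 1 < n \<Longrightarrow> f i \<noteq> f (i + 1)" "\<And>i. i + 2 < n \<Longrightarrow> f i \<noteq> f (i + 2)"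
    and "f (n - 1) \<noteq> f 0" "f (n - 1) \<noteq> f 1" "f (n - 2) \<noteq> f 0"
  shows "spread n f"
  unfolding spread_def
proof (intro allI impI)
  fix i assume i: "i < n"
  consider "i = n - 1" | "i = n - 2" "i \<noteq> n - 1" | "i + 2 < n" using i by linarith
  then show "f i \<noteq> f ((i + 1) mod n) \<and> f i \<noteq> f ((i + 2) mod n)"
    unfolding mod_succ[OF assms(1) i]
  proof cases
    case 2
    then have "i + 1 < n" "i + 1 = n - 1" using i by linarith+
    then show "f i \<noteq> f (if i = n - 1 then 0 else i + 1) \<and>
      f i \<noteq> f (if i = n - 1 then 1 else if i = n - 2 then 0 else i + 2)"
      using assms(2)[of i] assms(6) 2 by auto
  qed (use assms in auto)
qed

text \<open>Colour position 0 with \<open>c\<close> and continue greedily, avoiding \<open>c\<close>. The last position sees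
  four coloured ones, but \<open>c\<close> is not in its list.\<close>

lemma spread_list_coloring_aux:
  fixes M :: "nat \<Rightarrow> 'c set"
  assumes n: "3 \<le> n" and M: "\<And>i. i < n \<Longrightarrow> 4 \<le> card (M i)"
    and c: "c \<in> M 0" "c \<notin> M (n - 1)"
  shows "\<exists>f. (\<forall>i<n. f i \<in> M i) \<and> spread n f"
proof -
  have M': "4 \<le> card (M i)" if "1 \<le> i" "i \<le> n - 2" for i using M[of i] that n by auto
  obtain f where f: "f 0 = c"
    "\<forall>i\<in>{1..n-2}. f i \<in> M i \<and> f i \<noteq> f (i - 1) \<and> f i \<noteq> f (i - 2) \<and> f i \<noteq> c"
    using greedy_sequence[of "n - 2" M c] M'  by blast
  obtain x where x: "x \<in> M (n - 1)" "x \<notin> set [f (n - 2), f (n - 3), f 1]"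
    using pick_fresh[of "[f (n - 2), f (n - 3), f 1]" "M (n - 1)"] M[of "n - 1"] n by auto
  let ?f = "f(n - 1 := x)"
  have "spread n ?f"
  proof (rule spreadI[OF n])
    fix i assume i: "i + 1 < n"
    show "?f i \<noteq> ?f (i + 1)"
    proof (cases "i + 1 = n - 1")
      case True
      then have "i = n - 2" by linarith
      then show ?thesis using x True n by auto
    next
      case False
      then have "i + 1 \<in> {1..n-2}" using i by auto
      then have "f (i + 1) \<noteq> f i" using f(2) by fastforce
      then show ?thesis using i False by auto
    qed
  next
    fix i assume i: "i + 2 < n"
    show "?f i \<noteq> ?f (i + 2)"
    proof (cases "i + 2 = n - 1")
      case True
      then have "i = n - 3" by linarith
      then show ?thesis using x True n by auto
    next
      case False
      then have "i + 2 \<in> {1..n-2}" using i by auto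
      then have "f (i + 2) \<noteq> f i" using f(2) by fastforce
      then show ?thesis using i False by auto
    qed
  next
    have "n - 2 \<in> {1..n-2}" using n by auto
    then show "?f (n - 2) \<noteq> ?f 0" using f n by auto
    show "?f (n - 1) \<noteq> ?f 0" using x c f n by auto
    show "?f (n - 1) \<noteq> ?f 1" using x n by auto
  qed
  moreover have "?f i \<in> M i" if "i < n" for i
  proof -
    have "i = 0 \<or> i \<in> {1..n-2} \<or> i = n - 1" using that by auto
    then consider "i = 0" | "i \<in> {1..n-2}" | "i = n - 1" by blast
    then show ?thesis using f x c n by cases auto
  qed
  ultimately show ?thesis by blast
qed

text \<open>If some list is not contained in the preceding one, rotating the cycle leads to
  \<open>spread_list_coloring_aux\<close>. Otherwise all lists are equal, and four colours suffice
  when \<open>n\<close> is a sum of threes and fours. Among the numbers from 3 on, only 5 is not,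
  and there a fifth colour is supplied.\<close>

lemma spread_list_coloring:
  fixes M :: "nat \<Rightarrow> 'c set"
  assumes n: "3 \<le> n" and M: "\<And>i. i < n \<Longrightarrow> 4 \<le> card (M i)"
    and five: "n = 5 \<Longrightarrow> \<exists>i<n. card (M i) \<noteq> 4"
  shows "\<exists>f. (\<forall>i<n. f i \<in> M i) \<and> spread n f"
proof (cases "\<forall>j<n. M j \<subseteq> M ((j + n - 1) mod n)")
  case False
  then obtain j c where j: "j < n" and c: "c \<in> M j" "c \<notin> M ((j + n - 1) mod n)" by blast
  \<comment> \<open>The rotation puts position \<open>j\<close> first and its predecessor last. The
    predecessor is written with \<open>j + n - 1\<close> to avoid truncation at
    \<open>j = 0\<close>.\<close>
  define M' where "M' i = M ((j + i) mod n)" for i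
  have "c \<in> M' 0" "c \<notin> M' (n - 1)" using c j n by (auto simp: M'_def)
  moreover have "4 \<le> card (M' i)" for i using M[of "(j + i) mod n"] n by (auto simp: M'_def)
  ultimately obtain f where f: "\<forall>i<n. f i \<in> M' i" "spread n f"
    using spread_list_coloring_aux[OF n, of M' c] by blast
  define g where "g k = f ((k + (n - j)) mod n)" for k
  have "spread n g"
    unfolding spread_def
  proof (intro allI impI)
    fix k assume "k < n"
    let ?i = "(k + (n - j)) mod n"
    have "?i < n" using n by simp
    moreover have "((k + d) mod n + (n - j)) mod n = (?i + d) mod n" for d
      by (simp add: mod_simps algebra_simps)
    ultimately show "g k \<noteq> g ((k + 1) mod n) \<and> g k \<noteq> g ((k + 2) mod n)"
      using f(2) unfolding spread_def g_def by metis
  qed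
  moreover have "g k \<in> M k" if "k < n" for k
  proof -
    have "(j + (k + (n - j)) mod n) mod n = k"
    proof -
      have "(j + (k + (n - j)) mod n) mod n = (j + (k + (n - j))) mod n" by (simp add: mod_simps)
      also have "j + (k + (n - j)) = k + n" using j by simp
      finally show ?thesis using that by simp
    qed
    moreover have "f ((k + (n - j)) mod n) \<in> M' ((k + (n - j)) mod n)" using f(1) n by simp
    ultimately show ?thesis unfolding g_def M'_def by simp
  qed
  ultimately show ?thesis by blast
next
  case True
  \<comment> \<open>Lists that shrink all the way round the cycle and end where they started are
    equal.\<close>
  have step: "M (Suc j) \<subseteq> M j" if "Suc j < n" for j using True that by force
  have anti: "M j \<subseteq> M i" if "i \<le> j" "j < n" for i j
    using that
  proof (induction j)
    case (Suc j)
    then show ?case using step[of j] by (cases "i = Suc j") auto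
  qed simp
  have "M 0 \<subseteq> M (n - 1)" using True n by force
  then have eq: "M i = M 0" if "i < n" for i
  proof -
    have "i \<le> n - 1" "n - 1 < n" using that by auto
    then show ?thesis using anti[of 0 i] anti[of i "n - 1"] that \<open>M 0 \<subseteq> M (n - 1)\<close> by blast
  qed
  have card0: "4 \<le> card (M 0)" using M[of 0] n by simp
  then have fin: "finite (M 0)" by (metis card.infinite not_numeral_le_zero)
  show ?thesis
  proof (cases "n = 5")
    case True
    then obtain i where "i < n" "card (M i) \<noteq> 4" using five by blast
    then have "card (M 0) \<noteq> 4" using eq[of i] by simp
    then have "card {..<5::nat} \<le> card (M 0)" using card0 by simp
    then obtain h where h: "inj_on h {..<5::nat}" "h ` {..<5::nat} \<subseteq> M 0"
      using card_le_inj[OF _ fin, of "{..<5::nat}"] by blast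
    have "spread n h"
      unfolding spread_def
    proof (intro allI impI)
      fix i assume "i < n"
      then have "i = 0 \<or> i = 1 \<or> i = 2 \<or> i = 3 \<or> i = 4" unfolding True by linarith
      then have "i < 5" "(i + 1) mod n < 5" "(i + 2) mod n < 5" "i \<noteq> (i + 1) mod n" "i \<noteq> (i + 2) mod n"
        unfolding True by (elim disjE; simp)+
      then show "h i \<noteq> h ((i + 1) mod n) \<and> h i \<noteq> h ((i + 2) mod n)"
        by (simp only: inj_on_eq_iff[OF h(1)] lessThan_iff simp_thms)
    qed
    moreover have "h i \<in> M i" if "i < n" for i using h(2) eq[OF that] that True by auto
    ultimately show ?thesis by blast
  next
    case False
    have "card {..<4::nat} \<le> card (M 0)" using card0 by simp
    then obtain h where h: "inj_on h {..<4::nat}" "h ` {..<4::nat} \<subseteq> M 0"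
      using card_le_inj[OF _ fin, of "{..<4::nat}"] by blast
    have "\<exists>g. (\<forall>i. g i < (4::nat)) \<and> spread n g"
    proof -
      have m3: "i mod 3 \<noteq> (i + 1) mod (3::nat)" "i mod 3 \<noteq> (i + 2) mod (3::nat)" for i by (auto simp: mod_Suc)
      have m4: "i mod 4 \<noteq> (i + 1) mod (4::nat)" "i mod 4 \<noteq> (i + 2) mod (4::nat)" for i by (auto simp: mod_Suc)
      have le3: "i mod 3 < (4::nat)" for i using mod_less_divisor[of 3 i] by linarith
      \<comment> \<open>The colours come in blocks 012 with no, one or two blocks 0123 among them.
        Remainder 2 needs two such blocks, so the smallest case is 8; the number 5 would be the case
        of a negative \<open>m\<close>.\<close>
      obtain m where "n = 3 * m + 3 \<or> n = 3 * m + 4 \<or> n = 3 * m + 8"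
      proof -
        define m where "m = n div 3"
        have "n = 3 * m + n mod 3" "n mod 3 < 3" by (simp_all add: m_def)
        then have "n = 3 * m \<or> n = 3 * m + 1 \<or> n = 3 * m + 2" by linarith
        then have "n = 3 * (m - 1) + 3 \<or> n = 3 * (m - 1) + 4 \<or> n = 3 * (m - 2) + 8"
          using False n by linarith
        then show ?thesis using that by blast
      qed
      then consider "n = 3 * m + 3" | "n = 3 * m + 4" | "n = 3 * m + 8" by blast
      then show ?thesis
      proof cases
        case 1
        then have e: "n - 1 = 3 * m + 2" "n - 2 = 3 * m + 1" by linarith+
        have "spread n (\<lambda>i. i mod 3)"
          by (rule spreadI[OF n], unfold e) (use m3 in \<open>simp_all add: mod_Suc\<close>)
        then show ?thesis using le3 by (intro exI[of _ "\<lambda>i. i mod 3"]) auto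
      next
        case 2
        then have e: "n - 1 = 3 * m + 3" "n - 2 = 3 * m + 2" by linarith+
        let ?g = "\<lambda>i. if i = 3 * m + 3 then 3 else i mod (3::nat)"
        have g3: "i mod 3 \<noteq> (3::nat)" for i using mod_less_divisor[of 3 i] by linarith
        have "spread n ?g"
        proof (rule spreadI[OF n])
          fix i assume "i + 1 < n"
          then show "?g i \<noteq> ?g (i + 1)" using m3[of i] g3 2 by simp
        next
          fix i assume "i + 2 < n"
          then show "?g i \<noteq> ?g (i + 2)" using m3[of i] g3 2 by simp
        qed (unfold e, simp_all add: mod_Suc)
        moreover have "?g i < 4" for i using le3[of i] by simp
        ultimately show ?thesis by (intro exI[of _ ?g] conjI) auto
      next
        case 3
        then have e: "n - 1 = 3 * m + 7" "n - 2 = 3 * m + 6" by linarith+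
        let ?g = "\<lambda>i. if i < 8 then i mod 4 else (i + 1) mod (3::nat)"
        have "spread n ?g"
        proof (rule spreadI[OF n])
          show "?g (n - 2) \<noteq> ?g 0" "?g (n - 1) \<noteq> ?g 0" "?g (n - 1) \<noteq> ?g 1"
            unfolding e by (cases m; simp add: mod_Suc)+
        next
          fix i :: nat
          have "i < 6 \<or> i = 6 \<or> i = 7 \<or> 8 \<le> i" by linarith
          then show "?g i \<noteq> ?g (i + 1)" using m3[of "i + 1"] m4[of i] by auto
        next
          fix i :: nat
          have "i < 6 \<or> i = 6 \<or> i = 7 \<or> 8 \<le> i" by linarith
          then show "?g i \<noteq> ?g (i + 2)" using m3[of "i + 1"] m4[of i] by auto
        qed
        moreover have "?g i < 4" for i using le3[of "i + 1"] by simp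
        ultimately show ?thesis by (intro exI[of _ ?g] conjI) auto
      qed
    qed
    then obtain g where g: "\<And>i. g i < (4::nat)" "spread n g" by blast
    have "spread n (h \<circ> g)"
      using g(2) unfolding spread_def comp_apply
      by (simp add: inj_on_eq_iff[OF h(1)] g(1))
    moreover have "(h \<circ> g) i \<in> M i" if "i < n" for i using h(2) g(1)[of i] eq[OF that] by auto
    ultimately show ?thesis by blast
  qed
qed

section \<open>Reducible configurations\<close>

context list_graph
begin

text \<open>Adding \<open>length xs\<close> modulo \<open>length (t # xs)\<close> is a step
  backwards without subtraction. For five vertices this is the \<open>i + 4\<close> in the
  description of the excluded pentagon.\<close>

lemma loop_cycle:
  assumes path_nbrs: "path_nbrs N t xs t" and d: "distinct (t # xs)" and l: "2 \<le> length xs" and Nt: "N t = {hd xs, last xs}"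
    and i: "i < length (t # xs)"
  shows "N ((t # xs) ! i) = {(t # xs) ! ((i + 1) mod length (t # xs)),
    (t # xs) ! ((i + length xs) mod length (t # xs))}"
proof -
  define n where "n = length (t # xs)"
  have *: "path_nbrs N s xs t \<Longrightarrow> j < length xs \<Longrightarrow> N (xs ! j) = {(s # xs) ! j, (xs @ [t]) ! Suc j}" for s j
  proof (induction xs arbitrary: s j)
    case (Cons x xs)
    then show ?case by (cases j) (auto simp: hd_conv_nth nth_append)
  qed simp
  show ?thesis
  proof (cases i)
    case 0
    have "last xs = (t # xs) ! length xs" "hd xs = (t # xs) ! 1"
      using l by (cases xs; auto simp: last_conv_nth nth_Cons')+
    then show ?thesis using 0 Nt l by auto
  next
    case (Suc j)
    then have j: "j < length xs" using i by simp
    have "i + length xs = j + length (t # xs)" using Suc by simp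
    then have "(i + length xs) mod length (t # xs) = j" using j by (metis length_Cons less_Suc_eq mod_add_self2 mod_less)
    moreover have "(xs @ [t]) ! Suc j = (t # xs) ! ((i + 1) mod length (t # xs))"
      using Suc j by (cases "Suc j = length xs") (auto simp: nth_append)
    ultimately show ?thesis using *[OF path_nbrs j] Suc by (simp add: insert_commute)
  qed
qed

end

text \<open>Minimality refers to induced subgraphs with unchanged lists. The excluded pentagon is a
  whole component, since the equations fix complete neighbourhoods, and all its lists have exactly
  four colours.\<close>

locale min_counterexample = list_graph V N L
  for V :: "'v set" and N :: "'v \<Rightarrow> 'v set" and L :: "'v \<Rightarrow> 'c set" +
  assumes IH: "W \<subset> V \<Longrightarrow> \<exists>\<phi>. sub W \<phi>"
    and not_colorable: "\<not> sub V \<phi>"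
    and no_tight_pentagon: "distinct cs \<Longrightarrow> length cs = 5 \<Longrightarrow>
      (\<And>i. i < 5 \<Longrightarrow> N (cs ! i) = {cs ! ((i + 1) mod 5), cs ! ((i + 4) mod 5)}) \<Longrightarrow>
      \<exists>i<5. card (L (cs ! i)) \<noteq> 4"
begin

lemma not_good: "\<not> good V \<phi>"
  using sub_if_good not_colorable by blast

lemma obtain_sub:
  assumes "S \<subseteq> V" "S \<noteq> {}"
  obtains \<phi> where "sub (V - S) \<phi>"
  using IH[of "V - S"] assms by auto

lemma sub_conflict_free: "sub W \<phi> \<Longrightarrow> v \<in> W \<Longrightarrow> N v \<inter> W \<noteq> {} \<Longrightarrow> conflict_free \<phi> (N v \<inter> W)"
  unfolding sub_def by blast

lemma N_int_compl: "N v \<inter> (V - S) = N v - S"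
  using N_sub by blast

lemma sub_inj:
  assumes "sub (V - S) \<phi>" "v \<in> V - S" "card (N v - S) \<le> 2"
  shows "inj_on \<phi> (N v - S)"
  using inj_on_cf_small[of "N v - S" \<phi>] sub_conflict_free[OF assms(1,2)] assms(3) by (auto simp: N_int_compl)

text \<open>A vertex of degree one has three colours and avoids two when coloured last: that of its
  neighbour and the one forbidden by the neighbourhood of that neighbour.\<close>

lemma degree_ge_2:
  assumes v: "v \<in> V"
  shows "2 \<le> card (N v)"
proof (rule ccontr)
  assume "\<not> 2 \<le> card (N v)"
  then have c: "card (N v) = 0 \<or> card (N v) = 1" by linarith
  obtain \<phi> where \<phi>: "sub (V - {v}) \<phi>" using obtain_sub[of "{v}"] v by blast
  have g: "good (V - {v}) \<phi>"
  proof (rule good_if_sub[OF \<phi>])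
    fix u assume "u \<in> V - (V - {v})" "N u \<noteq> {}"
    then have "card (N u) = 1" using c by auto
    then show "conflict_free \<phi> (N u)" by (auto simp: card_1_singleton_iff)
  qed auto
  have "\<exists>c. c \<in> L v \<and> c \<notin> \<phi> ` (N v \<inter> (V - {v})) \<and> (\<forall>u. u \<in> N v \<longrightarrow> conflict_free (\<phi>(v := c)) (N u))"
  proof (cases "N v = {}")
    case True
    then show ?thesis using L_card[OF v] by (metis add_2_eq_Suc' card.empty card_gt_0_iff empty_iff equals0I image_empty inf_bot_left not_numeral_le_zero le_zero_eq zero_less_Suc le_add2 ex_in_conv)
  next
    case False
    then have "card (N v) = 1" using c by simp
    then obtain u where u: "N v = {u}" by (auto simp: card_1_singleton_iff)
    then have "v \<in> N u" using N_commute by blast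
    then obtain r where r: "\<And>c. c \<noteq> r \<Longrightarrow> conflict_free (\<phi>(v := c)) (N u)"
      using conflict_free_one_forbidden[of "N u" v \<phi>] N_card by auto
    have "3 \<le> card (L v)" using L_card[OF v] u by simp
    then obtain c where "c \<in> L v" "c \<notin> set [\<phi> u, r]" using pick_fresh[of "[\<phi> u, r]" "L v"] by auto
    then show ?thesis using u r by auto
  qed
  then obtain c where "c \<in> L v" "c \<notin> \<phi> ` (N v \<inter> (V - {v}))" "\<And>u. u \<in> N v \<Longrightarrow> conflict_free (\<phi>(v := c)) (N u)"
    by blast
  then have "good (insert v (V - {v})) (\<phi>(v := c))" by (intro good_step[OF g v]) auto
  moreover have "insert v (V - {v}) = V" using v by auto
  ultimately show False using not_good by metis
qed

text \<open>All vertices on the closed path have degree two, so it is a component and can be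
  coloured independently of the rest. Here the exception for pentagons enters.\<close>

lemma no_cycle:
  assumes path_nbrs: "path_nbrs N t xs t" and d: "distinct (t # xs)" and l: "2 \<le> length xs" and Nt: "N t = {hd xs, last xs}"
  shows False
proof -
  define cs where "cs = t # xs"
  define n where "n = length cs"
  have n: "3 \<le> n" using l by (simp add: n_def cs_def)
  have dcs: "distinct cs" using d by (simp add: cs_def)
  have Ncs: "N (cs ! i) = {cs ! ((i + 1) mod n), cs ! ((i + (n - 1)) mod n)}" if "i < n" for i
    using loop_cycle[OF path_nbrs d l Nt, of i] that by (simp add: cs_def n_def)
  have inV: "cs ! i \<in> V" if "i < n" for i
    using Ncs[OF that] N_outside by blast
  have ne: "(i + 1) mod n \<noteq> (i + (n - 1)) mod n" if "i < n" for i
  proof -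
    have "(i + (n - 1)) mod n = (if i = 0 then n - 1 else i - 1)"
    proof (cases i)
      case (Suc j)
      then have "i + (n - 1) = j + n" using n by linarith
      then show ?thesis using Suc that by simp
    qed (use n in simp)
    then show ?thesis using mod_succ(1)[OF n that] n that by (auto split: if_splits)
  qed
  have deg: "card (N (cs ! i)) = 2" if "i < n" for i
  proof -
    have "(i + 1) mod n < n" "(i + (n - 1)) mod n < n" using n by simp_all
    then have "cs ! ((i + 1) mod n) \<noteq> cs ! ((i + (n - 1)) mod n)"
      using ne[OF that] dcs by (simp add: nth_eq_iff_index_eq n_def)
    then show ?thesis using Ncs[OF that] by simp
  qed
  have "\<exists>f. (\<forall>i<n. f i \<in> L (cs ! i)) \<and> spread n f"
  proof (rule spread_list_coloring[OF n])
    show "4 \<le> card (L (cs ! i))" if "i < n" for i using L_card[OF inV[OF that]] deg[OF that] by simp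
    assume "n = 5"
    then show "\<exists>i<n. card (L (cs ! i)) \<noteq> 4"
      using no_tight_pentagon[of cs] dcs Ncs n_def by auto
  qed
  then obtain f where f: "\<And>i. i < n \<Longrightarrow> f i \<in> L (cs ! i)" "spread n f" by blast
  define C where "C = set cs"
  have CV: "C \<subseteq> V" using inV by (auto simp: C_def n_def in_set_conv_nth)
  have C_nth: "\<exists>i<n. v = cs ! i" if "v \<in> C" for v
    using that unfolding C_def n_def by (metis in_set_conv_nth)
  have NC: "N v \<subseteq> C" if v: "v \<in> C" for v
  proof -
    obtain i where "i < n" "v = cs ! i" using C_nth[OF v] by blast
    moreover have "(i + 1) mod n < n" "(i + (n - 1)) mod n < n" using n by simp_all
    ultimately show ?thesis using Ncs by (auto simp: C_def n_def)
  qed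
  then have NC': "N v \<inter> C = {}" if "v \<notin> C" for v using that N_commute by blast
  obtain \<psi> where \<psi>: "sub (V - C) \<psi>" using obtain_sub[of C] CV by (auto simp: C_def cs_def)
  define ix where "ix v = (THE i. i < n \<and> cs ! i = v)" for v
  have ix: "ix (cs ! i) = i" if "i < n" for i
    unfolding ix_def using that dcs by (intro the_equality) (auto simp: n_def nth_eq_iff_index_eq)
  define \<phi> where "\<phi> v = (if v \<in> C then f (ix v) else \<psi> v)" for v
  have \<phi>C: "\<phi> (cs ! i) = f i" if "i < n" for i using that ix by (simp add: \<phi>_def C_def n_def)
  have "sub V \<phi>"
    unfolding sub_def
  proof (intro ballI)
    fix v assume v: "v \<in> V"
    show "\<phi> v \<in> L v \<and> (\<forall>u\<in>N v \<inter> V. \<phi> u \<noteq> \<phi> v) \<and> (N v \<inter> V \<noteq> {} \<longrightarrow> conflict_free \<phi> (N v \<inter> V))"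
    proof (cases "v \<in> C")
      case False
      then have "N v \<inter> V = N v \<inter> (V - C)" using NC' by blast
      moreover have "\<phi> u = \<psi> u" if "u \<in> insert v (N v)" for u
        using that False NC'[OF False] by (auto simp: \<phi>_def)
      ultimately show ?thesis using \<psi> v False conflict_free_cong[of "N v \<inter> (V - C)" \<phi> \<psi>] unfolding sub_def by auto
    next
      case True
      then obtain i where i: "i < n" "v = cs ! i" using C_nth by blast
      let ?j = "(i + (n - 1)) mod n"
      have j: "?j < n" "(?j + 1) mod n = i" "(?j + 2) mod n = (i + 1) mod n" "(i + 1) mod n < n"
      proof -
        have "(?j + d) mod n = (i + (n - 1) + d) mod n" for d by (simp add: mod_simps)
        moreover have "i + (n - 1) + 1 = i + n" "i + (n - 1) + 2 = (i + 1) + n" using n by linarith+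
        ultimately show "(?j + 1) mod n = i" "(?j + 2) mod n = (i + 1) mod n"
          using i(1) by (metis mod_add_self2 mod_less)+
      qed (use n in simp_all)
      have "f ?j \<noteq> f i" "f ?j \<noteq> f ((i + 1) mod n)" "f i \<noteq> f ((i + 1) mod n)"
        using f(2) j i(1) unfolding spread_def by metis+
      moreover have Nv: "N v = {cs ! ((i + 1) mod n), cs ! ?j}" using Ncs i by simp
      moreover have "cs ! ((i + 1) mod n) \<noteq> cs ! ?j"
        using ne[OF i(1)] dcs j by (simp add: nth_eq_iff_index_eq n_def)
      moreover have "N v \<inter> V = N v" using N_sub by blast
      ultimately show ?thesis
        using f(1)[OF i(1)] i j by (simp add: \<phi>C conflict_free_doubleton)
    qed
  qed
  then show False using not_colorable by blast
qed

text \<open>Every removed vertex keeps an uncoloured neighbour, so no neighbourhood of a removed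
  vertex is complete.\<close>

lemma good_minus_links:
  assumes \<phi>: "sub (V - S) \<phi>" and "S \<subseteq> V" "\<And>v. v \<in> S \<Longrightarrow> N v \<inter> S \<noteq> {}"
  shows "good (V - S) \<phi>"
  by (rule good_if_sub[OF \<phi>]) (use assms(3) in blast)+

lemma chain_meets_itself:
  assumes "chain N s xs t" "2 \<le> length xs" "v \<in> set xs"
  shows "N v \<inter> set xs \<noteq> {}"
proof -
  have "\<exists>w. w \<in> N v \<and> w \<in> set xs"
  proof (cases "v = last xs")
    case False
    then have "t \<notin> N v" using chain_nbrs_right[OF assms(1,3)] by blast
    then show ?thesis using path_nbrs_next[of N s xs t v] assms(1,3) unfolding chain_def by metis
  next
    case True
    have "s \<notin> N v"
    proof
      assume "s \<in> N v"
      then have "v = hd xs" using chain_nbrs_left[OF assms(1,3)] by blast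
      then show False using True assms(1,2) unfolding chain_def
        by (cases xs) (auto split: if_splits)
    qed
    then show ?thesis
      using path_nbrs_next[of N t "rev xs" s v] chain_rev[OF assms(1)] assms(3) unfolding chain_def by (metis set_rev)
  qed
  then show ?thesis by blast
qed

text \<open>Only a chain of a single vertex has a neighbourhood free of chain vertices, namely
  \<open>{s, t}\<close>.\<close>

lemma chain_good:
  assumes ch: "chain N s xs t" and st: "\<phi> s \<noteq> \<phi> t" and S: "set xs \<subseteq> S"
    and v: "v \<in> set xs" "N v \<subseteq> V - S"
  shows "conflict_free \<phi> (N v)"
proof (cases "2 \<le> length xs")
  case True
  then show ?thesis using chain_meets_itself[OF ch True v(1)] v S by blast
next
  case False
  then obtain x where xs: "xs = [x]" using ch by (cases xs) (auto simp: chain_def Suc_le_eq)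
  then have "N v = {s, t}" "s \<noteq> t" using ch v unfolding chain_def by auto
  then show ?thesis using st by (simp add: conflict_free_doubleton)
qed

text \<open>Without the chain, \<open>s\<close> keeps two neighbours, which have different colours
  in the smaller graph. So \<open>N s\<close> is safe and the chain can be coloured from
  \<open>t\<close> towards \<open>s\<close>. The condition on length or adjacency rules out a single
  removed vertex whose two neighbours have equal colours.\<close>

lemma no_chain_at_3:
  assumes ch: "chain N s xs t" and k: "2 \<le> length xs \<or> t \<in> N s" and s: "card (N s) = 3"
  shows False
proof -
  let ?S = "set xs"
  have ne: "xs \<noteq> []" and st: "s \<notin> ?S" "t \<notin> ?S" using ch by (auto simp: chain_def)
  have SV: "?S \<subseteq> V" using chain_vertex[OF ch] by blast
  have "s \<in> V" "t \<in> V" using chain_hd[OF ch] chain_last[OF ch] in_V_if_nbr by blast+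
  then have sV: "s \<in> V - ?S" "t \<in> V - ?S" using st by auto
  obtain \<phi> where \<phi>: "sub (V - ?S) \<phi>" using obtain_sub[OF SV] ne by auto
  have g: "good (V - ?S) \<phi>"
  proof (rule good_if_sub[OF \<phi>])
    fix v assume v: "v \<in> V - (V - ?S)" "N v \<subseteq> V - ?S"
    then have "\<not> 2 \<le> length xs" using chain_meets_itself[OF ch] by blast
    then have "\<phi> t \<noteq> \<phi> s" using k \<phi> sV unfolding sub_def by blast
    from chain_good[OF ch this[symmetric] order_refl] show "conflict_free \<phi> (N v)" using v by blast
  qed auto
  have "card (N s - ?S) = 2"
    using s chain_nbrs(1)[OF ch] card_Diff_subset_Int[of "N s" ?S] by simp
  then have "inj_on \<phi> (N s - ?S)" "\<exists>u\<in>N s - ?S. \<exists>w\<in>N s - ?S. u \<noteq> w"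
    using sub_inj[OF \<phi> sV(1)] by (auto simp: card_2_iff)
  then have "safe \<phi> (N s \<inter> (V - ?S))" unfolding safe_def N_int_compl by blast
  then obtain \<phi>' where "good (V - ?S \<union> set (rev xs)) \<phi>'"
    using chain_solve[OF chain_rev[OF ch] g sV(2,1)] by auto
  moreover have "V - ?S \<union> set (rev xs) = V" using SV by auto
  ultimately show False using not_good by metis
qed

text \<open>If \<open>t\<close> has no other neighbours, this is \<open>no_cycle\<close>. Otherwise
  it has at most two others, and the first vertex of the loop can avoid their colours and that of
  \<open>t\<close>. This makes \<open>N t\<close> safe for the chain formed by the remaining
  vertices of the loop.\<close>

lemma no_loop:
  assumes path_nbrs: "path_nbrs N t xs t" and d: "distinct (t # xs)" and l: "2 \<le> length xs"
  shows False
proof -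
  obtain x ys where xs: "xs = x # ys" using l by (cases xs) auto
  then have ys: "ys \<noteq> []" using l by auto
  have ch: "chain N x ys t" using path_nbrs d xs ys by (auto simp: chain_def)
  have Nx: "N x = {t, hd ys}" using path_nbrs xs ys by auto
  let ?S = "set xs"
  have SV: "?S \<subseteq> V" using chain_vertex[OF ch] Nx N_outside xs by fastforce
  have tS: "t \<notin> ?S" using d by auto
  then have tV: "t \<in> V - ?S" using chain_last[OF ch] in_V_if_nbr by blast
  have NtS: "N t \<inter> ?S = {x, last ys}" using chain_nbrs(2)[OF ch] xs Nx N_commute[of x t] by auto
  have xl: "x \<noteq> last ys" using d xs ys by auto
  define B where "B = N t - ?S"
  have Nt: "N t = B \<union> {x, last ys}" using NtS by (auto simp: B_def)
  show False
  proof (cases "B = {}")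
    case True
    then show False using no_cycle[OF path_nbrs d l] Nt xs ys by simp
  next
    case False
    have cB: "card B \<le> 2"
      using N_card[of t] NtS xl card_Diff_subset_Int[of "N t" ?S] by (simp add: B_def)
    obtain \<phi> where \<phi>: "sub (V - ?S) \<phi>" using obtain_sub[OF SV] xs by auto
    have inj: "inj_on \<phi> B" using sub_inj[OF \<phi> tV] cB by (simp add: B_def)
    have hS: "hd ys \<in> ?S" using xs ys by auto
    have lS: "last ys \<in> ?S" using xs ys by auto
    have g: "good (V - ?S) \<phi>"
    proof (rule good_minus_links[OF \<phi> SV])
      fix v assume "v \<in> ?S"
      then consider "v = x" | "v \<in> set ys" using xs by auto
      then show "N v \<inter> ?S \<noteq> {}"
      proof cases
        case 1 then show ?thesis using Nx hS by auto
      next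
        case 2
        have "\<exists>w. w \<in> N v \<and> (w \<in> set ys \<or> w = x)"
          using path_nbrs_next[of N t "rev ys" x v] chain_rev[OF ch] 2 unfolding chain_def by (metis set_rev)
        then show ?thesis using xs by auto
      qed
    qed
    have x: "x \<in> V" "x \<notin> V - ?S" using SV xs by auto
    have "card (N x) = 2" using Nx tS hS by (metis card_2_iff)
    then have "4 \<le> card (L x)" using L_card[OF x(1)] by simp
    moreover have "card (insert (\<phi> t) (\<phi> ` B)) \<le> 3"
      using card_image_le[of B \<phi>] cB card_insert_le_m1[of 3 "\<phi> ` B" "\<phi> t"] by (simp add: B_def)
    ultimately obtain c where c: "c \<in> L x" "c \<noteq> \<phi> t" "c \<notin> \<phi> ` B"
      using pick_color[of "insert (\<phi> t) (\<phi> ` B)" "L x"] by (auto simp: B_def)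
    let ?D = "insert x (V - ?S)"
    have g': "good ?D (\<phi>(x := c))"
    proof (rule good_step[OF g x c(1)])
      show "c \<notin> \<phi> ` (N x \<inter> (V - ?S))" using Nx hS c(2) by auto
      show "conflict_free (\<phi>(x := c)) (N u)" if u: "u \<in> N x" "N u \<subseteq> ?D" for u
      proof -
        \<comment> \<open>\<open>N t\<close> still misses \<open>last ys\<close>. So only
          \<open>hd ys\<close> can have obtained a complete neighbourhood, and only if it is the
          last vertex too.\<close>
        have "u = hd ys" using u Nx NtS xl lS by auto
        then have Nu: "N u = {x, hd (tl ys @ [t])}" using ch ys unfolding chain_def by (cases ys) auto
        have "hd (tl ys @ [t]) = t \<or> hd (tl ys @ [t]) \<in> set ys" using ys by (cases ys; cases "tl ys") auto
        moreover have "set ys \<inter> ?D = {}" using d xs by auto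
        moreover have "hd (tl ys @ [t]) \<in> ?D" using u(2) Nu by simp
        ultimately have "hd (tl ys @ [t]) = t" by blast
        then have "N u = {x, t}" using Nu by simp
        then show ?thesis using c(2) x tS xs by (auto simp: conflict_free_doubleton)
      qed
    qed
    have Nint: "N t \<inter> ?D = insert x B" using Nt lS xl B_def N_sub by auto
    have "inj_on (\<phi>(x := c)) (insert x B)"
      using inj c(3) xs by (auto simp: inj_on_def B_def)
    moreover have "x \<notin> B" using xs by (auto simp: B_def)
    ultimately have "safe (\<phi>(x := c)) (N t \<inter> ?D)"
      unfolding safe_def Nint using False by auto
    then obtain \<phi>' where "good (?D \<union> set ys) \<phi>'"
      using chain_solve[OF ch g'] tV d xs by auto
    moreover have "?D \<union> set ys = V" using SV xs by auto
    ultimately show False using not_good by metis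
  qed
qed

end

section \<open>Two disjoint chains with common ends\<close>

context min_counterexample
begin

text \<open>With \<open>k\<close> the number of remaining neighbours of \<open>s\<close>, the new
  colour avoids that of \<open>t\<close>, \<open>k\<close> colours for properness and one colour for
  the neighbourhood of each remaining neighbour. The list has at least \<open>k + 4\<close> colours,
  which is more than \<open>2 * k + 1\<close> as \<open>k\<close> is at most two.\<close>

lemma recolor:
  assumes \<phi>: "sub (V - S) \<phi>" and s: "s \<in> V - S" "s \<noteq> t" "t \<notin> N s"
    and A: "card (N s - S) \<le> 2" "card (N s - S) + 2 \<le> card (N s)"
  obtains \<phi>' where "sub (V - S) \<phi>'" "\<phi>' s \<noteq> \<phi>' t"
proof -
  let ?A = "N s - S"
  have "\<forall>u. \<exists>r. u \<in> ?A \<longrightarrow> (\<forall>c. c \<noteq> r \<longrightarrow> conflict_free (\<phi>(s := c)) (N u - S))"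
  proof
    fix u
    show "\<exists>r. u \<in> ?A \<longrightarrow> (\<forall>c. c \<noteq> r \<longrightarrow> conflict_free (\<phi>(s := c)) (N u - S))"
    proof (cases "u \<in> ?A")
      case True
      then have "s \<in> N u - S" using s N_commute by blast
      moreover have "card (N u - S) \<le> 4" using N_card[of u] card_Diff_subset_Int[of "N u" S]
        by (meson card_mono Diff_subset finite_N le_trans)
      ultimately show ?thesis using conflict_free_one_forbidden[of "N u - S" s \<phi>] by (metis finite_Diff finite_N)
    qed auto
  qed
  then obtain r where r: "\<And>u c. u \<in> ?A \<Longrightarrow> c \<noteq> r u \<Longrightarrow> conflict_free (\<phi>(s := c)) (N u - S)" by metis
  let ?F = "insert (\<phi> t) (\<phi> ` ?A \<union> r ` ?A)"
  have "card ?F \<le> Suc (card (\<phi> ` ?A \<union> r ` ?A))" by (simp add: card_insert_le_m1 card_insert_if)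
  also have "\<dots> \<le> Suc (card (\<phi> ` ?A) + card (r ` ?A))" using card_Un_le by auto
  also have "\<dots> \<le> Suc (card ?A + card ?A)"
    using card_image_le[of ?A \<phi>] card_image_le[of ?A r] by simp
  also have "\<dots> < card (L s)" using A L_card[of s] s by auto
  finally obtain c where c: "c \<in> L s" "c \<notin> ?F" using pick_color[of ?F "L s"] by auto
  have "sub (V - S) (\<phi>(s := c))"
    unfolding sub_def N_int_compl
  proof (intro ballI conjI impI)
    fix v assume v: "v \<in> V - S"
    show "(\<phi>(s := c)) v \<in> L v" using \<phi> c v unfolding sub_def by auto
    show "(\<phi>(s := c)) u \<noteq> (\<phi>(s := c)) v" if u: "u \<in> N v - S" for u
    proof -
      have "\<phi> u \<noteq> \<phi> v" using \<phi> v u unfolding sub_def N_int_compl by blast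
      moreover have "v \<in> ?A" if "u = s" using u v that N_commute by blast
      moreover have "u \<in> ?A" if "v = s" using u v that by blast
      ultimately show ?thesis using c by auto
    qed
    assume ne: "N v - S \<noteq> {}"
    show "conflict_free (\<phi>(s := c)) (N v - S)"
    proof (cases "s \<in> N v")
      case True
      then have "v \<in> ?A" using v N_commute by blast
      then show ?thesis using r c by auto
    next
      case False
      then have "conflict_free (\<phi>(s := c)) (N v - S) \<longleftrightarrow> conflict_free \<phi> (N v - S)" by (intro conflict_free_cong) auto
      then show ?thesis using sub_conflict_free[OF \<phi> v] ne by (simp add: N_int_compl)
    qed
  qed
  moreover have "(\<phi>(s := c)) s \<noteq> (\<phi>(s := c)) t" using c s by auto
  ultimately show ?thesis using that by blast
qed

lemma parallel_nbrs:
  assumes "chain N s xs t" "chain N s ys t" "set xs \<inter> set ys = {}" and S: "S = set xs \<union> set ys"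
  shows "N s \<inter> S = {hd xs, hd ys}" "card (N s) = card (N s - S) + 2" "card (N s - S) \<le> 2"
    "hd xs \<noteq> hd ys"
proof -
  have ne: "xs \<noteq> []" "ys \<noteq> []" using assms by (auto simp: chain_def)
  show i: "N s \<inter> S = {hd xs, hd ys}" using chain_nbrs(1)[OF assms(1)] chain_nbrs(1)[OF assms(2)] S by auto
  show h: "hd xs \<noteq> hd ys" using assms(3) ne by (metis IntI empty_iff hd_in_set)
  have "card (N s \<inter> S) = 2" using i h by simp
  moreover have "card (N s) = card (N s \<inter> S) + card (N s - S)"
    by (metis Diff_Diff_Int Int_commute Int_Diff_Un card_Un_disjoint finite_Diff finite_Int finite_N Diff_disjoint Int_Diff_disjoint)
  ultimately show "card (N s) = card (N s - S) + 2" by simp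
  then show "card (N s - S) \<le> 2" using N_card[of s] by simp
qed

text \<open>Otherwise \<open>s\<close> has degree two and joins the two chains to a loop at
  \<open>t\<close>.\<close>

lemma parallel_end:
  assumes x: "chain N s xs t" and y: "chain N s ys t" and d: "set xs \<inter> set ys = {}"
  shows "N s - (set xs \<union> set ys) \<noteq> {}"
proof
  assume "N s - (set xs \<union> set ys) = {}"
  then have Ns: "N s = {hd xs, hd ys}" using parallel_nbrs(1)[OF x y d refl] by blast
  have ne: "xs \<noteq> []" "ys \<noteq> []" using x y by (auto simp: chain_def)
  have "path_nbrs N t (rev xs @ s # ys) t"
    using x y Ns ne path_nbrs_rev unfolding chain_def by (auto simp: path_nbrs_append last_rev)
  moreover have "distinct (t # rev xs @ s # ys)" using x y d unfolding chain_def by auto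
  moreover have "2 \<le> length (rev xs @ s # ys)" using ne by (cases xs) auto
  ultimately show False using no_loop by blast
qed

lemma card_img2: "finite A \<Longrightarrow> card A \<le> k \<Longrightarrow> card (\<phi> ` A) \<le> k"
  using card_image_le le_trans by blast

text \<open>The colour \<open>c\<close> on the first vertex of \<open>xs\<close> keeps the coloured
  part of \<open>N s\<close> rainbow, and by \<open>parallel_end\<close> this part has a second
  vertex. With \<open>N s\<close> safe, the chain \<open>ys\<close> can be coloured from
  \<open>t\<close> towards \<open>s\<close>.\<close>

lemma parallel_void:
  assumes x: "chain N s xs t" and y: "chain N s ys t" and d: "set xs \<inter> set ys = {}"
    and S: "S = set xs \<union> set ys" and \<phi>: "sub (V - S) \<phi>" and st: "\<phi> s \<noteq> \<phi> t"
    and c: "c \<in> L (hd xs)" "c \<noteq> \<phi> s" "length xs \<le> 2 \<Longrightarrow> c \<noteq> \<phi> t" "c \<notin> \<phi> ` (N s - S)"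
  shows False
proof -
  have ne: "xs \<noteq> []" "ys \<noteq> []" using x y by (auto simp: chain_def)
  have SV: "S \<subseteq> V" using chain_vertex(1)[OF x] chain_vertex(1)[OF y] S by blast
  have sV: "s \<in> V - S" "t \<in> V - S"
    using chain_hd[OF x] chain_last[OF x] in_V_if_nbr x y S by (auto simp: chain_def)
  have h: "hd xs \<in> set xs" "hd ys \<in> set ys" "last ys \<in> set ys" "last xs \<in> set xs" using ne by auto
  have g: "good (V - S) \<phi>"
    by (rule good_if_sub[OF \<phi>])
      (use chain_good[OF x st, of S] chain_good[OF y st, of S] S in auto)
  note nb = parallel_nbrs[OF x y d S]
  have t: "last ys \<in> N t" using chain_nbrs(2)[OF y] by blast
  obtain \<phi>' where \<phi>': "good (V - S \<union> set xs) \<phi>'" "\<And>u. u \<in> V - S \<Longrightarrow> \<phi>' u = \<phi> u" "\<phi>' (hd xs) = c"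
  proof (rule chain_extend[OF x g sV _ c(1-3)])
    show "(V - S) \<inter> set xs = {}" using S by blast
    have "hd ys \<in> N s" "hd ys \<notin> insert (hd xs) (V - S)" using nb h S by auto
    then show "N s \<subseteq> insert (hd xs) (V - S) \<Longrightarrow> conflict_free (\<phi>(hd xs := c)) (N s)" by blast
    have "last ys \<notin> insert (last xs) (V - S)" using h S d by auto
    then show "N t \<subseteq> insert (last xs) (V - S) \<Longrightarrow> safe \<phi> (N t \<inter> (V - S))" using t by blast
  qed auto
  have Ns: "N s \<inter> (V - S \<union> set xs) = insert (hd xs) (N s - S)"
    using nb(1) h S d N_sub[of s] by auto
  have inj: "inj_on \<phi> (N s - S)" using sub_inj[OF \<phi> sV(1) nb(3)] .
  have sN: "N s - S \<subseteq> V - S" using N_sub by blast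
  have "inj_on \<phi>' (N s - S)" using inj \<phi>'(2) sN by (metis inj_on_cong subsetD)
  moreover have "\<phi>' ` (N s - S) = \<phi> ` (N s - S)" using \<phi>'(2) sN by (intro image_cong) auto
  ultimately have "inj_on \<phi>' (insert (hd xs) (N s - S))"
    using c(4) \<phi>'(3) by (auto simp: inj_on_insert)
  moreover have "N s - S \<noteq> {}" using parallel_end[OF x y d] S by blast
  moreover have "hd xs \<notin> N s - S" using h S by blast
  ultimately have safe: "safe \<phi>' (N s \<inter> (V - S \<union> set xs))"
    unfolding Ns by (intro safe_insertI)
  have "t \<in> V - S \<union> set xs" "s \<in> V - S \<union> set xs" "(V - S \<union> set xs) \<inter> set (rev ys) = {}"
    using sV d S by auto
  then obtain \<phi>'' where "good (V - S \<union> set xs \<union> set (rev ys)) \<phi>''"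
    using chain_solve[OF chain_rev[OF y] \<phi>'(1)] safe by blast
  moreover have "V - S \<union> set xs \<union> set (rev ys) = V" using SV S by auto
  ultimately show False using not_good by metis
qed

text \<open>The excluded lengths 1 and 2 form the link \<open>Pent\<close>, which is not reducible by itself.\<close>

lemma no_parallel:
  assumes x: "chain N s xs t" and y: "chain N s ys t" and d: "set xs \<inter> set ys = {}"
    and cond: "t \<in> N s \<or> {length xs, length ys} \<noteq> {1, 2}"
  shows False
proof -
  define S where "S = set xs \<union> set ys"
  have ne: "xs \<noteq> []" "ys \<noteq> []" using x y by (auto simp: chain_def)
  have SV: "S \<subseteq> V" "S \<noteq> {}" using chain_vertex(1)[OF x] chain_vertex(1)[OF y] S_def ne by auto
  have sV: "s \<in> V - S" "t \<in> V - S" "s \<noteq> t"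
    using chain_hd[OF x] chain_last[OF x] in_V_if_nbr x y S_def by (auto simp: chain_def)
  have S': "S = set ys \<union> set xs" "S = set (rev xs) \<union> set (rev ys)" "S = set (rev ys) \<union> set (rev xs)"
    unfolding S_def by auto
  have d': "set ys \<inter> set xs = {}" "set (rev xs) \<inter> set (rev ys) = {}" "set (rev ys) \<inter> set (rev xs) = {}"
    using d by auto
  note nb = parallel_nbrs[OF x y d S_def]
  note nbt = parallel_nbrs[OF chain_rev[OF x] chain_rev[OF y] d'(2) S'(2)]
  \<comment> \<open>A removed chain of one vertex has the neighbourhood \<open>{s, t}\<close>, which
    has to be conflict-free.\<close>
  obtain \<phi> where \<phi>: "sub (V - S) \<phi>" and st: "\<phi> s \<noteq> \<phi> t"
  proof -
    obtain \<phi>0 where \<phi>0: "sub (V - S) \<phi>0" using obtain_sub[OF SV] .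
    show ?thesis
    proof (cases "t \<in> N s")
      case True
      then have "\<phi>0 t \<noteq> \<phi>0 s" using \<phi>0 sV unfolding sub_def by blast
      then show ?thesis using that[OF \<phi>0] by auto
    next
      case False
      then show ?thesis using recolor[OF \<phi>0 sV(1,3) False] nb that by (metis order_refl)
    qed
  qed
  have four: "4 \<le> card (L v)" if "v \<in> S" for v
    using that chain_vertex(3)[OF x] chain_vertex(3)[OF y] S_def by blast
  have hS: "hd xs \<in> S" "hd ys \<in> S" "last xs \<in> S" "last ys \<in> S" using ne S_def by auto
  have imgA: "card (insert (\<phi> s) (\<phi> ` (N s - S))) \<le> 3"
    using card_img2[OF _ nb(3), of \<phi>] by (simp add: card_insert_if)
  show False
  proof (cases "t \<in> N s")
    case True
    \<comment> \<open>As \<open>t\<close> is among the at most two other neighbours of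
      \<open>s\<close>, three colours are to be avoided in total.\<close>
    obtain c where c: "c \<in> L (hd xs)" "c \<notin> insert (\<phi> s) (\<phi> ` (N s - S))"
      using pick_color[of "insert (\<phi> s) (\<phi> ` (N s - S))" "L (hd xs)"] imgA four[OF hS(1)] by auto
    moreover have "t \<in> N s - S" using True sV by blast
    ultimately show False using parallel_void[OF x y d S_def \<phi> st c(1)] by auto
  next
    case False
    \<comment> \<open>If \<open>parallel_void\<close> never applies, the chain has at most two
      vertices, and the colours left at its first vertex are exactly the two colours on the other
      neighbours of \<open>s\<close>. By symmetry this holds at all four chain ends.\<close>
    have H: "\<phi> ` (N s - S) = L (hd xs) - {\<phi> s, \<phi> t} \<and> length xs \<le> 2 \<and> card (\<phi> ` (N s - S)) = 2"
      if x: "chain N s xs t" and y: "chain N s ys t" and d: "set xs \<inter> set ys = {}"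
        and S: "S = set xs \<union> set ys" and st: "\<phi> s \<noteq> \<phi> t" for s t xs ys
    proof -
      note nb = parallel_nbrs[OF x y d S]
      have xs: "hd xs \<in> S" using x S by (auto simp: chain_def)
      have cA: "card (\<phi> ` (N s - S)) \<le> 2" using card_img2[OF _ nb(3), of \<phi>] by simp
      have len: "length xs \<le> 2"
      proof (rule ccontr)
        assume l: "\<not> length xs \<le> 2"
        have "card (insert (\<phi> s) (\<phi> ` (N s - S))) < card (L (hd xs))"
          using cA four[OF xs] by (simp add: card_insert_if)
        then obtain c where c: "c \<in> L (hd xs)" "c \<notin> insert (\<phi> s) (\<phi> ` (N s - S))"
          using pick_color[of "insert (\<phi> s) (\<phi> ` (N s - S))" "L (hd xs)"] by auto
        then show False using parallel_void[OF x y d S \<phi> st c(1)] l by auto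
      qed
      have sub: "L (hd xs) - {\<phi> s, \<phi> t} \<subseteq> \<phi> ` (N s - S)"
        using parallel_void[OF x y d S \<phi> st] by blast
      have "card (L (hd xs)) - card {\<phi> s, \<phi> t} \<le> card (L (hd xs) - {\<phi> s, \<phi> t})"
        by (rule diff_card_le_card_Diff) simp
      moreover have "card {\<phi> s, \<phi> t} = 2" using st by simp
      ultimately have "2 \<le> card (L (hd xs) - {\<phi> s, \<phi> t})" using four[OF xs] by linarith
      then have "L (hd xs) - {\<phi> s, \<phi> t} = \<phi> ` (N s - S)"
        using card_seteq[OF _ sub] cA by simp
      then show ?thesis using len cA \<open>2 \<le> card (L (hd xs) - {\<phi> s, \<phi> t})\<close> by simp
    qed
    note Hx = H[OF x y d S_def st] and Hy = H[OF y x d'(1) S'(1) st]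
    note Hx' = H[OF chain_rev[OF x] chain_rev[OF y] d'(2) S'(2) st[symmetric]]
      and Hy' = H[OF chain_rev[OF y] chain_rev[OF x] d'(3) S'(3) st[symmetric]]
    have Lx': "\<phi> ` (N t - S) = L (last xs) - {\<phi> s, \<phi> t}" "\<phi> ` (N t - S) = L (last ys) - {\<phi> s, \<phi> t}"
      using Hx' Hy' ne by (auto simp: hd_rev)
    have len: "length xs = length ys"
    proof -
      have "length xs = 1 \<or> length xs = 2" "length ys = 1 \<or> length ys = 2"
        using Hx Hy ne by (metis One_nat_def Suc_1 le_SucE le_zero_eq length_0_conv)+
      then show ?thesis using cond False by (metis insert_commute)
    qed
    \<comment> \<open>The chains have equal length and the same colours available at corresponding
      ends. So \<open>ys\<close> is given the same colours as \<open>xs\<close>.\<close>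
    obtain c where c: "c \<in> \<phi> ` (N s - S)" using Hx by (metis card.empty ex_in_conv zero_neq_numeral)
    have cL: "c \<in> L (hd xs)" "c \<in> L (hd ys)" "c \<noteq> \<phi> s" "c \<noteq> \<phi> t" using c Hx Hy by blast+
    have g: "good (V - S) \<phi>"
      by (rule good_if_sub[OF \<phi>])
        (use chain_good[OF x st, of S] chain_good[OF y st, of S] S_def in auto)
    have hne: "hd ys \<in> N s" "last ys \<in> N t" "hd xs \<in> N s" "last xs \<in> N t" "hd xs \<noteq> hd ys" "last xs \<noteq> last ys"
      using nb nbt by (auto simp: hd_rev)
    obtain \<phi>' where \<phi>': "good (V - S \<union> set xs) \<phi>'" "\<And>u. u \<in> V - S \<Longrightarrow> \<phi>' u = \<phi> u" "\<phi>' (hd xs) = c"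
    proof (rule chain_extend[OF x g sV(1,2) _ cL(1,3,4)])
      show "(V - S) \<inter> set xs = {}" using S_def by blast
      have "hd ys \<notin> insert (hd xs) (V - S)" using hne hS by auto
      then show "N s \<subseteq> insert (hd xs) (V - S) \<Longrightarrow> conflict_free (\<phi>(hd xs := c)) (N s)" using hne by blast
      have "last ys \<notin> insert (last xs) (V - S)" using hne hS by auto
      then show "N t \<subseteq> insert (last xs) (V - S) \<Longrightarrow> safe \<phi> (N t \<inter> (V - S))" using hne by blast
    qed auto
    let ?D = "V - S \<union> set xs"
    \<comment> \<open>A repeated colour at \<open>v\<close> and \<open>w\<close> is tolerable
      because the other two neighbours of \<open>r\<close> have distinct colours, one of which
      differs from the repeated one.\<close>
    have twin: "conflict_free \<psi> (N r)"
      if tw: "\<And>u. u \<in> V - S \<Longrightarrow> \<psi> u = \<phi> u" "N r = (N r - S) \<union> {v, w}" "r \<in> V - S" "card (N r - S) \<le> 2"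
        "card (\<phi> ` (N r - S)) = 2" "\<psi> v = d" "\<psi> w = d" for \<psi> r v w d
    proof -
      have "\<exists>u. u \<in> N r - S \<and> \<phi> u \<noteq> d"
      proof (rule ccontr)
        assume "\<not> ?thesis"
        then have "\<phi> ` (N r - S) \<subseteq> {d}" by blast
        then have "card (\<phi> ` (N r - S)) \<le> 1" by (metis card.empty card_insert_disjoint card_mono empty_iff finite.emptyI finite.insertI One_nat_def)
        then show False using tw(5) by simp
      qed
      then obtain u where u: "u \<in> N r - S" "\<phi> u \<noteq> d" by blast
      have inj: "inj_on \<phi> (N r - S)" using sub_inj[OF \<phi> tw(3,4)] .
      have NrV: "q \<in> V" if "q \<in> N r" for q using that N_sub by blast
      show ?thesis
      proof (rule conflict_freeI[of u])
        fix q assume q: "q \<in> N r" "q \<noteq> u"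
        then consider "q \<in> N r - S" | "q = v" | "q = w" using tw(2) by blast
        then show "\<psi> q \<noteq> \<psi> u"
        proof cases
          case 1
          then have "\<phi> q \<noteq> \<phi> u" using inj_onD[OF inj] u q by blast
          then show ?thesis using tw(1)[of q] tw(1)[of u] 1 u NrV[of q] NrV[of u] by auto
        qed (use tw(1)[of u] tw(6,7) u NrV[of u] in auto)
      qed (use u in blast)
    qed
    \<comment> \<open>Avoiding the colours of both ends puts the colour of the last vertex of
      \<open>xs\<close> into the list of the last vertex of \<open>ys\<close>, by the two equations
      in \<open>Lx'\<close>.\<close>
    have lx: "\<phi>' (last xs) \<in> L (last xs) - {\<phi> s, \<phi> t}"
    proof -
      have "last xs \<in> ?D" "t \<in> ?D" "last xs \<in> set xs" using ne sV by auto
      then have "\<phi>' (last xs) \<in> L (last xs)" "\<phi>' (last xs) \<noteq> \<phi>' t"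
        using good_proper[OF \<phi>'(1), of "last xs" t] hne(4) \<phi>'(1) unfolding good_def by blast+
      then have "\<phi>' (last xs) \<in> L (last xs)" "\<phi>' (last xs) \<noteq> \<phi> t"
        using \<phi>'(2)[OF sV(2)] by simp_all
      moreover have "\<phi>' (last xs) \<noteq> \<phi> s"
      proof (cases "length xs = 1")
        case True
        then have "last xs = hd xs" by (cases xs) auto
        then show ?thesis using \<phi>'(3) cL by simp
      next
        case False
        then have "length xs = 2" using Hx ne by (metis One_nat_def Suc_1 le_SucE le_zero_eq length_0_conv)
        then obtain p q where xs: "xs = [p, q]" by (metis Suc_1 length_0_conv length_Suc_conv One_nat_def)
        then have "N p = {s, q}" "s \<noteq> q" using x unfolding chain_def by auto
        then have "conflict_free \<phi>' {s, q}" using good_conflict_free[OF \<phi>'(1), of p] sV xs by auto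
        then show ?thesis using \<open>s \<noteq> q\<close> \<phi>'(2)[OF sV(1)] xs by (simp add: conflict_free_doubleton)
      qed
      ultimately show ?thesis by blast
    qed
    then have c'L: "\<phi>' (last xs) \<in> L (last ys)" "\<phi>' (last xs) \<noteq> \<phi> s" "\<phi>' (last xs) \<noteq> \<phi> t" using Lx' by auto
    have Ns: "N s = (N s - S) \<union> {hd xs, hd ys}" using nb(1) by blast
    have Nt: "N t = (N t - S) \<union> {last xs, last ys}" using nbt(1) ne by (auto simp: hd_rev)
    have cardB: "card (\<phi> ` (N t - S)) = 2" using Hx' by blast
    show False
    proof (cases "length ys = 1")
      case True
      then obtain w where ys: "ys = [w]" by (cases ys) auto
      obtain v where xs: "xs = [v]" using True len by (cases xs) auto
      have w: "w \<in> V" "w \<notin> ?D" using hS ys SV d S_def by auto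
      have Nw: "N w = {s, t}" using y ys unfolding chain_def by auto
      have "good (insert w ?D) (\<phi>'(w := c))"
      proof (rule good_step[OF \<phi>'(1) w])
        show "c \<in> L w" "c \<notin> \<phi>' ` (N w \<inter> ?D)" using cL ys Nw \<phi>'(2) sV d by auto
        show "conflict_free (\<phi>'(w := c)) (N u)" if "u \<in> N w" for u
        proof -
          have *: "(\<phi>'(w := c)) q = \<phi> q" if "q \<in> V - S" for q
            using \<phi>'(2)[OF that] that w by auto
          have **: "(\<phi>'(w := c)) v = c" "(\<phi>'(w := c)) w = c" using \<phi>'(3) xs by auto
          have "u = s \<or> u = t" using that Nw by auto
          then show ?thesis
          proof
            assume u: "u = s"
            show ?thesis unfolding u
              by (rule twin[OF * _ sV(1) nb(3) _ **]) (use Ns xs ys Hx in auto)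
          next
            assume u: "u = t"
            show ?thesis unfolding u
              by (rule twin[OF * _ sV(2) nbt(3) cardB **]) (use Nt xs ys in auto)
          qed
        qed
      qed
      moreover have "insert w ?D = V" using SV S_def ys by auto
      ultimately show False using not_good by metis
    next
      case False
      then have "length ys = 2" using Hy ne by (metis One_nat_def Suc_1 le_SucE le_zero_eq length_0_conv)
      then obtain w w' where ys: "ys = [w, w']" by (metis Suc_1 length_0_conv length_Suc_conv One_nat_def)
      obtain v v' where xs: "xs = [v, v']"
        using \<open>length ys = 2\<close> len by (metis Suc_1 length_0_conv length_Suc_conv One_nat_def)
      have w: "w \<in> V" "w \<notin> ?D" "w' \<in> V" "w' \<notin> ?D" "w \<noteq> w'" using hS ys SV d S_def y by (auto simp: chain_def)
      have Nw: "N w = {s, w'}" "N w' = {w, t}" "w \<noteq> t" "w' \<noteq> s" using y ys unfolding chain_def by auto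
      have vv: "v \<noteq> v'" "v \<noteq> w" "v \<noteq> w'" "v' \<noteq> w" "v' \<noteq> w'" using x xs ys d unfolding chain_def by auto
      define c' where "c' = \<phi>' v'"
      have cc': "c \<noteq> c'"
      proof -
        have "v' \<in> N v" using x xs unfolding chain_def by auto
        then have "\<phi>' v' \<noteq> \<phi>' v" using good_proper[OF \<phi>'(1), of v' v] xs by auto
        then show ?thesis using \<phi>'(3) xs c'_def by auto
      qed
      let ?\<phi> = "\<phi>'(w := c)"
      have old: "?\<phi> q = \<phi> q" if "q \<in> V - S" for q using \<phi>'(2)[OF that] that w by auto
      have g1: "good (insert w ?D) ?\<phi>"
      proof (rule good_step[OF \<phi>'(1) w(1,2)])
        show "c \<in> L w" "c \<notin> \<phi>' ` (N w \<inter> ?D)" using cL ys Nw \<phi>'(2) sV w by auto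
        show "conflict_free ?\<phi> (N u)" if u: "u \<in> N w" "N u \<subseteq> insert w ?D" for u
        proof -
          have **: "?\<phi> v = c" "?\<phi> w = c" using \<phi>'(3) xs vv by auto
          have "u = s \<or> u = w'" using u Nw by auto
          then show ?thesis
          proof
            assume u: "u = s"
            show ?thesis unfolding u
              by (rule twin[OF old _ sV(1) nb(3) _ **]) (use Ns xs ys Hx in auto)
          next
            assume "u = w'"
            then show ?thesis using Nw cL old[OF sV(2)] by (auto simp: conflict_free_doubleton)
          qed
        qed
      qed
      have old': "(?\<phi>(w' := c')) q = \<phi> q" if "q \<in> V - S" for q using old[OF that] that w by auto
      have "good (insert w' (insert w ?D)) (?\<phi>(w' := c'))"
      proof (rule good_step[OF g1 w(3)])
        show "w' \<notin> insert w ?D" using w by auto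
        show "c' \<in> L w'" using c'L ys xs c'_def by auto
        show "c' \<notin> ?\<phi> ` (N w' \<inter> insert w ?D)"
          using Nw cc' c'L xs c'_def old[OF sV(2)] by auto
        show "conflict_free (?\<phi>(w' := c')) (N u)" if u: "u \<in> N w'" for u
        proof -
          have **: "(?\<phi>(w' := c')) v' = c'" "(?\<phi>(w' := c')) w' = c'" using vv c'_def by auto
          have "u = w \<or> u = t" using u Nw by auto
          then show ?thesis
          proof
            assume u: "u = t"
            show ?thesis unfolding u
              by (rule twin[OF old' _ sV(2) nbt(3) cardB **]) (use Nt xs ys in auto)
          next
            assume u: "u = w"
            show ?thesis unfolding u Nw(1)
              using Nw c'L xs c'_def old'[OF sV(1)] by (subst conflict_free_doubleton) auto
          qed
        qed
      qed
      moreover have "insert w' (insert w ?D) = V" using SV S_def ys by auto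
      ultimately show False using not_good by metis
    qed
  qed
qed

end

text \<open>The contribution of the link to the degree of either end, an edge between the ends
  included.\<close>

fun width :: "'v link \<Rightarrow> nat" where
  "width NoLink = 0"
| "width Edge = 1"
| "width (Path xs) = 1"
| "width (Ear xs) = 2"
| "width (Pent x y z) = 2"

lemma width_rev [simp]: "width (rev_link l) = width l"
  by (cases l) auto

context list_graph
begin

lemma card_left_nbrs: "link l s t \<Longrightarrow> card (left_nbrs l t) = width l"
  by (cases l) (auto simp: chain_def card_insert_if)

lemma link_closed_inner:
  assumes "link l s t" "v \<in> link_verts l" "N v \<inter> link_verts l = {}"
  shows "N v = {s, t}" "s \<noteq> t"
proof -
  have sub: "N v \<subseteq> {s, t}" using link_inner_nbrs(1)[OF assms(1,2)] assms(3) by blast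
  have c: "card (N v) = 2" using link_inner_nbrs(2)[OF assms(1,2)] .
  have "card {s, t} \<le> 2" by (simp add: card_insert_if)
  then show "N v = {s, t}" using card_seteq[OF _ sub] c by simp
  then show "s \<noteq> t" using c by auto
qed

text \<open>As long as the inner vertices of a link are uncoloured, the neighbourhood of an end can
  be complete only if the link is missing or an edge.\<close>

lemma left_nbrs_closed:
  assumes "link l s t" "left_nbrs l t \<inter> link_verts l = {}" "l \<noteq> NoLink"
  shows "l = Edge" "left_nbrs l t = {t}"
  using assms by (cases l; auto simp: chain_def)+

end

section \<open>Vertices joining two wide links\<close>

context min_counterexample
begin

text \<open>As \<open>u\<close> has degree two, the link together with \<open>u\<close> is a closed
  path at \<open>b\<close>, which \<open>no_loop\<close> excludes.\<close>

lemma end_loop: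
  assumes l: "link l u b" and w: "width l = 2" and Nu: "N u = left_nbrs l b" and ub: "u \<noteq> b"
  shows False
proof (cases l)
  case (Ear xs)
  then have "path_nbrs N b (u # xs) b" "distinct (b # u # xs)" "2 \<le> length (u # xs)"
    using l Nu by (auto simp: chain_def Suc_le_eq)
  then show False by (rule no_loop)
next
  case (Pent x y z)
  have "N x = {u, b}" "N y = {u, z}" "N z = {y, b}" "y \<noteq> z" "x \<noteq> y" "x \<noteq> z" "x \<noteq> u" "x \<noteq> b"
    "y \<noteq> u" "z \<noteq> u" "y \<noteq> b" "z \<noteq> b"
    using l Pent by (auto simp: chain_def)
  moreover have "N u = {x, y}" using Nu Pent by simp
  ultimately have "path_nbrs N b [x, u, y, z] b" "distinct (b # [x, u, y, z])"
    using ub by (simp_all add: insert_commute)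
  then show False using no_loop[of b "[x, u, y, z]"] by simp
qed (use w in auto)

text \<open>The short side of a \<open>Pent\<close> needs a colour unlike those of both ends.
  Reserving it beforehand turns this need into a single colour to be avoided at an end that is
  coloured later. For other links the reserved colour is arbitrary.\<close>

lemma pent_reserve:
  assumes "link l s t" "finite F" "\<And>x y z. l = Pent x y z \<Longrightarrow> card F \<le> 3"
  obtains e where "\<And>x y z. l = Pent x y z \<Longrightarrow> e \<in> L x \<and> e \<notin> F"
proof (cases "\<exists>x y z. l = Pent x y z")
  case True
  then obtain x y z where P: "l = Pent x y z" by blast
  then have "4 \<le> card (L x)" using assms(1) chain_vertex(3)[of s "[x]" t x] by simp
  then obtain e where "e \<in> L x" "e \<notin> F" using pick_color[OF assms(2), of "L x"] assms(3)[OF P] by auto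
  then show ?thesis using P that by auto
qed (rule that[of undefined], blast)

text \<open>\<open>u\<close> has degree four and so at least six colours, of which it avoids at most
  five: those of \<open>a\<close> and \<open>b\<close>, at most two on the other neighbours of
  \<open>b\<close>, and the one reserved for \<open>l2\<close>. Then \<open>l1\<close> is coloured
  towards \<open>u\<close> and \<open>l2\<close> towards \<open>b\<close>.\<close>

lemma no_double_split:
  assumes l1: "link l1 a u" and l2: "link l2 u b" and w: "width l1 = 2" "width l2 = 2"
    and ne: "a \<noteq> u" "u \<noteq> b" and d: "link_verts l1 \<inter> link_verts l2 = {}" "a \<notin> link_verts l2" "b \<notin> link_verts l1" "a \<noteq> b"
    and Nu: "N u = right_nbrs l1 a \<union> left_nbrs l2 b"
  shows False
proof -
  define S where "S = insert u (link_verts l1 \<union> link_verts l2)"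
  note n1 = inner_not_ends[OF l1] and n2 = inner_not_ends[OF l2]
  have r1: "right_nbrs l1 a \<subseteq> link_verts l1 \<union> {a}" using left_nbrs_subset[OF link_rev[OF l1]] by simp
  have f2: "left_nbrs l2 b \<subseteq> link_verts l2 \<union> {b}" using left_nbrs_subset[OF l2] .
  have ne1: "l1 \<noteq> NoLink" "l1 \<noteq> Edge" "l2 \<noteq> NoLink" "l2 \<noteq> Edge" using w by auto
  have ex1: "left_nbrs l1 u \<inter> link_verts l1 \<noteq> {}" "right_nbrs l1 a \<inter> link_verts l1 \<noteq> {}"
    using left_nbrs_closed(1)[OF l1] left_nbrs_closed(1)[OF link_rev[OF l1]] ne1 by auto
  have ex2: "left_nbrs l2 b \<inter> link_verts l2 \<noteq> {}" "right_nbrs l2 u \<inter> link_verts l2 \<noteq> {}"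
    using left_nbrs_closed(1)[OF l2] left_nbrs_closed(1)[OF link_rev[OF l2]] ne1 by auto
  have uV: "u \<in> V" using Nu ex1 N_outside by fastforce
  have SV: "S \<subseteq> V" using link_inner_nbrs(3)[OF l1] link_inner_nbrs(3)[OF l2] uV S_def by auto
  have Na: "left_nbrs l1 u \<subseteq> N a" using link_nbrs_left[OF l1] by blast
  have Nb: "N b \<inter> S = right_nbrs l2 u"
    using link_nbrs_right[OF l2] link_far_nbrs[OF l1, of b] d ne by (auto simp: S_def)
  have abV: "a \<in> V - S" "b \<in> V - S"
  proof -
    have "a \<in> V" "b \<in> V" using Na Nb ex1 ex2 N_outside by fastforce+
    then show "a \<in> V - S" "b \<in> V - S" using d ne n1 n2 S_def by auto
  qed
  define B where "B = N b - S"
  have NbB: "N b = B \<union> right_nbrs l2 u" "B \<inter> right_nbrs l2 u = {}" using Nb B_def by blast+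
  have "card (N b) = card B + 2"
    using card_left_nbrs[OF link_rev[OF l2]] w NbB card_Un_disjoint[of B "right_nbrs l2 u"] by (simp add: B_def)
  then have cB: "card B \<le> 2" using N_card[of b] by simp
  \<comment> \<open>If \<open>b\<close> had no neighbour outside the link, it would close a loop
    with it.\<close>
  have Bne: "B \<noteq> {}"
    using end_loop[OF link_rev[OF l2]] w NbB(1) ne by auto
  obtain \<phi> where \<phi>: "sub (V - S) \<phi>" using obtain_sub[OF SV] S_def by blast
  have inj: "inj_on \<phi> B" using sub_inj[OF \<phi> abV(2)] cB B_def by simp
  let ?D = "V - S"
  have g: "good ?D \<phi>"
  proof (rule good_minus_links[OF \<phi> SV])
    fix v assume v: "v \<in> S"
    then consider "v = u" | "v \<in> link_verts l1" | "v \<in> link_verts l2" using S_def by blast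
    then show "N v \<inter> S \<noteq> {}"
    proof cases
      case 1 then show ?thesis using Nu ex1 S_def by auto
    next
      case 2 then show ?thesis using link_inner_next[OF l1 2] S_def by blast
    next
      case 3 then show ?thesis using link_inner_prev[OF l2 3] S_def by blast
    qed
  qed
  have "card (insert (\<phi> b) (\<phi> ` B)) \<le> 3"
    using card_img2[OF _ cB, of \<phi>] by (simp add: card_insert_if B_def)
  then obtain e where e: "\<And>x y z. l2 = Pent x y z \<Longrightarrow> e \<in> L x \<and> e \<noteq> \<phi> b \<and> e \<notin> \<phi> ` B"
    using pent_reserve[OF l2, of "insert (\<phi> b) (\<phi> ` B)"] by (auto simp: B_def)
  have "right_nbrs l1 a \<inter> left_nbrs l2 b = {}" using r1 f2 d by blast
  then have "card (N u) = 4"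
    using Nu card_left_nbrs[OF l2] card_left_nbrs[OF link_rev[OF l1]] w by (simp add: card_Un_disjoint)
  then have "6 \<le> card (L u)" using L_card[OF uV] by simp
  moreover have "card (insert (\<phi> a) (insert (\<phi> b) (insert e (\<phi> ` B)))) \<le> 5"
    using card_img2[OF _ cB, of \<phi>] by (simp add: card_insert_if B_def)
  ultimately obtain k where k: "k \<in> L u" "k \<notin> insert (\<phi> a) (insert (\<phi> b) (insert e (\<phi> ` B)))"
    using pick_color[of "insert (\<phi> a) (insert (\<phi> b) (insert e (\<phi> ` B)))" "L u"] by (auto simp: B_def)
  define \<phi>1 where "\<phi>1 = \<phi>(u := k)"
  define D1 where "D1 = insert u ?D"
  have uD: "u \<notin> ?D" using S_def by simp
  have g1: "good D1 \<phi>1"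
    unfolding D1_def \<phi>1_def
  proof (rule good_step[OF g uV uD k(1)])
    have "N u \<inter> ?D \<subseteq> {a, b}" using Nu r1 f2 S_def by blast
    then show "k \<notin> \<phi> ` (N u \<inter> ?D)" using k(2) by blast
    fix v assume v: "v \<in> N u" "N v \<subseteq> insert u ?D"
    have io: "link_verts l1 \<inter> insert u ?D = {}" "link_verts l2 \<inter> insert u ?D = {}" using S_def n1 n2 by auto
    consider "v = a" | "v = b" | "v \<in> link_verts l1" | "v \<in> link_verts l2" using v(1) Nu r1 f2 by blast
    then show "conflict_free (\<phi>(u := k)) (N v)"
    proof cases
      case 1 then show ?thesis using Na ex1(1) io v(2) by blast
    next
      case 2 then show ?thesis using Nb ex2(2) io v(2) by blast
    next
      case 3
      then have "N v = {a, u}" using link_closed_inner[OF l1 3] v(2) io by blast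
      then show ?thesis using k(2) ne by (auto simp: conflict_free_doubleton)
    next
      case 4
      then have "N v = {u, b}" using link_closed_inner[OF l2 4] v(2) io by blast
      then show ?thesis using k(2) ne by (auto simp: conflict_free_doubleton)
    qed
  qed
  have \<phi>1: "\<phi>1 u = k" "\<And>v. v \<in> ?D \<Longrightarrow> \<phi>1 v = \<phi> v" using uD by (auto simp: \<phi>1_def)
  \<comment> \<open>\<open>N u\<close> stays incomplete until \<open>l2\<close> is coloured, so both
    conditions at the right end of \<open>l1\<close> hold vacuously.\<close>
  have no: "\<not> N u \<subseteq> D1 \<union> link_verts l1"
    using Nu ex2(1) d(1) n2 unfolding D1_def S_def by blast
  obtain \<phi>2 where \<phi>2: "good (D1 \<union> link_verts l1) \<phi>2" "\<And>v. v \<in> D1 \<Longrightarrow> \<phi>2 v = \<phi>1 v"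
  proof (rule link_solve[OF l1 g1])
    show "a \<in> D1" "u \<in> D1" using abV D1_def by auto
    show "D1 \<inter> link_verts l1 = {}" using n1 by (auto simp: D1_def S_def)
    show "\<phi>1 a \<noteq> \<phi>1 u" using \<phi>1 abV k(2) by auto
  qed (use no in blast)+
  let ?D2 = "D1 \<union> link_verts l1"
  have \<phi>2': "\<phi>2 v = \<phi> v" if "v \<in> ?D" for v using \<phi>2(2)[of v] \<phi>1(2)[OF that] that by (simp add: D1_def)
  have \<phi>2u: "\<phi>2 u = k" using \<phi>2(2)[of u] \<phi>1 by (simp add: D1_def)
  have BD: "B \<subseteq> ?D" using N_sub B_def by blast
  have injB: "inj_on \<phi>2 B" "\<phi>2 ` B = \<phi> ` B"
    using inj \<phi>2' BD by (metis inj_on_cong subsetD, metis image_cong subsetD)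
  have fb: "N b \<inter> link_verts l1 = {}" using link_far_nbrs[OF l1, of b] d ne by auto
  have NbD: "N b \<inter> ?D2 = B \<union> (right_nbrs l2 u \<inter> {u})"
    using NbB(1) BD fb n2 left_nbrs_subset[OF link_rev[OF l2]] by (auto simp: D1_def S_def B_def)
  obtain \<phi>3 where "good (?D2 \<union> link_verts l2) \<phi>3"
  proof (rule link_solve[OF l2 \<phi>2(1)])
    show "u \<in> ?D2" "b \<in> ?D2" using abV by (auto simp: D1_def)
    show "?D2 \<inter> link_verts l2 = {}" using n2 d by (auto simp: D1_def S_def)
    show "\<phi>2 u \<noteq> \<phi>2 b" using \<phi>2u \<phi>2'[OF abV(2)] k by auto
  next
    fix xs assume "l2 = Path xs \<or> l2 = Ear xs"
    then have E: "l2 = Ear xs" using w by auto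
    have uB: "u \<notin> B" using S_def B_def by simp
    have NbD': "N b \<inter> ?D2 = insert u B" unfolding NbD using E by auto
    have "\<phi>2 u \<notin> \<phi>2 ` B" using \<phi>2u injB k by auto
    then have "inj_on \<phi>2 (insert u B)" using injB uB by (simp add: inj_on_insert)
    then show "safe \<phi>2 (N b \<inter> ?D2)" unfolding NbD' using uB Bne by (intro safe_insertI)
  next
    fix x y z assume P: "l2 = Pent x y z"
    have "right_nbrs l2 u \<inter> {u} = {}" using P n2 by auto
    then have NbD': "N b \<inter> ?D2 = B" using NbD by auto
    have "e \<in> L x \<and> e \<noteq> \<phi>2 u \<and> e \<noteq> \<phi>2 b \<and> e \<notin> \<phi>2 ` B"
      using e[OF P] k \<phi>2u \<phi>2'[OF abV(2)] injB by auto
    then show "inj_on \<phi>2 (N b \<inter> ?D2) \<and> N b \<inter> ?D2 \<noteq> {} \<and>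
      (\<exists>e\<in>L x. e \<noteq> \<phi>2 u \<and> e \<noteq> \<phi>2 b \<and> e \<notin> \<phi>2 ` (N b \<inter> ?D2))"
      unfolding NbD' using injB Bne by blast
  qed blast
  moreover have "?D2 \<union> link_verts l2 = V" using SV by (auto simp: D1_def S_def)
  ultimately show False using not_good by metis
qed

end

section \<open>Two crossing edges and three links between their ends\<close>

context min_counterexample
begin

text \<open>Colour \<open>z\<close> and \<open>y\<close> first and then the three links from left to right. Each link completes
  the neighbourhood of its left end only; for the last one this needs colours of \<open>z\<close> and \<open>y\<close> that
  make the neighbourhood of \<open>b\<close> safe.\<close>

lemma no_crossing_aux:
  assumes l1: "link l1 a z" and l2: "link l2 z y" and l3: "link l3 y b"
    and nl: "l1 \<noteq> NoLink" "l2 \<noteq> NoLink" "l3 \<noteq> NoLink"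
    and ay: "y \<in> N a" and zb: "b \<in> N z"
    and dist: "distinct [a, z, y, b]"
    and dj: "link_verts l1 \<inter> link_verts l2 = {}" "link_verts l1 \<inter> link_verts l3 = {}" "link_verts l2 \<inter> link_verts l3 = {}"
    and out: "a \<notin> link_verts l2" "a \<notin> link_verts l3" "b \<notin> link_verts l1" "b \<notin> link_verts l2" "y \<notin> link_verts l1" "z \<notin> link_verts l3"
    and Nz: "N z = insert b (right_nbrs l1 a \<union> left_nbrs l2 y)" and Ny: "N y = insert a (right_nbrs l2 z \<union> left_nbrs l3 b)"
    and S: "S = {z, y} \<union> link_verts l1 \<union> link_verts l2 \<union> link_verts l3"
    and Bne: "\<And>xs. l3 = Path xs \<Longrightarrow> N b - S \<noteq> {}"
  shows False
proof -
  note n1 = inner_not_ends[OF l1] and n2 = inner_not_ends[OF l2] and n3 = inner_not_ends[OF l3]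
  note r1 = link_rev[OF l1] and r2 = link_rev[OF l2] and r3 = link_rev[OF l3]
  have L1: "left_nbrs l1 z \<subseteq> link_verts l1 \<union> {z}" and R1: "right_nbrs l1 a \<subseteq> link_verts l1 \<union> {a}"
    and L2: "left_nbrs l2 y \<subseteq> link_verts l2 \<union> {y}" and R2: "right_nbrs l2 z \<subseteq> link_verts l2 \<union> {z}"
    and L3: "left_nbrs l3 b \<subseteq> link_verts l3 \<union> {b}" and R3: "right_nbrs l3 y \<subseteq> link_verts l3 \<union> {y}"
    using left_nbrs_subset[OF l1] left_nbrs_subset[OF l2] left_nbrs_subset[OF l3]
      left_nbrs_subset[OF r1] left_nbrs_subset[OF r2] left_nbrs_subset[OF r3] by simp_all
  have ne: "a \<noteq> z" "a \<noteq> y" "a \<noteq> b" "z \<noteq> y" "z \<noteq> b" "y \<noteq> b" using dist by auto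
  have SV: "S \<subseteq> V"
    using link_inner_nbrs(3)[OF l1] link_inner_nbrs(3)[OF l2] link_inner_nbrs(3)[OF l3] in_V_if_nbr[OF ay]
      in_V_if_nbr[OF zb] unfolding S by auto
  have abV: "a \<in> V - S" "b \<in> V - S"
    using in_V_if_nbr[OF ay] in_V_if_nbr[OF zb] ne out n1 n3 unfolding S by auto
  have fa: "N a \<inter> link_verts l2 = {}" "N a \<inter> link_verts l3 = {}" and fb: "N b \<inter> link_verts l1 = {}" "N b \<inter> link_verts l2 = {}"
    using link_far_nbrs[OF l2, of a] link_far_nbrs[OF l3, of a] link_far_nbrs[OF l1, of b]
      link_far_nbrs[OF l2, of b] ne out by auto
  have NaS: "N a \<inter> S = insert y (left_nbrs l1 z)"
    using link_nbrs_left[OF l1] fa ay unfolding S by blast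
  have zNb: "z \<in> N b" using zb N_commute by blast
  have NbS: "N b \<inter> S = insert z (right_nbrs l3 y)"
    using link_nbrs_right[OF l3] fb zNb unfolding S by blast
  define A B where "A = N a - S" and "B = N b - S"
  have NaA: "N a = A \<union> insert y (left_nbrs l1 z)" and NbB: "N b = B \<union> insert z (right_nbrs l3 y)"
    using NaS NbS unfolding A_def B_def by blast+
  have finAB: "finite A" "finite B" by (simp_all add: A_def B_def)
  have w: "1 \<le> width l1" "1 \<le> width l2" "1 \<le> width l3" using nl by (cases l1; cases l2; cases l3; simp)+
  have yl: "y \<notin> left_nbrs l1 z" "z \<notin> right_nbrs l3 y" using L1 R3 ne out by auto
  have cA: "card (N a) = card A + 1 + width l1"
  proof -
    have "A \<inter> insert y (left_nbrs l1 z) = {}" using NaS unfolding A_def by blast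
    then have "card (A \<union> insert y (left_nbrs l1 z)) = card A + card (insert y (left_nbrs l1 z))"
      using finAB by (intro card_Un_disjoint) auto
    then show ?thesis using card_left_nbrs[OF l1] yl(1) unfolding NaA[symmetric] by simp
  qed
  have cB: "card (N b) = card B + 1 + width l3"
  proof -
    have "B \<inter> insert z (right_nbrs l3 y) = {}" using NbS unfolding B_def by blast
    then have "card (B \<union> insert z (right_nbrs l3 y)) = card B + card (insert z (right_nbrs l3 y))"
      using finAB by (intro card_Un_disjoint) auto
    then show ?thesis using card_left_nbrs[OF r3] yl(2) unfolding NbB[symmetric] by simp
  qed
  have cz: "card (N z) = 1 + width l1 + width l2"
  proof -
    have "right_nbrs l1 a \<inter> left_nbrs l2 y = {}" "b \<notin> right_nbrs l1 a \<union> left_nbrs l2 y" using R1 L2 ne out dj by blast+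
    then show ?thesis using Nz card_left_nbrs[OF l2] card_left_nbrs[OF r1] by (simp add: card_Un_disjoint)
  qed
  have cy: "card (N y) = 1 + width l2 + width l3"
  proof -
    have "right_nbrs l2 z \<inter> left_nbrs l3 b = {}" "a \<notin> right_nbrs l2 z \<union> left_nbrs l3 b" using R2 L3 ne out dj by blast+
    then show ?thesis using Ny card_left_nbrs[OF l3] card_left_nbrs[OF r2] by (simp add: card_Un_disjoint)
  qed
  have cB2: "card B + width l3 \<le> 3" using cB N_card[of b] by simp
  have cA2: "card A \<le> 2" using cA N_card[of a] w by simp
  \<comment> \<open>If the links at \<open>z\<close> or \<open>y\<close> are edges, then
    \<open>{a, b}\<close> is the part of the neighbourhood that must be safe, so \<open>a\<close>
    and \<open>b\<close> need different colours.\<close>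
  obtain \<phi> where \<phi>: "sub (V - S) \<phi>" and ab: "\<phi> a \<noteq> \<phi> b"
  proof -
    obtain \<phi>0 where \<phi>0: "sub (V - S) \<phi>0" using obtain_sub[OF SV] S by blast
    show ?thesis
    proof (cases "b \<in> N a")
      case True
      then have "\<phi>0 b \<noteq> \<phi>0 a" using \<phi>0 abV unfolding sub_def by blast
      then show ?thesis using that[OF \<phi>0] by auto
    next
      case False
      have "card A + 2 \<le> card (N a)" using cA w by simp
      then show ?thesis using recolor[OF \<phi>0 abV(1) ne(3) False] cA2 that unfolding A_def by blast
    qed
  qed
  have inj: "inj_on \<phi> B" using sub_inj[OF \<phi> abV(2)] cB2 w unfolding B_def by simp
  let ?D0 = "V - S"
  have BD: "B \<subseteq> ?D0" using N_sub B_def by blast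
  have exl2: "left_nbrs l2 y \<inter> S \<noteq> {}" "right_nbrs l2 z \<inter> S \<noteq> {}"
    using left_nbrs_nonempty[of l2 y] left_nbrs_nonempty[of "rev_link l2" z] nl L2 R2 unfolding S by auto
  have g: "good ?D0 \<phi>"
  proof (rule good_minus_links[OF \<phi> SV])
    fix v assume v: "v \<in> S"
    then consider "v = z" | "v = y" | "v \<in> link_verts l1" | "v \<in> link_verts l2" | "v \<in> link_verts l3" using S by blast
    then show "N v \<inter> S \<noteq> {}"
    proof cases
      case 1 then show ?thesis using Nz exl2 by auto
    next
      case 2 then show ?thesis using Ny exl2 by auto
    next
      case 3 then show ?thesis using link_inner_next[OF l1 3] S by blast
    next
      case 4 then show ?thesis using link_inner_prev[OF l2 4] S by blast
    next
      case 5 then show ?thesis using link_inner_prev[OF l3 5] S by blast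
    qed
  qed
  have zyV: "z \<in> V" "y \<in> V" "z \<notin> ?D0" "y \<notin> ?D0" using S SV by auto
  have cLz: "3 + width l1 + width l2 \<le> card (L z)" using L_card[OF zyV(1)] cz by simp
  have cLy: "3 + width l2 + width l3 \<le> card (L y)" using L_card[OF zyV(2)] cy by simp
  have finB: "finite (\<phi> ` B)" by (simp add: B_def)
  have cfB: "card (\<phi> ` B) \<le> card B" using card_image_le[of B \<phi>] by (simp add: B_def)
  \<comment> \<open>At most four colours are avoided at \<open>z\<close>, since
    \<open>card B\<close> is at most two. Its degree is at least three, so it has five.\<close>
  have "card (insert (\<phi> a) (insert (\<phi> b) (\<phi> ` B))) \<le> 2 + card B"
    using cfB finB by (simp add: card_insert_if)
  then obtain kz where kz: "kz \<in> L z" "kz \<noteq> \<phi> a" "kz \<noteq> \<phi> b" "kz \<notin> \<phi> ` B"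
    using pick_color[of "insert (\<phi> a) (insert (\<phi> b) (\<phi> ` B))" "L z"] cLz cB2 w finB by auto
  define \<phi>1 where "\<phi>1 = \<phi>(z := kz)"
  define D1 where "D1 = insert z ?D0"
  have \<phi>1: "\<phi>1 z = kz" "\<And>v. v \<in> ?D0 \<Longrightarrow> \<phi>1 v = \<phi> v" using zyV by (auto simp: \<phi>1_def)
  have ioD0: "link_verts l1 \<inter> ?D0 = {}" "link_verts l2 \<inter> ?D0 = {}" "link_verts l3 \<inter> ?D0 = {}" using S by auto
  have g1: "good D1 \<phi>1"
    unfolding D1_def \<phi>1_def
  proof (rule good_step[OF g zyV(1,3) kz(1)])
    have "N z \<inter> ?D0 \<subseteq> {a, b}" using Nz R1 L2 S by blast
    then show "kz \<notin> \<phi> ` (N z \<inter> ?D0)" using kz by blast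
    fix v assume v: "v \<in> N z" "N v \<subseteq> insert z ?D0"
    have io: "link_verts l1 \<inter> insert z ?D0 = {}" "link_verts l2 \<inter> insert z ?D0 = {}" "link_verts l3 \<inter> insert z ?D0 = {}"
      "y \<notin> insert z ?D0" using ioD0 n1 n2 out ne zyV by auto
    consider "v = a" | "v = b" | "v = y" | "v \<in> link_verts l1" | "v \<in> link_verts l2" using v(1) Nz R1 L2 by blast
    then show "conflict_free (\<phi>(z := kz)) (N v)"
    proof cases
      case 1 then show ?thesis using ay io v(2) by blast
    next
      case 2
      have "right_nbrs l3 y \<inter> (link_verts l3 \<union> {y}) \<noteq> {}" using R3 left_nbrs_nonempty[of "rev_link l3" y] nl by auto
      then show ?thesis using NbB 2 io v(2) by blast
    next
      case 3
      have "right_nbrs l2 z \<inter> link_verts l2 = {}" "left_nbrs l3 b \<inter> link_verts l3 = {}" using v(2) 3 Ny io by blast+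
      then have "N y = {a, z, b}" using Ny left_nbrs_closed(2)[OF r2] left_nbrs_closed(2)[OF l3] nl by auto
      then have "N y - {z} = insert a {b}" using ne by auto
      moreover have "safe (\<phi>(z := kz)) (insert a {b})"
        using ab ne by (intro safe_insertI) auto
      ultimately show ?thesis using conflict_free_safe[of _ "N y" z] 3 by simp
    next
      case 4
      then have "N v = {a, z}" using link_closed_inner[OF l1 4] v(2) io by blast
      then show ?thesis using kz ne by (auto simp: conflict_free_doubleton)
    next
      case 5
      obtain q where "q \<in> N v" "q \<in> link_verts l2 \<union> {y}" using link_inner_next[OF l2 5] .
      then show ?thesis using v(2) io by blast
    qed
  qed
  have "y \<in> N a" by (rule ay)
  then obtain ra where ra: "\<And>c. c \<noteq> ra \<Longrightarrow> conflict_free (\<phi>1(y := c)) (N a)"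
    using conflict_free_one_forbidden[of "N a" y \<phi>1] N_card by auto
  have c3: "card {\<phi> a, \<phi> b, kz} \<le> 3" by (simp add: card_insert_if)
  obtain e1 where e1: "\<And>x p q. l1 = Pent x p q \<Longrightarrow> e1 \<in> L x \<and> e1 \<notin> {\<phi> a, \<phi> b, kz}"
    using pent_reserve[OF l1 _ c3] by auto
  obtain e2 where e2: "\<And>x p q. l2 = Pent x p q \<Longrightarrow> e2 \<in> L x \<and> e2 \<notin> {\<phi> a, \<phi> b, kz}"
    using pent_reserve[OF l2 _ c3] by auto
  have fin3: "finite (insert (\<phi> b) (insert kz (\<phi> ` B)))" using finB by simp
  have card3: "card (insert (\<phi> b) (insert kz (\<phi> ` B))) \<le> 3" if "l3 = Pent x p q" for x p q
    using cB2 cfB finB that by (simp add: card_insert_if)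
  obtain e3 where e3: "\<And>x p q. l3 = Pent x p q \<Longrightarrow> e3 \<in> L x \<and> e3 \<notin> insert (\<phi> b) (insert kz (\<phi> ` B))"
    by (rule pent_reserve[OF l3 fin3]) (use card3 in blast)+
  \<comment> \<open>One forbidden colour serves two purposes: \<open>y\<close> completes
    \<open>N a\<close> only if \<open>l1\<close> is an edge, and a colour is reserved for
    \<open>l1\<close> only if it is a pentagon.\<close>
  define r1' where "r1' = (if l1 = Edge then ra else e1)"
  \<comment> \<open>The further colours that \<open>y\<close> avoids for the sake of
    \<open>b\<close> and \<open>l2\<close>. If \<open>l3\<close> is an ear, \<open>y\<close> is a
    neighbour of \<open>b\<close> and must not repeat a colour of \<open>B\<close>; if it is a
    pentagon, its reserved colour stays free. The colour reserved for \<open>l2\<close> matters when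
    \<open>l3\<close> is an edge, as \<open>N y\<close> is incomplete otherwise. Every colour in
    \<open>Y\<close> is paid for by the larger width of \<open>l2\<close> or
    \<open>l3\<close>.\<close>
  define Y where "Y = (case l3 of Ear xs \<Rightarrow> \<phi> ` B | Pent x p q \<Rightarrow> {e3}
    | _ \<Rightarrow> (case l2 of Pent x p q \<Rightarrow> {e2} | _ \<Rightarrow> {}))"
  have finY: "finite Y" unfolding Y_def using finB by (auto split: link.splits)
  have "4 + card Y < card (L y)"
    using cLy w cB2 cfB unfolding Y_def by (cases l3; cases l2; simp)
  moreover have "card (insert (\<phi> a) (insert (\<phi> b) (insert kz (insert r1' Y)))) \<le> 4 + card Y"
    using finY by (simp add: card_insert_if)
  ultimately obtain ky where "ky \<in> L y" "ky \<notin> insert (\<phi> a) (insert (\<phi> b) (insert kz (insert r1' Y)))"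
    using pick_color[of "insert (\<phi> a) (insert (\<phi> b) (insert kz (insert r1' Y)))" "L y"] finY by auto
  then have ky: "ky \<in> L y" "ky \<noteq> \<phi> a" "ky \<noteq> \<phi> b" "ky \<noteq> kz" "ky \<noteq> r1'" "ky \<notin> Y" by auto
  define \<phi>2 where "\<phi>2 = \<phi>1(y := ky)"
  define D2 where "D2 = insert y D1"
  have yD1: "y \<notin> D1" using zyV ne by (auto simp: D1_def)
  have \<phi>2: "\<phi>2 y = ky" "\<phi>2 z = kz" "\<And>v. v \<in> ?D0 \<Longrightarrow> \<phi>2 v = \<phi> v"
    using \<phi>1 zyV ne by (auto simp: \<phi>2_def)
  have D2: "D2 = insert y (insert z ?D0)" by (simp add: D2_def D1_def)
  have io: "link_verts l1 \<inter> D2 = {}" "link_verts l2 \<inter> D2 = {}" "link_verts l3 \<inter> D2 = {}"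
    using ioD0 n1 n2 n3 out unfolding D2 by auto
  have g2: "good D2 \<phi>2"
    unfolding D2_def \<phi>2_def
  proof (rule good_step[OF g1 zyV(2) yD1 ky(1)])
    have "N y \<inter> D1 \<subseteq> {a, b, z}" using Ny R2 L3 S unfolding D1_def by blast
    then show "ky \<notin> \<phi>1 ` (N y \<inter> D1)" using ky \<phi>1 abV by auto
    fix v assume v: "v \<in> N y" "N v \<subseteq> insert y D1"
    then have v2: "N v \<subseteq> D2" by (simp add: D2_def)
    consider "v = a" | "v = b" | "v = z" | "v \<in> link_verts l2" | "v \<in> link_verts l3" using v(1) Ny R2 L3 by blast
    then show "conflict_free (\<phi>1(y := ky)) (N v)"
    proof cases
      case 1
      then have "left_nbrs l1 z \<inter> link_verts l1 = {}" using NaA v2 io by blast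
      then have "l1 = Edge" using left_nbrs_closed(1)[OF l1] nl by blast
      then show ?thesis using ra 1 ky(5) by (simp add: r1'_def)
    next
      case 2
      then have "right_nbrs l3 y \<inter> link_verts l3 = {}" using NbB v2 io by blast
      then have "right_nbrs l3 y = {y}" using left_nbrs_closed(2)[OF r3] nl by auto
      then have Nb: "N b - {y} = insert z B"
        using NbB ne S unfolding B_def by auto
      have zB: "z \<notin> B" "y \<notin> B" using S B_def by auto
      show ?thesis
      proof (cases "B = {}")
        case True
        then have "N b = {z, y}" using NbB \<open>right_nbrs l3 y = {y}\<close> by auto
        then show ?thesis using 2 ne ky \<phi>1 by (simp add: conflict_free_doubleton)
      next
        case False
        have "inj_on (\<phi>1(y := ky)) (insert z B) \<longleftrightarrow> inj_on (\<phi>(z := kz)) (insert z B)"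
          using zB ne unfolding \<phi>1_def by (intro inj_on_cong) auto
        moreover have "inj_on (\<phi>(z := kz)) (insert z B)"
          using inj kz(4) zB by (auto simp: inj_on_def)
        ultimately have "safe (\<phi>1(y := ky)) (insert z B)" using zB False by (intro safe_insertI) auto
        then show ?thesis using conflict_free_safe[of _ "N b" y] Nb 2 by simp
      qed
    next
      case 3
      then have "right_nbrs l1 a \<inter> link_verts l1 = {}" "left_nbrs l2 y \<inter> link_verts l2 = {}" using Nz v2 io by blast+
      then have "N z = {b, a, y}" using Nz left_nbrs_closed(2)[OF r1] left_nbrs_closed(2)[OF l2] nl by auto
      then have "N z - {y} = insert a {b}" using ne by auto
      moreover have "safe (\<phi>1(y := ky)) (insert a {b})"
        using ab ne \<phi>1 abV by (intro safe_insertI) auto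
      ultimately show ?thesis using conflict_free_safe[of _ "N z" y] 3 by simp
    next
      case 4
      then have "N v = {z, y}" using link_closed_inner[OF l2 4] v2 io by blast
      then show ?thesis using ky \<phi>1 ne by (auto simp: conflict_free_doubleton)
    next
      case 5
      then have "N v = {y, b}" using link_closed_inner[OF l3 5] v2 io by blast
      then show ?thesis using ky \<phi>1 ne abV by (auto simp: conflict_free_doubleton)
    qed
  qed
  have abD2: "a \<in> D2" "b \<in> D2" "z \<in> D2" "y \<in> D2" using abV unfolding D2 by auto
  have inj_sub: "inj_on f M" if "inj_on f K" "M \<subseteq> K" for f :: "'v \<Rightarrow> 'c" and M K
    using that inj_on_subset by blast
  have two: "safe f M" if "inj_on f M" "p \<in> M" "q \<in> M" "p \<noteq> q" for f :: "'v \<Rightarrow> 'c" and M p q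
    using that unfolding safe_def by blast
  have c4: "\<phi>2 a = \<phi> a" "\<phi>2 b = \<phi> b" using \<phi>2 abV by auto
  have injaby: "inj_on \<phi>2 {a, b, y}" using c4 \<phi>2 ky ab by auto
  obtain \<phi>3 where \<phi>3: "good (D2 \<union> link_verts l1) \<phi>3" "\<And>v. v \<in> D2 \<Longrightarrow> \<phi>3 v = \<phi>2 v"
  proof (rule link_solve[OF l1 g2])
    show "a \<in> D2" "z \<in> D2" "D2 \<inter> link_verts l1 = {}" using abD2 io by auto
    show "\<phi>2 a \<noteq> \<phi>2 z" using \<phi>2 c4 kz by auto
  next
    \<comment> \<open>\<open>N z\<close> can become complete here only if \<open>l2\<close> is an
      edge, and then \<open>b\<close> and \<open>y\<close> are two differently coloured members of
      it.\<close>
    fix xs assume "N z \<subseteq> D2 \<union> link_verts l1"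
    then have "left_nbrs l2 y \<inter> link_verts l2 = {}" using Nz io dj by blast
    then have y: "left_nbrs l2 y = {y}" using left_nbrs_closed(2)[OF l2] nl by blast
    have "N z \<inter> D2 \<subseteq> {a, b, y}" using Nz y R1 io by blast
    moreover have "b \<in> N z \<inter> D2" "y \<in> N z \<inter> D2" using y Nz abD2 by auto
    ultimately show "safe \<phi>2 (N z \<inter> D2)" using two inj_sub[OF injaby] ne by blast
  next
    fix x p q assume P: "l1 = Pent x p q" and "N z \<subseteq> D2 \<union> link_verts l1"
    then have "left_nbrs l2 y \<inter> link_verts l2 = {}" using Nz io dj by blast
    then have y: "left_nbrs l2 y = {y}" using left_nbrs_closed(2)[OF l2] nl by blast
    have "right_nbrs l1 a \<inter> D2 = {}" using P io by auto
    then have sub: "N z \<inter> D2 \<subseteq> {b, y}" using Nz y by blast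
    moreover have "N z \<inter> D2 \<noteq> {}" using Nz abD2 by blast
    moreover have "e1 \<noteq> \<phi>2 a \<and> e1 \<noteq> \<phi>2 z \<and> e1 \<notin> \<phi>2 ` {b, y}" "e1 \<in> L x"
      using e1[OF P] \<phi>2 c4 ky(5) P by (auto simp: r1'_def)
    ultimately show "inj_on \<phi>2 (N z \<inter> D2) \<and> N z \<inter> D2 \<noteq> {} \<and>
      (\<exists>e\<in>L x. e \<noteq> \<phi>2 a \<and> e \<noteq> \<phi>2 z \<and> e \<notin> \<phi>2 ` (N z \<inter> D2))"
      using inj_sub[OF injaby] by blast
  qed blast
  define D3 where "D3 = D2 \<union> link_verts l1"
  have c3: "\<phi>3 a = \<phi> a" "\<phi>3 b = \<phi> b" "\<phi>3 y = ky" "\<phi>3 z = kz" using \<phi>3(2) abD2 c4 \<phi>2 by auto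
  have abD3: "a \<in> D3" "b \<in> D3" "z \<in> D3" "y \<in> D3" using abD2 D3_def by auto
  have io3: "link_verts l2 \<inter> D3 = {}" "link_verts l3 \<inter> D3 = {}" using io dj unfolding D3_def by auto
  have injabz: "inj_on \<phi>3 {a, b, z}" using c3 kz ab by auto
  obtain \<phi>4 where \<phi>4: "good (D3 \<union> link_verts l2) \<phi>4" "\<And>v. v \<in> D3 \<Longrightarrow> \<phi>4 v = \<phi>3 v"
  proof (rule link_solve[OF l2 \<phi>3(1)[folded D3_def]])
    show "z \<in> D3" "y \<in> D3" "D3 \<inter> link_verts l2 = {}" using abD3 io3 by auto
    show "\<phi>3 z \<noteq> \<phi>3 y" using c3 ky by auto
  next
    fix xs assume "N y \<subseteq> D3 \<union> link_verts l2"
    then have "left_nbrs l3 b \<inter> link_verts l3 = {}" using Ny io3 dj by blast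
    then have b: "left_nbrs l3 b = {b}" using left_nbrs_closed(2)[OF l3] nl by blast
    have "N y \<inter> D3 \<subseteq> {a, b, z}" using Ny b R2 io3 by blast
    moreover have "b \<in> N y \<inter> D3" "a \<in> N y \<inter> D3" using b Ny abD3 by auto
    ultimately show "safe \<phi>3 (N y \<inter> D3)" using two inj_sub[OF injabz] ne by blast
  next
    fix x p q assume P: "l2 = Pent x p q" and "N y \<subseteq> D3 \<union> link_verts l2"
    then have "left_nbrs l3 b \<inter> link_verts l3 = {}" using Ny io3 dj by blast
    then have b: "l3 = Edge" using left_nbrs_closed(1)[OF l3] nl by blast
    have "right_nbrs l2 z \<inter> D3 = {}" using P io3 by auto
    then have sub: "N y \<inter> D3 \<subseteq> {a, b}" using Ny b by auto
    moreover have "N y \<inter> D3 \<noteq> {}" using Ny abD3 by blast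
    moreover have "e2 \<noteq> \<phi>3 y \<and> e2 \<noteq> \<phi>3 z \<and> e2 \<notin> \<phi>3 ` {a, b}" "e2 \<in> L x"
      using e2[OF P] c3 ky(6) P b by (auto simp: Y_def)
    ultimately show "inj_on \<phi>3 (N y \<inter> D3) \<and> N y \<inter> D3 \<noteq> {} \<and>
      (\<exists>e\<in>L x. e \<noteq> \<phi>3 z \<and> e \<noteq> \<phi>3 y \<and> e \<notin> \<phi>3 ` (N y \<inter> D3))"
      using inj_sub[OF injabz] by blast
  qed blast
  define D4 where "D4 = D3 \<union> link_verts l2"
  have abD4: "y \<in> D4" "b \<in> D4" using abD3 D4_def by auto
  have io4: "link_verts l3 \<inter> D4 = {}" using io3 dj unfolding D4_def by auto
  have old: "\<phi>4 v = \<phi> v" if "v \<in> ?D0" for v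
    using \<phi>4(2)[of v] \<phi>3(2)[of v] \<phi>2(3)[OF that] that by (auto simp: D3_def D2)
  have c4': "\<phi>4 b = \<phi> b" "\<phi>4 y = ky" "\<phi>4 z = kz" using c3 \<phi>4(2) abD3 by auto
  have NbD: "N b \<inter> D4 = insert z B \<union> (right_nbrs l3 y \<inter> {y})"
    using NbB BD R3 io4 abD2 by (auto simp: D4_def D3_def D2)
  have imB: "\<phi>4 ` B = \<phi> ` B" using old BD by (metis image_cong subsetD)
  have zB: "z \<notin> B" "y \<notin> B" using S B_def by auto
  have injB: "inj_on \<phi>4 B" using inj old BD by (metis inj_on_cong subsetD)
  have injzB: "inj_on \<phi>4 (insert z B)" using injB imB kz(4) zB c4' by (simp add: inj_on_insert)
  obtain \<phi>5 where "good (D4 \<union> link_verts l3) \<phi>5"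
  proof (rule link_solve[OF l3 \<phi>4(1)[folded D4_def]])
    show "y \<in> D4" "b \<in> D4" "D4 \<inter> link_verts l3 = {}" using abD4 io4 by auto
    show "\<phi>4 y \<noteq> \<phi>4 b" using c4' ky by auto
  next
    fix xs assume "l3 = Path xs \<or> l3 = Ear xs"
    then show "safe \<phi>4 (N b \<inter> D4)"
    proof
      assume P: "l3 = Path xs"
      then have "right_nbrs l3 y \<inter> {y} = {}" using n3 l3 by (auto simp: chain_def hd_rev)
      then have "N b \<inter> D4 = insert z B" using NbD by simp
      \<comment> \<open>For a path, \<open>z\<close> alone would not make \<open>N b\<close> safe.
        The case without other neighbours of \<open>b\<close> is left to
        \<open>no_crossing\<close>.\<close>
      moreover have "B \<noteq> {}" using Bne[OF P] B_def by simp
      ultimately show ?thesis using injzB zB by (simp add: safe_insertI)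
    next
      assume P: "l3 = Ear xs"
      then have eq: "N b \<inter> D4 = insert y (insert z B)" using NbD by auto
      have "ky \<notin> \<phi>4 ` insert z B" using ky(4,6) P c4' imB by (auto simp: Y_def)
      then have "inj_on \<phi>4 (insert y (insert z B))" using injzB c4' zB ne by (subst inj_on_insert) auto
      then show ?thesis unfolding eq using zB ne by (intro safe_insertI) auto
    qed
  next
    fix x p q assume P: "l3 = Pent x p q"
    then have "right_nbrs l3 y \<inter> {y} = {}" using n3 by auto
    then have eq: "N b \<inter> D4 = insert z B" using NbD by simp
    have "e3 \<in> L x \<and> e3 \<noteq> \<phi>4 y \<and> e3 \<noteq> \<phi>4 b \<and> e3 \<notin> \<phi>4 ` insert z B"
      using e3[OF P] c4' imB ky(6) P by (auto simp: Y_def)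
    then show "inj_on \<phi>4 (N b \<inter> D4) \<and> N b \<inter> D4 \<noteq> {} \<and>
      (\<exists>e\<in>L x. e \<noteq> \<phi>4 y \<and> e \<noteq> \<phi>4 b \<and> e \<notin> \<phi>4 ` (N b \<inter> D4))"
      unfolding eq using injzB by blast
  qed blast
  moreover have "D4 \<union> link_verts l3 = V" using SV S by (auto simp: D4_def D3_def D2)
  ultimately show False using not_good by metis
qed

end

section \<open>Closed intervals\<close>

text \<open>For links of width one this lists the inner vertices in order; an edge counts as a path
  without inner vertices.\<close>

fun link_list :: "'v link \<Rightarrow> 'v list" where
  "link_list (Path xs) = xs"
| "link_list _ = []"

section \<open>Gluing links at a vertex or at a crossing\<close>

context min_counterexample
begin

lemma link_list_props:
  assumes "link l s t" "width l = 1"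
  shows "path_nbrs N s (link_list l) t" "set (link_list l) = link_verts l" "distinct (link_list l)"
    "left_nbrs l t = {hd (link_list l @ [t])}" "right_nbrs l s = {last (s # link_list l)}"
  using assms by (cases l; auto simp: chain_def hd_rev)+

text \<open>Either the ends are adjacent or there is a chain with two vertices, so
  \<open>no_chain_at_3\<close> applies.\<close>

lemma wide_end:
  assumes "link l s t" "width l = 2" "card (N s) = 3"
  shows False
proof (cases l)
  case (Ear xs)
  then show False using no_chain_at_3[of s xs t] assms by auto
next
  case (Pent x y z)
  then show False using no_chain_at_3[of s "[y, z]" t] assms by auto
qed (use assms in auto)

lemma width_cases: "width l = 0 \<or> width l = 1 \<or> width l = 2"
  by (cases l) auto

text \<open>The widths add up to the degree of \<open>u\<close>. Widths 0 and 2 close a loop, 1 and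
  2 give a wide link at a vertex of degree three, and 2 and 2 a double split. Only two paths remain,
  which \<open>u\<close> joins to a longer one; it becomes an ear if \<open>a\<close> and
  \<open>b\<close> are adjacent.\<close>

lemma split_link:
  assumes l1: "link l1 a u" and l2: "link l2 u b"
    and ne: "a \<noteq> u" "u \<noteq> b" "a \<noteq> b" and d: "link_verts l1 \<inter> link_verts l2 = {}" "a \<notin> link_verts l2" "b \<notin> link_verts l1"
    and Nu: "N u = right_nbrs l1 a \<union> left_nbrs l2 b" and uV: "u \<in> V"
  shows "\<exists>l. link l a b \<and> link_verts l = insert u (link_verts l1 \<union> link_verts l2)"
proof -
  note n1 = inner_not_ends[OF l1] and n2 = inner_not_ends[OF l2]
  have "right_nbrs l1 a \<inter> left_nbrs l2 b = {}"
    using left_nbrs_subset[OF link_rev[OF l1]] left_nbrs_subset[OF l2] d ne by auto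
  then have c: "card (N u) = width l1 + width l2"
    using Nu card_left_nbrs[OF l2] card_left_nbrs[OF link_rev[OF l1]] by (simp add: card_Un_disjoint)
  then have "2 \<le> width l1 + width l2" using degree_ge_2[OF uV] by simp
  then consider "width l1 = 0" "width l2 = 2" | "width l1 = 2" "width l2 = 0" | "width l1 = 1" "width l2 = 1"
    | "width l1 = 1" "width l2 = 2" | "width l1 = 2" "width l2 = 1" | "width l1 = 2" "width l2 = 2"
    using width_cases[of l1] width_cases[of l2] by linarith
  then show ?thesis
  proof cases
    case 1
    then have "N u = left_nbrs l2 b" using Nu by (cases l1) auto
    then show ?thesis using end_loop[OF l2] 1 ne by blast
  next
    case 2
    then have "N u = left_nbrs (rev_link l1) a" using Nu by (cases l2) auto
    then show ?thesis using end_loop[OF link_rev[OF l1]] 2 ne by simp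
  next
    case 3
    note p1 = link_list_props[OF l1 3(1)] and p2 = link_list_props[OF l2 3(2)]
    let ?xs = "link_list l1 @ u # link_list l2"
    have "path_nbrs N a ?xs b" unfolding path_nbrs_append using p1 p2 Nu by auto
    moreover have "distinct (a # ?xs @ [b])" using p1(2,3) p2(2,3) n1 n2 d ne by auto
    ultimately have ch: "chain N a ?xs b" by (auto simp: chain_def)
    have i: "set ?xs = insert u (link_verts l1 \<union> link_verts l2)" using p1(2) p2(2) by auto
    show ?thesis
    proof (cases "b \<in> N a")
      case True
      then show ?thesis using ch i by (intro exI[of _ "Ear ?xs"]) auto
    next
      case False
      then show ?thesis using ch i by (intro exI[of _ "Path ?xs"]) auto
    qed
  next
    case 4
    then show ?thesis using wide_end[OF l2] c by simp
  next
    case 5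
    then show ?thesis using wide_end[OF link_rev[OF l1]] c by simp
  next
    case 6
    then show ?thesis using no_double_split[OF l1 l2 _ _ ne(1,2) d ne(3) Nu] by blast
  qed
qed

text \<open>The four vertices are thought of in the order \<open>a\<close>, \<open>z\<close>,
  \<open>y\<close>, \<open>b\<close>, with one link in each gap, so that the edges from
  \<open>a\<close> to \<open>y\<close> and from \<open>z\<close> to \<open>b\<close> cross. Only
  \<open>a\<close> and \<open>b\<close> may have neighbours outside the configuration.\<close>

definition crossing :: "'v \<Rightarrow> 'v \<Rightarrow> 'v \<Rightarrow> 'v \<Rightarrow> 'v link \<Rightarrow> 'v link \<Rightarrow> 'v link \<Rightarrow> bool" where
  "crossing a z y b l1 l2 l3 \<longleftrightarrow> link l1 a z \<and> link l2 z y \<and> link l3 y b \<and> y \<in> N a \<and> b \<in> N z \<and>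
    distinct [a, z, y, b] \<and> link_verts l1 \<inter> link_verts l2 = {} \<and> link_verts l1 \<inter> link_verts l3 = {} \<and> link_verts l2 \<inter> link_verts l3 = {} \<and>
    a \<notin> link_verts l2 \<and> a \<notin> link_verts l3 \<and> b \<notin> link_verts l1 \<and> b \<notin> link_verts l2 \<and> y \<notin> link_verts l1 \<and> z \<notin> link_verts l3 \<and>
    N z = insert b (right_nbrs l1 a \<union> left_nbrs l2 y) \<and> N y = insert a (right_nbrs l2 z \<union> left_nbrs l3 b)"

lemma crossing_rev: "crossing a z y b l1 l2 l3 \<Longrightarrow> crossing b y z a (rev_link l3) (rev_link l2) (rev_link l1)"
  unfolding crossing_def using N_commute link_rev by auto

text \<open>Applied from both sides, \<open>no_crossing_aux\<close> leaves the case that both outer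
  links are paths and that \<open>a\<close> and \<open>b\<close> have degree two. Then
  \<open>y\<close> and \<open>z\<close> are joined by two disjoint chains through \<open>b\<close>
  and \<open>a\<close>. Both have at least two vertices, so \<open>no_parallel\<close>
  applies.\<close>

lemma no_crossing:
  assumes cr: "crossing a z y b l1 l2 l3" and nl: "l1 \<noteq> NoLink" "l2 \<noteq> NoLink" "l3 \<noteq> NoLink"
  shows False
proof -
  note C = cr[unfolded crossing_def] and R = crossing_rev[OF cr, unfolded crossing_def]
  define S where "S = {z, y} \<union> link_verts l1 \<union> link_verts l2 \<union> link_verts l3"
  have S': "S = {y, z} \<union> link_verts (rev_link l3) \<union> link_verts (rev_link l2) \<union> link_verts (rev_link l1)" unfolding S_def by auto
  have 1: "\<exists>xs. l3 = Path xs \<and> N b - S = {}"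
    using no_crossing_aux[of l1 a z l2 y l3 b, OF _ _ _ nl _ _ _ _ _ _ _ _ _ _ _ _ _ _ S_def] C by blast
  have 2: "\<exists>xs. rev_link l1 = Path xs \<and> N a - S = {}"
    using no_crossing_aux[of "rev_link l3" b y "rev_link l2" z "rev_link l1" a, OF _ _ _ _ _ _ _ _ _ _ _ _ _ _ _ _ _ _ _ _ S'] R nl
    by (metis rev_link_eq(1))
  obtain xs3 where l3: "l3 = Path xs3" and Nb: "N b - S = {}" using 1 by blast
  obtain xs1 where l1: "l1 = Path xs1" and Na: "N a - S = {}" using 2 by (metis rev_link.simps(3) rev_link_rev)
  have ch1: "chain N a xs1 z" and ch3: "chain N y xs3 b" using C l1 l3 by auto
  have ne: "xs1 \<noteq> []" "xs3 \<noteq> []" using ch1 ch3 by (auto simp: chain_def)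
  have "N a \<inter> S = insert y (N a \<inter> (link_verts l1 \<union> {z}))"
    using link_far_nbrs[of l2 z y a] link_far_nbrs[of l3 y b a] C unfolding S_def by auto
  moreover have "N a \<inter> (link_verts l1 \<union> {z}) = {hd xs1}"
  proof -
    have "link l1 a z" using C by blast
    from link_nbrs_left[OF this] show ?thesis by (simp add: l1)
  qed
  moreover have "N a = N a \<inter> S" using Na by blast
  ultimately have Na': "N a = {y, hd xs1}" by simp
  have "N b \<inter> S = insert z (N b \<inter> (link_verts l3 \<union> {y}))"
    using link_far_nbrs[of l2 z y b] link_far_nbrs[of l1 a z b] C N_commute[of z b] unfolding S_def by auto
  moreover have "N b \<inter> (link_verts l3 \<union> {y}) = {last xs3}"
  proof -
    have "link l3 y b" using C by blast
    from link_nbrs_right[OF this] show ?thesis by (simp add: l3 hd_rev)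
  qed
  moreover have "N b = N b \<inter> S" using Nb by blast
  ultimately have Nb': "N b = {z, last xs3}" by simp
  have d: "set xs1 \<inter> set xs3 = {}" "y \<notin> set xs1" "b \<notin> set xs1" "a \<notin> set xs3" "z \<notin> set xs3"
    "distinct [a, z, y, b]"
    using C l1 l3 by auto
  have "path_nbrs N y (xs3 @ b # []) z"
    unfolding path_nbrs_append using ch3 Nb' ne by (auto simp: chain_def)
  then have c1: "chain N y (xs3 @ [b]) z" using ch3 d by (auto simp: chain_def)
  have c2: "chain N y (a # xs1) z" using ch1 d Na' ne by (auto simp: chain_def)
  have "1 \<notin> {length (xs3 @ [b]), length (a # xs1)}" using ne by auto
  then have "{length (xs3 @ [b]), length (a # xs1)} \<noteq> {1, 2}" by blast
  then show False using no_parallel[OF c1 c2] d by auto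
qed

text \<open>The degrees of \<open>z\<close> and \<open>y\<close> force both outer links to have
  width one. They yield two disjoint chains from \<open>a\<close> to \<open>b\<close>, one through
  each of \<open>z\<close> and \<open>y\<close>, and \<open>no_parallel\<close> leaves only lengths
  1 and 2 with non-adjacent ends. This is where \<open>Pent\<close> originates.\<close>

lemma crossing_mid:
  assumes cr: "crossing a z y b l1 NoLink l3"
  shows "\<exists>l. link l a b \<and> link_verts l = {z, y} \<union> link_verts l1 \<union> link_verts l3"
proof -
  note C = cr[unfolded crossing_def]
  have l1: "link l1 a z" and l3: "link l3 y b" and ne: "distinct [a, z, y, b]" using C by auto
  note n1 = inner_not_ends[OF l1] and n3 = inner_not_ends[OF l3]
  have Nz: "N z = insert b (right_nbrs l1 a)" and Ny: "N y = insert a (left_nbrs l3 b)" using C by auto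
  have zy: "z \<in> V" "y \<in> V" using Nz Ny N_outside by blast+
  have "b \<notin> right_nbrs l1 a" "a \<notin> left_nbrs l3 b" using left_nbrs_subset[OF link_rev[OF l1]] left_nbrs_subset[OF l3] C by auto
  then have c: "card (N z) = Suc (width l1)" "card (N y) = Suc (width l3)"
    using Nz Ny card_left_nbrs[OF l3] card_left_nbrs[OF link_rev[OF l1]] by simp_all
  then have w: "width l1 = 1" "width l3 = 1"
    using degree_ge_2[OF zy(1)] degree_ge_2[OF zy(2)] width_cases[of l1] width_cases[of l3]
      wide_end[OF l3] wide_end[OF link_rev[OF l1]] by auto
  note p1 = link_list_props[OF l1 w(1)] and p3 = link_list_props[OF l3 w(2)]
  have "path_nbrs N a (link_list l1 @ z # []) b" unfolding path_nbrs_append using p1 Nz by auto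
  then have c1: "chain N a (link_list l1 @ [z]) b" using p1 n1 ne C by (auto simp: chain_def)
  have c2: "chain N a (y # link_list l3) b" using p3 n3 ne C Ny by (auto simp: chain_def)
  have dj: "set (link_list l1 @ [z]) \<inter> set (y # link_list l3) = {}" using p1 p3 ne C by auto
  have nadj: "b \<notin> N a" and len: "{length (link_list l1 @ [z]), length (y # link_list l3)} = {1, 2}"
    using no_parallel[OF c1 c2 dj] by blast+
  then have "(link_list l1 = [] \<and> (\<exists>q. link_list l3 = [q])) \<or> ((\<exists>p. link_list l1 = [p]) \<and> link_list l3 = [])"
    by (cases "link_list l1"; cases "link_list l3") (auto simp: doubleton_eq_iff)
  then show ?thesis
  proof (elim disjE conjE exE)
    fix q assume e: "link_list l1 = []" "link_list l3 = [q]"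
    then show ?thesis using c1 c2 dj nadj p1(2) p3(2) by (intro exI[of _ "Pent z y q"]) auto
  next
    fix p assume e: "link_list l1 = [p]" "link_list l3 = []"
    then show ?thesis using c1 c2 dj nadj p1(2) p3(2) by (intro exI[of _ "Pent y p z"]) auto
  qed
qed

text \<open>\<open>z\<close> has degree two, since a wide \<open>l2\<close> would give degree three.
  So there is a chain from \<open>y\<close> through \<open>l2\<close> and \<open>z\<close> to
  \<open>b\<close>. If \<open>l3\<close> is missing, \<open>y\<close> prolongs it to
  \<open>a\<close>. A width of one makes \<open>y\<close> a vertex of degree three at a chain. A
  wider \<open>l3\<close> is parallel to the chain, and a pentagon contains chains of both lengths 1
  and 2, one of which violates \<open>no_parallel\<close>.\<close>

lemma crossing_left:
  assumes cr: "crossing a z y b NoLink l2 l3" and nl: "l2 \<noteq> NoLink"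
  shows "\<exists>l. link l a b \<and> link_verts l = {z, y} \<union> link_verts l2 \<union> link_verts l3"
proof -
  note C = cr[unfolded crossing_def]
  have l2: "link l2 z y" and l3: "link l3 y b" and ne: "distinct [a, z, y, b]" using C by auto
  note n2 = inner_not_ends[OF l2] and n3 = inner_not_ends[OF l3]
  have Nz: "N z = insert b (left_nbrs l2 y)" and Ny: "N y = insert a (right_nbrs l2 z \<union> left_nbrs l3 b)" using C by auto
  have "b \<notin> left_nbrs l2 y" using left_nbrs_subset[OF l2] C by auto
  then have "card (N z) = Suc (width l2)" using Nz card_left_nbrs[OF l2] by simp
  then have w: "width l2 = 1"
    using width_cases[of l2] wide_end[OF l2] nl by (cases l2) auto
  note p2 = link_list_props[OF l2 w]
  have cy: "card (N y) = 2 + width l3"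
  proof -
    have "right_nbrs l2 z \<inter> left_nbrs l3 b = {}" "a \<notin> right_nbrs l2 z \<union> left_nbrs l3 b"
      using left_nbrs_subset[OF link_rev[OF l2]] left_nbrs_subset[OF l3] C by auto
    then show ?thesis using Ny card_left_nbrs[OF l3] card_left_nbrs[OF link_rev[OF l2]] w by (simp add: card_Un_disjoint)
  qed
  define Z where "Z = rev (link_list l2) @ [z]"
  have "path_nbrs N y (rev (link_list l2) @ z # []) b"
    unfolding path_nbrs_append using path_nbrs_rev[OF p2(1)] Nz p2(4) by (cases "link_list l2") (auto simp: insert_commute)
  then have cZ: "chain N y Z b" using p2 n2 ne C by (auto simp: chain_def Z_def)
  have hZ: "right_nbrs l2 z = {hd Z}" using p2(5) by (cases "link_list l2" rule: rev_cases) (auto simp: Z_def)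
  have sZ: "set Z = insert z (link_verts l2)" using p2(2) by (auto simp: Z_def)
  have dj: "set Z \<inter> link_verts l3 = {}" using sZ C by auto
  consider "width l3 = 0" | "width l3 = 1" | "width l3 = 2" using width_cases[of l3] by metis
  then show ?thesis
  proof cases
    case 1
    then have l3N: "l3 = NoLink" by (cases l3) auto
    have Zne: "Z \<noteq> []" by (simp add: Z_def)
    have ch: "chain N a (y # Z) b"
      using cZ Ny hZ l3N Zne ne sZ C by (auto simp: chain_def)
    show ?thesis
    proof (cases "b \<in> N a")
      case True
      then show ?thesis using ch sZ l3N by (intro exI[of _ "Ear (y # Z)"]) auto
    next
      case False
      then show ?thesis using ch sZ l3N by (intro exI[of _ "Path (y # Z)"]) auto
    qed
  next
    case 2
    then have c3: "card (N y) = 3" using cy by simp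
    have False
    proof (cases l3)
      case Edge
      then show False using no_chain_at_3[OF cZ _ c3] l3 by auto
    next
      case (Path xs)
      then have cx: "chain N y xs b" "set Z \<inter> set xs = {}" using l3 dj by auto
      have "\<not> 2 \<le> length Z" "\<not> 2 \<le> length xs"
        using no_chain_at_3[OF cZ _ c3] no_chain_at_3[OF cx(1) _ c3] by blast+
      then have "2 \<notin> {length Z, length xs}" by auto
      then have "{length Z, length xs} \<noteq> {1, 2}" by blast
      then show False using no_parallel[OF cZ cx] by blast
    qed (use 2 in auto)
    then show ?thesis ..
  next
    case 3
    have False
    proof (cases l3)
      case (Ear xs)
      then show False using no_parallel[OF cZ, of xs] l3 dj by auto
    next
      case (Pent x p q)
      then have cx: "chain N y [x] b" "set Z \<inter> set [x] = {}" "chain N y [p, q] b" "set Z \<inter> set [p, q] = {}"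
        using l3 dj by auto
      have "2 \<in> {length Z, length [x]}" "1 \<in> {length Z, length [p, q]}"
        using no_parallel[OF cZ cx(1,2)] no_parallel[OF cZ cx(3,4)] by blast+
      then show False by auto
    qed (use 3 in auto)
    then show ?thesis ..
  qed
qed

lemma crossing_link:
  assumes cr: "crossing a z y b l1 l2 l3"
  shows "\<exists>l. link l a b \<and> link_verts l = {z, y} \<union> link_verts l1 \<union> link_verts l2 \<union> link_verts l3"
proof -
  consider "l2 = NoLink" | "l2 \<noteq> NoLink" "l1 = NoLink" | "l2 \<noteq> NoLink" "l3 = NoLink"
    | "l1 \<noteq> NoLink" "l2 \<noteq> NoLink" "l3 \<noteq> NoLink" by blast
  then show ?thesis
  proof cases
    case 1 then show ?thesis using crossing_mid cr by simp
  next
    case 2 then show ?thesis using crossing_left cr by simp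
  next
    case 3
    then have "crossing b y z a NoLink (rev_link l2) (rev_link l1)" using crossing_rev[OF cr] by simp
    then obtain l where "link l b a" "link_verts l = {y, z} \<union> link_verts l2 \<union> link_verts l1"
      using crossing_left[of b y z a "rev_link l2" "rev_link l1"] 3 by auto
    then show ?thesis using link_rev 3 by (intro exI[of _ "rev_link l"]) auto
  next
    case 4 then show ?thesis using no_crossing[OF cr] by blast
  qed
qed

end

text \<open>The crossing edges are given with their end between \<open>x\<close> and
  \<open>y\<close> first, so that equality of edges becomes equality of both components.\<close>

locale ordered_counterexample = min_counterexample V N L
  for V :: "'v :: linorder set" and N :: "'v \<Rightarrow> 'v set" and L :: "'v \<Rightarrow> 'c set" +
  assumes one_crossing: "y \<in> N x \<Longrightarrow> x < z \<Longrightarrow> z < y \<Longrightarrow> w \<in> N z \<Longrightarrow> w < x \<or> y < w \<Longrightarrow>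
    x < z' \<Longrightarrow> z' < y \<Longrightarrow> w' \<in> N z' \<Longrightarrow> w' < x \<or> y < w' \<Longrightarrow> z' = z \<and> w' = w"
begin

definition closed :: "'v \<Rightarrow> 'v \<Rightarrow> bool" where
  "closed s t \<longleftrightarrow> s \<in> V \<and> t \<in> V \<and> s < t \<and> (\<forall>u\<in>V. s < u \<longrightarrow> u < t \<longrightarrow> N u \<subseteq> {s..t})"

definition between :: "'v \<Rightarrow> 'v \<Rightarrow> 'v set" where
  "between s t = {u \<in> V. s < u \<and> u < t}"

lemma closedD: "closed s t \<Longrightarrow> s < u \<Longrightarrow> u < t \<Longrightarrow> v \<in> N u \<Longrightarrow> s \<le> v \<and> v \<le> t"
  unfolding closed_def using in_V_if_nbr by fastforce

lemma closedI:
  assumes "s \<in> V" "t \<in> V" "s < t" "\<And>u v. s < u \<Longrightarrow> u < t \<Longrightarrow> v \<in> N u \<Longrightarrow> v < s \<or> t < v \<Longrightarrow> False"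
  shows "closed s t"
  unfolding closed_def
proof (intro conjI ballI impI subsetI)
  fix u v assume "s < u" "u < t" "v \<in> N u"
  then have "\<not> (v < s \<or> t < v)" using assms(4) by blast
  then show "v \<in> {s..t}" by (simp add: not_less)
qed (use assms in auto)

lemma N_below:
  assumes "link l s u" "link_verts l = between s u" "s \<in> V" "s < u"
  shows "N u \<inter> {s..u} = right_nbrs l s"
proof -
  have "N u \<inter> {s..u} = N u \<inter> (link_verts l \<union> {s})"
    unfolding assms(2) between_def using in_V_if_nbr(1)[of _ u] N_irrefl[of u] assms(3,4) by (auto simp: le_less)
  then show ?thesis using link_nbrs_right[OF assms(1)] by simp
qed

lemma N_above:
  assumes "link l u t" "link_verts l = between u t" "t \<in> V" "u < t"
  shows "N u \<inter> {u..t} = left_nbrs l t"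
proof -
  have "N u \<inter> {u..t} = N u \<inter> (link_verts l \<union> {t})"
    unfolding assms(2) between_def using in_V_if_nbr(1)[of _ u] N_irrefl[of u] assms(3,4) by (auto simp: le_less)
  then show ?thesis using link_nbrs_left[OF assms(1)] by simp
qed

text \<open>Without inner neighbours of \<open>s\<close>, the first inner vertex splits the
  interval. Otherwise let \<open>y\<close> be the last inner neighbour of \<open>s\<close>. If no
  edge passes over \<open>y\<close> from inside \<open>{s<..<y}\<close>, it is a split vertex. If an
  edge from \<open>p\<close> to \<open>q\<close> does, it is the only edge crossing that from
  \<open>s\<close> to \<open>y\<close>, and either \<open>q = t\<close>, which is the crossing, or
  \<open>q\<close> is a split vertex.\<close>

lemma closed_crossing_or_split:
  assumes cl: "closed s t" and ne: "between s t \<noteq> {}"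
  obtains (crossing) z y where "s < z" "z < y" "y < t" "y \<in> N s" "t \<in> N z"
  | (split) u where "u \<in> between s t" "closed s u" "closed u t"
proof -
  have st: "s \<in> V" "t \<in> V" "s < t" using cl unfolding closed_def by auto
  have fin: "finite (between s t)" unfolding between_def using finite_V by simp
  show ?thesis
  proof (cases "N s \<inter> between s t = {}")
    case True
    define u where "u = Min (between s t)"
    have u: "u \<in> between s t" using Min_in[OF fin ne] u_def by simp
    have least: "u \<le> v" if "v \<in> between s t" for v using Min_le[OF fin that] u_def by simp
    have u': "u \<in> V" "s < u" "u < t" using u by (auto simp: between_def)
    have "closed s u"
    proof (rule closedI[OF st(1) u'(1,2)])
      fix w v assume "s < w" "w < u" "v \<in> N w"
      moreover from this have "w \<in> between s t" using in_V_if_nbr u' by (auto simp: between_def)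
      ultimately show False using least[of w] by auto
    qed
    moreover have "closed u t"
    proof (rule closedI[OF u'(1) st(2) u'(3)])
      fix w v assume w: "u < w" "w < t" "v \<in> N w" "v < u \<or> t < v"
      have "s < w" using w u' by simp
      then have v: "s \<le> v" "v < u" using closedD[OF cl _ w(2,3)] w(4) by auto
      have "v = s"
      proof (rule ccontr)
        assume "v \<noteq> s"
        then have "v \<in> between s t" using v u' w in_V_if_nbr by (auto simp: between_def)
        then show False using least v by fastforce
      qed
      then have "w \<in> N s \<inter> between s t" using w \<open>s < w\<close> N_commute in_V_if_nbr by (auto simp: between_def)
      then show False using True by blast
    qed
    ultimately show ?thesis using split u by blast
  next
    case False
    define y where "y = Max (N s \<inter> between s t)"
    have y: "y \<in> N s \<inter> between s t" using Max_in[of "N s \<inter> between s t"] False y_def by simp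
    have greatest: "v \<le> y" if "v \<in> N s" "s < v" "v < t" for v
      using Max_ge[of "N s \<inter> between s t" v] that in_V_if_nbr y_def by (auto simp: between_def)
    have y': "y \<in> V" "s < y" "y < t" "y \<in> N s" "s \<in> N y" using y N_commute by (auto simp: between_def)
    show ?thesis
    proof (cases "\<exists>p q. s < p \<and> p < y \<and> q \<in> N p \<and> y < q")
      case True
      then obtain p q where pq: "s < p" "p < y" "q \<in> N p" "y < q" by blast
      have qt: "q \<le> t" using closedD[OF cl pq(1) _ pq(3)] pq(2) y' by auto
      show ?thesis
      proof (cases "q = t")
        case True
        then show ?thesis using crossing[of p y] pq y' by auto
      next
        case False
        then have q: "q < t" "s < q" "q \<in> V" using qt pq y' in_V_if_nbr by auto
        \<comment> \<open>An edge leaving to the right of \<open>q\<close> would cross the edge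
          \<open>s\<close>, \<open>y\<close> as a second one if it starts before \<open>y\<close>,
          and the edge \<open>p\<close>, \<open>q\<close> as a second one otherwise.\<close>
        have csq: "closed s q"
        proof (rule closedI[OF st(1) q(3,2)])
          fix w v assume w: "s < w" "w < q" "v \<in> N w" "v < s \<or> q < v"
          have v: "q < v" using closedD[OF cl w(1) less_trans[OF w(2) q(1)] w(3)] w(4) by auto
          have yv: "y < v" "s < v" using pq v y' by order+
          consider "w < y" | "w = y" | "y < w" by fastforce
          then show False
          proof cases
            case 1
            then show False using one_crossing[of y s p q w v] pq y' w v yv by auto
          next
            case 2
            then show False using one_crossing[of q p y s y v] pq y' w v yv by auto
          next
            case 3
            then have "p < w" using pq by order
            then show False using one_crossing[of q p y s w v] pq y' w v yv 3 by auto
          qed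
        qed
        moreover have "closed q t"
        proof (rule closedI[OF q(3) st(2) q(1)])
          fix w v assume w: "q < w" "w < t" "v \<in> N w" "v < q \<or> t < v"
          have "s < w" using w q by simp
          then have v: "s \<le> v" "v < q" using closedD[OF cl _ w(2,3)] w(4) by auto
          show False
          proof (cases "v = s")
            case True
            then have "w \<le> y" using greatest[of w] w \<open>s < w\<close> N_commute by blast
            then show False using w pq by simp
          next
            case False
            then have "s < v" using v by simp
          then have "w \<le> q" using closedD[OF csq _ v(2), of w] w(3) N_commute by blast
          then show False using w by simp
          qed
        qed
        ultimately show ?thesis using split[of q] q by (auto simp: between_def)
      qed
    next
      case False
      have "closed s y"
      proof (rule closedI[OF st(1) y'(1,2)])
        fix w v assume w: "s < w" "w < y" "v \<in> N w" "v < s \<or> y < v"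
        then have "y < v" using closedD[OF cl w(1) less_trans[OF w(2) y'(3)] w(3)] by auto
        then show False using False w by blast
      qed
      moreover have "closed y t"
      proof (rule closedI[OF y'(1) st(2) y'(3)])
        fix w v assume w: "y < w" "w < t" "v \<in> N w" "v < y \<or> t < v"
        have "s < w" using w y' by simp
        then have v: "s \<le> v" "v < y" using closedD[OF cl _ w(2,3)] w(4) by auto
        show False
        proof (cases "v = s")
          case True
          then have "w \<le> y" using greatest[of w] w \<open>s < w\<close> N_commute by blast
          then show False using w by simp
        next
          case False
          then have "s < v" using v by simp
          then show False
            using \<open>\<nexists>p q. s < p \<and> p < y \<and> q \<in> N p \<and> y < q\<close> v(2) w(1,3) N_commute by blast
        qed
      qed
      ultimately show ?thesis using split[of y] y by blast
    qed
  qed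
qed

text \<open>The intervals cut out by a split vertex or by a crossing have fewer inner vertices and
  are closed. Their links are glued by \<open>split_link\<close> or
  \<open>crossing_link\<close>.\<close>

lemma closed_link:
  assumes "closed s t"
  shows "\<exists>l. link l s t \<and> link_verts l = between s t"
  using assms
proof (induction "card (between s t)" arbitrary: s t rule: less_induct)
  case less
  note cl = less.prems
  have st: "s \<in> V" "t \<in> V" "s < t" using cl unfolding closed_def by auto
  have fin: "finite (between s t)" for s t unfolding between_def using finite_V by simp
  have IH: "\<exists>l. link l p q \<and> link_verts l = between p q"
    if "closed p q" "s \<le> p" "q \<le> t" "p \<noteq> s \<or> q \<noteq> t" for p q
  proof (rule less.hyps[OF _ that(1)])
    have pq: "p \<in> V" "q \<in> V" "p < q" using that unfolding closed_def by auto
    have "between p q \<subseteq> between s t" using that by (auto simp: between_def)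
    moreover have "p \<in> between s t \<or> q \<in> between s t" using that pq by (auto simp: between_def)
    moreover have "p \<notin> between p q" "q \<notin> between p q" by (auto simp: between_def)
    ultimately have "between p q \<subset> between s t" by blast
    then show "card (between p q) < card (between s t)" using psubset_card_mono[OF fin] by blast
  qed
  show ?case
  proof (cases "between s t = {}")
    case True
    then show ?thesis by (cases "t \<in> N s") (auto intro: exI[of _ Edge] exI[of _ NoLink])
  next
    case False
    from cl False show ?thesis
    proof (cases rule: closed_crossing_or_split)
      case (crossing z y)
      then have V: "z \<in> V" "y \<in> V" "z \<in> N t" "s \<in> N y" using in_V_if_nbr N_commute by blast+
      \<comment> \<open>The edges \<open>s\<close>, \<open>y\<close> and \<open>z\<close>,
        \<open>t\<close> cross each other, so neither is crossed by a third edge. This closes the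
        three gaps between their ends.\<close>
      have oz: "v = t" if "v \<in> N z" "v < s \<or> y < v" for v
        using one_crossing[of y s z t z v] crossing that by auto
      have oy: "v = s" if "v \<in> N y" "v < z \<or> t < v" for v
        using one_crossing[of t z y s y v] crossing V that by auto
      have o1: "w = z \<and> v = t" if "s < w" "w < y" "v \<in> N w" "v < s \<or> y < v" for v w
        using one_crossing[of y s z t w v] crossing that by auto
      have o2: "w = y \<and> v = s" if "z < w" "w < t" "v \<in> N w" "v < z \<or> t < v" for v w
        using one_crossing[of t z y s w v] crossing V that by auto
      have c1: "closed s z"
      proof (rule closedI[OF st(1) V(1) crossing(1)])
        fix u v assume u: "s < u" "u < z" "v \<in> N u" "v < s \<or> z < v"
        have "u < t" using u crossing by order
        then have "s \<le> v" "v \<le> t" using closedD[OF cl u(1) _ u(3)] by auto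
        then have v: "z < v" "v \<le> t" using u by auto
        show False
        proof (cases "y < v")
          case True
          moreover have "u < y" using u crossing by order
          ultimately show False using o1[OF u(1) _ u(3)] u(2) by blast
        next
          case False
          then have "v < t" using crossing by order
          then have "v = y \<and> u = s" using o2[of v u] u v N_commute by blast
          then show False using u by simp
        qed
      qed
      have c2: "closed z y"
      proof (rule closedI[OF V(1,2) crossing(2)])
        fix u v assume u: "z < u" "u < y" "v \<in> N u" "v < z \<or> y < v"
        have "s < u" "u < t" using u crossing by order+
        then show False using o1[OF _ u(2,3)] o2[OF u(1) _ u(3)] u(1,2,4) by blast
      qed
      have c3: "closed y t"
      proof (rule closedI[OF V(2) st(2) crossing(3)])
        fix u v assume u: "y < u" "u < t" "v \<in> N u" "v < y \<or> t < v"
        have "s < u" using u crossing by order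
        then have "s \<le> v" "v \<le> t" using closedD[OF cl _ u(2,3)] by auto
        then have v: "s \<le> v" "v < y" using u by auto
        show False
        proof (cases "v < z")
          case True
          moreover have "z < u" using u crossing by order
          ultimately show False using o2[OF _ u(2,3)] u(1) by blast
        next
          case False
          then have "s < v" using crossing by order
          then have "v = z \<and> u = t" using o1[of v u] u v N_commute by blast
          then show False using u by simp
        qed
      qed
      have zt: "z < t" "s < y" using crossing by order+
      obtain l1 where l1: "link l1 s z" "link_verts l1 = between s z" using IH[OF c1 order_refl less_imp_le[OF zt(1)] disjI2[OF less_imp_neq[OF zt(1)]]] by blast
      obtain l2 where l2: "link l2 z y" "link_verts l2 = between z y" using IH[OF c2 less_imp_le[OF crossing(1)] less_imp_le[OF crossing(3)] disjI1[OF less_imp_neq[OF crossing(1), symmetric]]] by blast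
      obtain l3 where l3: "link l3 y t" "link_verts l3 = between y t" using IH[OF c3 less_imp_le[OF zt(2)] order_refl disjI1[OF less_imp_neq[OF zt(2), symmetric]]] by blast
      have "N z = insert t (N z \<inter> {s..z} \<union> N z \<inter> {z..y})"
      proof -
        have "v \<in> insert t ({s..z} \<union> {z..y})" if "v \<in> N z" for v
        proof (cases "v = t")
          case False
          then have "s \<le> v" "v \<le> y" using oz[OF that] by (meson not_less)+
          then show ?thesis using linear[of v z] by auto
        qed simp
        then show ?thesis using crossing(5) by blast
      qed
      then have Nz: "N z = insert t (right_nbrs l1 s \<union> left_nbrs l2 y)"
        using N_below[OF l1 st(1)] N_above[OF l2 V(2)] crossing by simp
      have "N y = insert s (N y \<inter> {z..y} \<union> N y \<inter> {y..t})"
      proof -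
        have "v \<in> insert s ({z..y} \<union> {y..t})" if "v \<in> N y" for v
        proof (cases "v = s")
          case False
          then have "z \<le> v" "v \<le> t" using oy[OF that] by (meson not_less)+
          then show ?thesis using linear[of v y] by auto
        qed simp
        then show ?thesis using V(4) by blast
      qed
      then have Ny: "N y = insert s (right_nbrs l2 z \<union> left_nbrs l3 t)"
        using N_below[OF l2 V(1)] N_above[OF l3 st(2)] crossing by simp
      have "crossing s z y t l1 l2 l3"
        unfolding crossing_def using l1 l2 l3 Nz Ny crossing by (auto simp: between_def)
      then obtain l where "link l s t" "link_verts l = {z, y} \<union> link_verts l1 \<union> link_verts l2 \<union> link_verts l3"
        using crossing_link by blast
      moreover have "{z, y} \<union> link_verts l1 \<union> link_verts l2 \<union> link_verts l3 = between s t"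
        unfolding l1(2) l2(2) l3(2) between_def using V crossing by auto
      ultimately show ?thesis by auto
    next
      case (split u)
      then have u: "u \<in> V" "s < u" "u < t" by (auto simp: between_def)
      obtain l1 where l1: "link l1 s u" "link_verts l1 = between s u" using IH[OF split(2) order_refl less_imp_le[OF u(3)] disjI2[OF less_imp_neq[OF u(3)]]] by blast
      obtain l2 where l2: "link l2 u t" "link_verts l2 = between u t" using IH[OF split(3) less_imp_le[OF u(2)] order_refl disjI1[OF less_imp_neq[OF u(2), symmetric]]] by blast
      have "N u = N u \<inter> {s..u} \<union> N u \<inter> {u..t}"
        using closedD[OF cl u(2,3)] by auto
      then have Nu: "N u = right_nbrs l1 s \<union> left_nbrs l2 t"
        using N_below[OF l1 st(1) u(2)] N_above[OF l2 st(2) u(3)] by simp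
      have "\<exists>l. link l s t \<and> link_verts l = insert u (link_verts l1 \<union> link_verts l2)"
      proof (rule split_link[OF l1(1) l2(1) _ _ _ _ _ _ Nu u(1)])
        show "s \<noteq> u" "u \<noteq> t" "s \<noteq> t" using u st by auto
        show "link_verts l1 \<inter> link_verts l2 = {}" unfolding l1(2) l2(2) between_def by auto
        show "s \<notin> link_verts l2" unfolding l2(2) between_def using u by auto
        show "t \<notin> link_verts l1" unfolding l1(2) between_def using u by auto
      qed
      moreover have "insert u (link_verts l1 \<union> link_verts l2) = between s t"
        unfolding l1(2) l2(2) between_def using u by auto
      ultimately show ?thesis by auto
    qed
  qed
qed

text \<open>The first vertex has all its neighbours in the link of the whole vertex set, so minimum
  degree two forces width two, and the link closes up to a loop by \<open>end_loop\<close>.\<close>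

lemma contradiction: False
proof (cases "V = {}")
  case True
  then show False using not_colorable by (simp add: sub_def)
next
  case False
  define m M where "m = Min V" and "M = Max V"
  have mM: "m \<in> V" "M \<in> V" "\<And>v. v \<in> V \<Longrightarrow> m \<le> v \<and> v \<le> M"
    using False finite_V by (auto simp: m_def M_def)
  have "m \<noteq> M"
  proof
    assume "m = M"
    then have "N m = {}" using mM N_sub[of m] N_irrefl[of m] by (metis antisym equals0I subsetD)
    then show False using degree_ge_2[OF mM(1)] by simp
  qed
  then have lt: "m < M" using mM(3)[OF mM(1)] by simp
  have "closed m M" unfolding closed_def using mM lt N_sub by fastforce
  then obtain l where l: "link l m M" "link_verts l = between m M" using closed_link by blast
  have "N m = N m \<inter> {m..M}" using N_sub[of m] mM by auto
  then have Nm: "N m = left_nbrs l M" using N_above[OF l mM(2) lt] by simp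
  have "2 \<le> width l" using degree_ge_2[OF mM(1)] card_left_nbrs[OF l(1)] Nm by simp
  then have "width l = 2" using width_cases[of l] by auto
  then show False using end_loop[OF l(1) _ Nm] \<open>m \<noteq> M\<close> by blast
qed

end

section \<open>Colouring all graphs with an admissible vertex order\<close>

definition tight_pentagon :: "('v \<Rightarrow> 'v set) \<Rightarrow> ('v \<Rightarrow> 'c set) \<Rightarrow> 'v list \<Rightarrow> bool" where
  "tight_pentagon N L cs \<longleftrightarrow> distinct cs \<and> length cs = 5 \<and>
    (\<forall>i<5. N (cs ! i) = {cs ! ((i + 1) mod 5), cs ! ((i + 4) mod 5)} \<and> card (L (cs ! i)) = 4)"

text \<open>With the vertices on a circle in the order of \<open>pos\<close> and edges drawn as chords, every edge
  is crossed at most once.\<close>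

definition one_crossing_order :: "('v \<Rightarrow> 'r::linorder) \<Rightarrow> ('v \<Rightarrow> 'v set) \<Rightarrow> bool" where
  "one_crossing_order pos N \<longleftrightarrow> (\<forall>x y z w z' w'. y \<in> N x \<longrightarrow> w \<in> N z \<longrightarrow> w' \<in> N z' \<longrightarrow>
     pos x < pos z \<longrightarrow> pos z < pos y \<longrightarrow> pos w < pos x \<or> pos y < pos w \<longrightarrow>
     pos x < pos z' \<longrightarrow> pos z' < pos y \<longrightarrow> pos w' < pos x \<or> pos y < pos w' \<longrightarrow> z' = z \<and> w' = w)"

text \<open>Passing to induced subgraphs creates no new tight pentagon: a list of size four forces
  degree at most two in the whole graph, so a pentagon that is tight in the subgraph is a component
  of the whole graph as well.\<close>

lemma sub_colorable_ordered:
  fixes V :: "'v :: linorder set" and L :: "'v \<Rightarrow> 'c set"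
  assumes "list_graph V N L"
    and "one_crossing_order (\<lambda>v. v) N" "\<nexists>cs. tight_pentagon N L cs" "W \<subseteq> V"
  shows "\<exists>\<phi>. list_graph.sub N L W \<phi>"
proof -
  interpret list_graph V N L by fact
  show ?thesis
    using finite_subset[OF assms(4) finite_V] assms(4)
  proof (induction W rule: finite_psubset_induct)
    case (psubset W)
    note oc = assms(2)[unfolded one_crossing_order_def, rule_format]
    define N' where "N' v = (if v \<in> W then N v \<inter> W else {})" for v
    have N'N: "N' v \<subseteq> N v" for v by (auto simp: N'_def)
    have fin: "finite W" using psubset by blast
    interpret W: list_graph W N' L
    proof
      fix u v
      show "u \<in> N' v \<Longrightarrow> v \<in> N' u" using N_sym by (auto simp: N'_def split: if_splits)
      show "card (N' v) \<le> 4" using N_card[of v] card_mono[OF finite_N N'N[of v]] by simp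
      show "v \<in> W \<Longrightarrow> card (N' v) + 2 \<le> card (L v)"
        using L_card[of v] card_mono[OF finite_N N'N[of v]] psubset.prems by auto
    qed (use fin N_irrefl in \<open>auto simp: N'_def split: if_splits\<close>)
    have sub_eq: "W.sub W' \<phi> \<longleftrightarrow> sub W' \<phi>" if "W' \<subseteq> W" for W' \<phi>
    proof -
      have "N' v \<inter> W' = N v \<inter> W'" if "v \<in> W'" for v using that \<open>W' \<subseteq> W\<close> by (auto simp: N'_def)
      then show ?thesis unfolding W.sub_def sub_def by simp
    qed
    show ?case
    proof (rule ccontr)
      assume no: "\<nexists>\<phi>. sub W \<phi>"
      interpret ordered_counterexample W N' L
      proof
        show "W' \<subset> W \<Longrightarrow> \<exists>\<phi>. W.sub W' \<phi>" for W'
          using psubset.IH[of W'] psubset.prems sub_eq[of W'] by auto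
        show "\<not> W.sub W \<phi>" for \<phi> using no sub_eq by simp
        fix cs :: "'v list"
        assume cs: "distinct cs" "length cs = 5"
          "\<And>i. i < 5 \<Longrightarrow> N' (cs ! i) = {cs ! ((i + 1) mod 5), cs ! ((i + 4) mod 5)}"
        show "\<exists>i<5. card (L (cs ! i)) \<noteq> 4"
        proof (rule ccontr)
          assume "\<not> ?thesis"
          then have four: "card (L (cs ! i)) = 4" if "i < 5" for i using that by blast
          have "N (cs ! i) = N' (cs ! i)" if i: "i < 5" for i
          proof -
            have "cs ! ((i + 1) mod 5) \<noteq> cs ! ((i + 4) mod 5)"
            proof -
              have "i = 0 \<or> i = 1 \<or> i = 2 \<or> i = 3 \<or> i = 4" using i by linarith
              then have "(i + 1) mod 5 \<noteq> (i + 4) mod 5" by (elim disjE) simp_all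
              then show ?thesis using cs(1,2) by (simp add: nth_eq_iff_index_eq)
            qed
            then have c2: "card (N' (cs ! i)) = 2" using cs(3)[OF i] by simp
            have "cs ! i \<in> W" using cs(3)[OF i] by (auto simp: N'_def split: if_splits)
            then have "card (N (cs ! i)) \<le> 2" using L_card[of "cs ! i"] four[OF i] psubset.prems by auto
            then show ?thesis using card_seteq[OF finite_N N'N] c2 by metis
          qed
          then have "tight_pentagon N L cs" unfolding tight_pentagon_def using cs four by simp
          then show False using assms(3) by blast
        qed
      next
        fix x y z w z' w'
        assume "y \<in> N' x" "x < z" "z < y" "w \<in> N' z" "w < x \<or> y < w" "x < z'" "z' < y" "w' \<in> N' z'"
          "w' < x \<or> y < w'"
        then show "z' = z \<and> w' = w"
          using oc[of y x w z w' z'] N'N by (metis subsetD)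
      qed
      show False by (rule contradiction)
    qed
  qed
qed

text \<open>The vertices themselves carry no order, so the graph is transported to their positions
  and the colouring is pulled back along \<open>pos\<close>.\<close>

lemma (in list_graph) colorable:
  fixes pos :: "'v \<Rightarrow> 'r :: linorder"
  assumes oc: "one_crossing_order pos N" and inj: "inj_on pos V" and no: "\<nexists>cs. tight_pentagon N L cs"
  shows "\<exists>\<phi>. sub V \<phi>"
proof -
  define ip where "ip = inv_into V pos"
  have ip: "ip (pos v) = v" if "v \<in> V" for v using that inj by (simp add: ip_def)
  define N' where "N' r = (if r \<in> pos ` V then pos ` N (ip r) else {})" for r
  define L' where "L' r = L (ip r)" for r
  have N': "N' (pos v) = pos ` N v" if "v \<in> V" for v using that ip by (simp add: N'_def)
  have injN: "inj_on pos (N v)" for v using inj N_sub inj_on_subset by blast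
  have NV: "u \<in> V" if "u \<in> N v" for u v using that N_sub by blast
  have pos_eq: "pos u = pos v \<longleftrightarrow> u = v" if "u \<in> V" "v \<in> V" for u v
    using that inj_on_eq_iff[OF inj] by blast
  have mem: "pos u \<in> N' (pos v) \<longleftrightarrow> u \<in> N v" if "u \<in> V" "v \<in> V" for u v
    using that pos_eq NV by (auto simp: N')
  have pre: "\<exists>v\<in>V. \<exists>u\<in>N v. r = pos v \<and> q = pos u" if q: "q \<in> N' r" for q r
  proof -
    have "r \<in> pos ` V" using q by (auto simp: N'_def split: if_splits)
    then obtain v where v: "v \<in> V" "r = pos v" by blast
    then obtain u where "u \<in> N v" "q = pos u" using q N' by auto
    then show ?thesis using v by blast
  qed
  interpret R: list_graph "pos ` V" N' L'
  proof
    show "finite (pos ` V)" using finite_V by simp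
    show "N' r \<subseteq> pos ` V" for r using N_sub by (auto simp: N'_def split: if_splits)
    show "r \<notin> pos ` V \<Longrightarrow> N' r = {}" for r by (simp add: N'_def)
    show "q \<in> N' r \<Longrightarrow> r \<in> N' q" for q r using pre[of q r] mem N_sym NV by metis
    show "r \<notin> N' r" for r using pre[of r r] pos_eq NV N_irrefl by metis
    show "card (N' r) \<le> 4" for r using N_card card_image[OF injN] by (simp add: N'_def)
    show "r \<in> pos ` V \<Longrightarrow> card (N' r) + 2 \<le> card (L' r)" for r
      using L_card card_image[OF injN] ip by (auto simp: N'_def L'_def)
  qed
  have "one_crossing_order (\<lambda>v. v) N'"
    unfolding one_crossing_order_def
  proof (intro allI impI)
    fix x y z w z' w'
    assume h: "y \<in> N' x" "w \<in> N' z" "w' \<in> N' z'" "x < z" "z < y" "w < x \<or> y < w" "x < z'" "z' < y"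
      "w' < x \<or> y < w'"
    obtain x0 y0 where xy: "y0 \<in> N x0" "x = pos x0" "y = pos y0" using pre[OF h(1)] by blast
    obtain z0 w0 where zw: "w0 \<in> N z0" "z = pos z0" "w = pos w0" using pre[OF h(2)] by blast
    obtain z1 w1 where zw': "w1 \<in> N z1" "z' = pos z1" "w' = pos w1" using pre[OF h(3)] by blast
    have "z1 = z0 \<and> w1 = w0"
      using oc[unfolded one_crossing_order_def, rule_format, of y0 x0 w0 z0 w1 z1] h(4-9)
      unfolding xy(2,3) zw(2,3) zw'(2,3) using xy(1) zw(1) zw'(1) by blast
    then show "z' = z \<and> w' = w" using zw zw' by simp
  qed
  moreover have "\<nexists>cs. tight_pentagon N' L' cs"
  proof
    assume "\<exists>cs. tight_pentagon N' L' cs"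
    then obtain cs where cs: "tight_pentagon N' L' cs" by blast
    define ds where "ds = map ip cs"
    have inV: "cs ! i \<in> pos ` V" if "i < 5" for i
    proof (rule ccontr)
      assume "cs ! i \<notin> pos ` V"
      then have "N' (cs ! i) = {}" by (simp add: N'_def)
      then show False using cs that unfolding tight_pentagon_def by auto
    qed
    have len: "length cs = 5" using cs unfolding tight_pentagon_def by blast
    have sub: "set cs \<subseteq> pos ` V" using inV len by (auto simp: in_set_conv_nth)
    have dsn: "ds ! i = ip (cs ! i)" "ds ! i \<in> V" "pos (ds ! i) = cs ! i" if "i < 5" for i
      using that inV[OF that] ip len by (auto simp: ds_def)
    have "inj_on ip (pos ` V)" using ip by (auto simp: inj_on_def)
    then have "distinct ds" using cs sub unfolding tight_pentagon_def ds_def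
      by (auto simp: distinct_map inj_on_subset)
    moreover have "N (ds ! i) = {ds ! ((i + 1) mod 5), ds ! ((i + 4) mod 5)} \<and> card (L (ds ! i)) = 4"
      if i: "i < 5" for i
    proof -
      have m: "(i + 1) mod 5 < 5" "(i + 4) mod 5 < 5" by simp_all
      have "pos ` N (ds ! i) = N' (cs ! i)" using N'[OF dsn(2)[OF i]] dsn(3)[OF i] by simp
      also have "\<dots> = {cs ! ((i + 1) mod 5), cs ! ((i + 4) mod 5)}"
        using cs i unfolding tight_pentagon_def by blast
      also have "\<dots> = pos ` {ds ! ((i + 1) mod 5), ds ! ((i + 4) mod 5)}"
        using dsn(3)[OF m(1)] dsn(3)[OF m(2)] by simp
      finally have "N (ds ! i) = {ds ! ((i + 1) mod 5), ds ! ((i + 4) mod 5)}"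
        using inj_on_image_eq_iff[OF inj N_sub, of "{ds ! ((i + 1) mod 5), ds ! ((i + 4) mod 5)}"]
          dsn(2)[OF m(1)] dsn(2)[OF m(2)] by blast
      moreover have "card (L (ds ! i)) = 4"
        using cs i dsn(1)[OF i] unfolding tight_pentagon_def L'_def by simp
      ultimately show ?thesis by blast
    qed
    ultimately have "tight_pentagon N L ds" using len unfolding tight_pentagon_def ds_def by simp
    then show False using no by blast
  qed
  ultimately obtain \<psi> where \<psi>: "R.sub (pos ` V) \<psi>" using sub_colorable_ordered[OF R.list_graph_axioms] by blast
  have "sub V (\<psi> \<circ> pos)"
    unfolding sub_def
  proof (intro ballI)
    fix v assume v: "v \<in> V"
    have NvV: "N v \<inter> V = N v" using N_sub by blast
    have "N' (pos v) \<inter> pos ` V = pos ` N v" using N'[OF v] N_sub by blast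
    then have p: "\<psi> (pos v) \<in> L' (pos v)" "\<And>r. r \<in> pos ` N v \<Longrightarrow> \<psi> r \<noteq> \<psi> (pos v)"
      "pos ` N v \<noteq> {} \<Longrightarrow> conflict_free \<psi> (pos ` N v)"
      using \<psi> v unfolding R.sub_def by auto
    have "conflict_free (\<psi> \<circ> pos) (N v)" if ne: "N v \<noteq> {}"
    proof -
      obtain u where u: "u \<in> N v" "\<And>w. w \<in> N v \<Longrightarrow> \<psi> (pos w) = \<psi> (pos u) \<Longrightarrow> pos w = pos u"
        using p(3) ne unfolding conflict_free_def by auto
      show ?thesis
      proof (rule conflict_freeI[OF u(1)])
        fix w assume "w \<in> N v" "w \<noteq> u"
        then show "(\<psi> \<circ> pos) w \<noteq> (\<psi> \<circ> pos) u" using u pos_eq NV by (metis comp_apply)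
      qed
    qed
    then show "(\<psi> \<circ> pos) v \<in> L v \<and> (\<forall>u\<in>N v \<inter> V. (\<psi> \<circ> pos) u \<noteq> (\<psi> \<circ> pos) v) \<and>
      (N v \<inter> V \<noteq> {} \<longrightarrow> conflict_free (\<psi> \<circ> pos) (N v \<inter> V))"
      using p(1,2) ip[OF v] unfolding NvV by (auto simp: L'_def)
  qed
  then show ?thesis by blast
qed

section \<open>From drawings to vertex orders\<close>

lemma simple_path_eq_iff:
  assumes "simple_path c" "x \<in> {0..1}" "y \<in> {0..1}" "c x = c y"
  shows "x = y \<or> x = 0 \<and> y = 1 \<or> x = 1 \<and> y = 0"
  using assms unfolding simple_path_def loop_free_def by blast

lemma arc_interior:
  assumes "arc h"
  shows "path_image h - {pathstart h, pathfinish h} = h ` {0<..<1}"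
proof -
  have inj: "inj_on h {0..1}" using assms by (simp add: arc_def)
  have im: "{0<..<1} = {0..1::real} - {0, 1}" by auto
  have "h ` {0<..<1} = h ` {0..1} - h ` {0, 1}"
    unfolding im by (rule inj_on_image_set_diff[OF inj]) auto
  then show ?thesis by (simp add: path_image_def pathstart_def pathfinish_def)
qed

text \<open>An arc from \<open>c 0\<close> to \<open>c t3\<close> cuts the inside of the curve into
  two regions. A second path avoiding it would run within one of them, but its ends lie on different
  arcs of the curve, and each region accumulates only at one of these arcs and at the cut.\<close>

lemma interleaved_paths_meet_aux:
  fixes c p q :: "real \<Rightarrow> complex"
  assumes c: "simple_path c" "pathfinish c = pathstart c" and t: "0 < t2" "t2 < t3" "t3 < t4" "t4 < 1"
    and p: "path p" "pathstart p = c 0" "pathfinish p = c t3" "path_image p - {c 0, c t3} \<subseteq> inside (path_image c)"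
    and q: "path q" "pathstart q = c t2" "pathfinish q = c t4" "path_image q - {c t2, c t4} \<subseteq> inside (path_image c)"
  shows "path_image p \<inter> path_image q \<noteq> {}"
proof
  assume disj: "path_image p \<inter> path_image q = {}"
  have c01: "c 1 = c 0" using c(2) by (simp add: pathstart_def pathfinish_def)
  note eq = simple_path_eq_iff[OF c(1)]
  have ne: "c 0 \<noteq> c t3" "c t2 \<noteq> c t4" using eq[of 0 t3] eq[of t2 t4] t by auto
  \<comment> \<open>The given paths may intersect themselves. Arcs with the same ends are extracted,
    since the cutting theorem needs simple paths.\<close>
  obtain g where g: "arc g" "path_image g \<subseteq> path_image p" "pathstart g = c 0" "pathfinish g = c t3"
    using path_contains_arc[OF p(1-3) ne(1)] by metis
  obtain h where h: "arc h" "path_image h \<subseteq> path_image q" "pathstart h = c t2" "pathfinish h = c t4"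
    using path_contains_arc[OF q(1-3) ne(2)] by metis
  define c1 c2 where "c1 = subpath 0 t3 c" and "c2 = reversepath (subpath t3 1 c)"
  have i1: "path_image c1 = c ` {0..t3}" and i2: "path_image c2 = c ` {t3..1}"
    using t by (auto simp: c1_def c2_def path_image_subpath)
  have J: "path_image c1 \<union> path_image c2 = path_image c"
  proof -
    have "{0..t3} \<union> {t3..1} = {0..1}" using t by auto
    then show ?thesis unfolding i1 i2 path_image_def[of c] by (simp add: image_Un[symmetric])
  qed
  have sp: "simple_path c1" "simple_path c2"
    using simple_path_subpath[OF c(1)] t by (auto simp: c1_def c2_def simple_path_reversepath)
  have ends: "pathstart c1 = c 0" "pathfinish c1 = c t3" "pathstart c2 = c 0" "pathfinish c2 = c t3"
    using c01 by (auto simp: c1_def c2_def)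
  have c12: "path_image c1 \<inter> path_image c2 = {c 0, c t3}"
  proof
    show "path_image c1 \<inter> path_image c2 \<subseteq> {c 0, c t3}"
    proof
      fix z assume "z \<in> path_image c1 \<inter> path_image c2"
      then obtain x y where "x \<in> {0..t3}" "y \<in> {t3..1}" "z = c x" "z = c y" unfolding i1 i2 by auto
      then show "z \<in> {c 0, c t3}" using eq[of x y] t by auto
    qed
    have "c 0 \<in> c ` {0..t3}" "c t3 \<in> c ` {0..t3}" "c t3 \<in> c ` {t3..1}" "c 1 \<in> c ` {t3..1}"
      using t by auto
    then show "{c 0, c t3} \<subseteq> path_image c1 \<inter> path_image c2" unfolding i1 i2 using c01 by auto
  qed
  have ic: "inside (path_image c) \<inter> path_image c = {}" using inside_no_overlap by blast
  have gc: "path_image g \<inter> path_image c \<subseteq> {c 0, c t3}" using g(2) p(4) ic by blast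
  have gends: "c 0 \<in> path_image g" "c t3 \<in> path_image g"
    using g(3,4) pathstart_in_path_image pathfinish_in_path_image by metis+
  have c1g: "path_image c1 \<inter> path_image g = {c 0, c t3}" and c2g: "path_image c2 \<inter> path_image g = {c 0, c t3}"
    using gc gends c12 J by blast+
  have gi: "path_image g - {c 0, c t3} = g ` {0<..<1}" using arc_interior[OF g(1)] g(3,4) by simp
  have "g (1/2) \<in> g ` {0<..<1}" by simp
  then have "g (1/2) \<in> path_image g \<inter> inside (path_image c)" using gi g(2) p(4) by blast
  then have "path_image g \<inter> inside (path_image c1 \<union> path_image c2) \<noteq> {}" unfolding J by blast
  then obtain
    I: "inside (path_image c1 \<union> path_image g) \<inter> inside (path_image c2 \<union> path_image g) = {}"
       "inside (path_image c1 \<union> path_image g) \<union> inside (path_image c2 \<union> path_image g) \<union>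
        (path_image g - {c 0, c t3}) = inside (path_image c1 \<union> path_image c2)"
    using split_inside_simple_closed_curve[OF sp(1) ends(1,2) sp(2) ends(3,4) arc_imp_simple_path[OF g(1)]
        g(3,4) ne(1) c12 c1g c2g] by blast
  let ?I1 = "inside (path_image c1 \<union> path_image g)" and ?I2 = "inside (path_image c2 \<union> path_image g)"
  have cl: "closed (path_image c1 \<union> path_image g)" "closed (path_image c2 \<union> path_image g)"
    using closed_path_image[OF simple_path_imp_path[OF sp(1)]] closed_path_image[OF simple_path_imp_path[OF sp(2)]]
      closed_path_image[OF arc_imp_path[OF g(1)]] by (blast intro: closed_Un)+
  have op: "open ?I1" "open ?I2" using open_inside cl by blast+
  let ?Q = "h ` {0<..<1}"
  have conth: "continuous_on {0..1} h" using h(1) by (simp add: arc_def path_def)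
  have conn: "topological_space_class.connected ?Q"
    by (intro connected_continuous_image) (auto intro: continuous_on_subset[OF conth])
  have hi: "path_image h - {c t2, c t4} = ?Q" using arc_interior[OF h(1)] h(3,4) by simp
  have "?Q \<subseteq> inside (path_image c)" unfolding hi[symmetric] using h(2) q(4) by blast
  then have "?Q \<subseteq> ?I1 \<union> ?I2 \<union> (path_image g - {c 0, c t3})" unfolding I(2) J .
  moreover have "x \<notin> path_image g" if "x \<in> ?Q" for x
  proof -
    have "x \<in> path_image h" using that unfolding hi[symmetric] by simp
    then show ?thesis using h(2) g(2) disj by auto
  qed
  ultimately have QI: "?Q \<subseteq> ?I1 \<union> ?I2" by auto
  have clQ: "h 0 \<in> T \<and> h 1 \<in> T" if "closed T" "?Q \<subseteq> T" for T
  proof -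
    have "h ` closure {0<..<1} \<subseteq> T"
      using that conth by (intro image_closure_subset) (auto simp: closure_greaterThanLessThan)
    then show ?thesis by (auto simp: closure_greaterThanLessThan)
  qed
  have h01: "h 0 = c t2" "h 1 = c t4" using h(3,4) by (simp_all add: pathstart_def pathfinish_def)
  have onJ: "c t2 \<in> path_image c" "c t4 \<in> path_image c" using t by (auto simp: path_image_def)
  have notg: "c t2 \<notin> path_image g" "c t4 \<notin> path_image g"
    using gc onJ eq[of t2 0] eq[of t2 t3] eq[of t4 0] eq[of t4 t3] t by auto
  have not12: "c t4 \<notin> path_image c1" "c t2 \<notin> path_image c2"
  proof -
    have "c t4 \<noteq> c x" if "x \<in> {0..t3}" for x using eq[of t4 x] that t by auto
    then show "c t4 \<notin> path_image c1" unfolding i1 by blast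
    have "c t2 \<noteq> c x" if "x \<in> {t3..1}" for x using eq[of t2 x] that t by auto
    then show "c t2 \<notin> path_image c2" unfolding i2 by blast
  qed
  have "?I1 \<union> ?I2 \<subseteq> inside (path_image c)" unfolding J[symmetric] I(2)[symmetric] by auto
  then have notI: "c t2 \<notin> ?I1 \<union> ?I2" "c t4 \<notin> ?I1 \<union> ?I2"
    using onJ by (metis IntI empty_iff ic subsetD)+
  have cI: "closed (?I1 \<union> (path_image c1 \<union> path_image g))" "closed (?I2 \<union> (path_image c2 \<union> path_image g))"
    unfolding Un_commute[of "inside _"] union_with_inside using open_outside[OF cl(1)] open_outside[OF cl(2)] by auto
  \<comment> \<open>Connectedness puts the open arc into one region. Both its ends then belong to
    the closure of that region, though one of them lies on the opposite side.\<close>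
  have "?Q \<subseteq> ?I1 \<or> ?Q \<subseteq> ?I2"
    using connectedD[OF conn op _ QI] I(1) QI by blast
  then show False
  proof
    assume "?Q \<subseteq> ?I1"
    then have "c t4 \<in> ?I1 \<union> (path_image c1 \<union> path_image g)" using clQ[OF cI(1)] h01 by auto
    then show False using notI notg not12 by auto
  next
    assume "?Q \<subseteq> ?I2"
    then have "c t2 \<in> ?I2 \<union> (path_image c2 \<union> path_image g)" using clQ[OF cI(2)] h01 by auto
    then show False using notI notg not12 by auto
  qed
qed

text \<open>A shift of the closed parametrisation moves the first of the four points to parameter
  0.\<close>

lemma interleaved_paths_meet:
  fixes c p q :: "real \<Rightarrow> complex"
  assumes c: "simple_path c" "pathfinish c = pathstart c"
    and t: "0 \<le> t1" "t1 < t2" "t2 < t3" "t3 < t4" "t4 < 1"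
    and p: "path p" "pathstart p = c t1" "pathfinish p = c t3" "path_image p - {c t1, c t3} \<subseteq> inside (path_image c)"
    and q: "path q" "pathstart q = c t2" "pathfinish q = c t4" "path_image q - {c t2, c t4} \<subseteq> inside (path_image c)"
  shows "path_image p \<inter> path_image q \<noteq> {}"
proof -
  define d where "d = shiftpath t1 c"
  have d: "simple_path d" "pathfinish d = pathstart d" "path_image d = path_image c"
    using simple_path_shiftpath[OF c t(1)] closed_shiftpath[OF c(2), of t1]
      path_image_shiftpath[OF _ c(2), of t1] t by (auto simp: d_def)
  have v: "d 0 = c t1" "d (t2 - t1) = c t2" "d (t3 - t1) = c t3" "d (t4 - t1) = c t4"
    using t by (auto simp: d_def shiftpath_def)
  show ?thesis
    by (rule interleaved_paths_meet_aux[OF d(1,2), of "t2 - t1" "t3 - t1" "t4 - t1"])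
      (use t p q in \<open>auto simp: v d(3)\<close>)
qed

text \<open>For a loop in \<open>\<Omega>\<close>, its winding number around \<open>1 / (z - d)\<close>, extended by 0 to \<open>z = d\<close>, is a
  continuous integer-valued function of \<open>z\<close> in the connected set \<open>K\<close>, so it vanishes.\<close>

lemma inversion_of_complement:
  fixes K :: "complex set"
  assumes K: "compact K" "topological_space_class.connected K" "d \<in> K" and conn: "topological_space_class.connected (- K)"
  defines "\<Omega> \<equiv> {w. w = 0 \<or> d + inverse w \<notin> K}"
  shows "open \<Omega>" "simply_connected \<Omega>"
proof -
  let ?i = "\<lambda>z. inverse (z - d)"
  obtain R where R: "R > 0" "\<And>z. z \<in> K \<Longrightarrow> norm (z - d) \<le> R"
  proof -
    obtain B where B: "\<And>z. z \<in> K \<Longrightarrow> norm z \<le> B" using compact_imp_bounded[OF K(1)] bounded_iff by metis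
    then have "norm (z - d) \<le> \<bar>B\<bar> + norm d + 1" if "z \<in> K" for z
      using norm_triangle_ineq4[of z d] B[OF that] by linarith
    moreover have "0 < \<bar>B\<bar> + norm d + 1" using norm_ge_zero[of d] by linarith
    ultimately show ?thesis using that by blast
  qed
  \<comment> \<open>Since \<open>K\<close> is bounded, the points outside \<open>\<Omega>\<close>
    stay away from 0. So the continuity of \<open>inverse\<close> away from its pole suffices to
    show that \<open>\<Omega>\<close> is open.\<close>
  have big: "norm w \<ge> 1 / R" if "w \<notin> \<Omega>" for w
  proof -
    have w: "w \<noteq> 0" "d + inverse w \<in> K" using that by (auto simp: \<Omega>_def)
    then have "norm (inverse w) \<le> R" using R(2)[of "d + inverse w"] by simp
    then have "1 / norm w \<le> R" by (simp add: inverse_eq_divide norm_divide)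
    moreover have "norm w > 0" using w by simp
    ultimately show ?thesis using R(1) by (simp add: divide_le_eq mult.commute)
  qed
  have "- \<Omega> = {w. 1 / R \<le> norm w} \<inter> (\<lambda>w. d + inverse w) -` K"
    using big R(1) by (auto simp: \<Omega>_def)
  moreover have "closed ({w. 1 / R \<le> norm w} \<inter> (\<lambda>w. d + inverse w) -` K)"
  proof (rule continuous_closed_preimage)
    show "continuous_on {w :: complex. 1 / R \<le> norm w} (\<lambda>w. d + inverse w)"
      using R(1) by (intro continuous_intros) (auto simp: field_simps)
    show "closed {w :: complex. 1 / R \<le> norm w}" by (intro closed_Collect_le continuous_intros)
  qed (use K compact_imp_closed in blast)
  ultimately show op: "open \<Omega>" by (simp add: open_closed)
  have iU: "?i ` (- K) = \<Omega> - {0}"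
  proof
    show "?i ` (- K) \<subseteq> \<Omega> - {0}" using K(3) by (auto simp: \<Omega>_def)
    show "\<Omega> - {0} \<subseteq> ?i ` (- K)"
    proof
      fix w assume "w \<in> \<Omega> - {0}"
      then have "d + inverse w \<in> - K" "w = ?i (d + inverse w)" by (auto simp: \<Omega>_def)
      then show "w \<in> ?i ` (- K)" by blast
    qed
  qed
  have "topological_space_class.connected (?i ` (- K))"
    using conn K(3) by (intro connected_continuous_image) (auto intro!: continuous_intros)
  then have "topological_space_class.connected (\<Omega> - {0})" using iU by simp
  moreover have "0 \<in> closure (\<Omega> - {0})"
  proof -
    have "0 islimpt \<Omega>" using op by (intro interior_limit_point) (auto simp: interior_open \<Omega>_def)
    then show ?thesis by (simp add: closure_def islimpt_def) blast
  qed
  ultimately have con: "topological_space_class.connected \<Omega>"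
    using connected_intermediate_closure[of "\<Omega> - {0}" \<Omega>] closure_subset[of "\<Omega> - {0}"] by auto
  show "simply_connected \<Omega>"
    unfolding simply_connected_eq_winding_number_zero[OF op]
  proof (intro conjI con allI impI)
    fix g z0
    assume g: "path g \<and> path_image g \<subseteq> \<Omega> \<and> pathfinish g = pathstart g \<and> z0 \<notin> \<Omega>"
    define h where "h z = (if z = d then 0 else winding_number g (?i z))" for z
    have iK: "?i z \<notin> path_image g" if "z \<in> K" "z \<noteq> d" for z
      using g that by (auto simp: \<Omega>_def)
    obtain B where B: "\<And>z. B \<le> norm z \<Longrightarrow> winding_number g z = 0"
      using winding_number_zero_at_infinity[of g] g by blast
    have "continuous (at z within K) h" if z: "z \<in> K" for z
    proof (cases "z = d")
      case True
      define e where "e = 1 / (\<bar>B\<bar> + 1)"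
      have e: "e > 0" by (simp add: e_def)
      have "h y = 0" if "dist y d < e" for y
      proof (cases "y = d")
        case False
        then have "norm (y - d) > 0" "norm (y - d) < e" using that by (auto simp: dist_norm)
        then have "\<bar>B\<bar> + 1 \<le> 1 / norm (y - d)" by (simp add: e_def field_simps)
        then have "B \<le> norm (?i y)" by (simp add: inverse_eq_divide norm_divide)
        then show ?thesis using B by (simp add: h_def)
      qed (simp add: h_def)
      then show ?thesis
        using True by (intro continuous_transform_within[OF continuous_const[of _ 0] e z]) simp
    next
      case False
      have "continuous (at z within K) (\<lambda>z. winding_number g (?i z))"
      proof (rule continuous_within_compose3[where g = "winding_number g"])
        show "continuous (at (?i z)) (winding_number g)"
          using continuous_at_winding_number g iK[OF z False] by blast
        show "continuous (at z within K) ?i" using False by (intro continuous_intros) auto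
      qed
      moreover have "dist z d > 0" using False by simp
      ultimately show ?thesis
        using z by (rule continuous_transform_within) (auto simp: h_def dist_commute)
    qed
    then have ch: "continuous_on K h" by (simp add: continuous_on_eq_continuous_within)
    have Ints: "h z \<in> \<int>" if "z \<in> K" for z
      using integer_winding_number[of g "?i z"] g iK[OF that] by (auto simp: h_def)
    have "h constant_on K"
    proof (rule continuous_discrete_range_constant[OF K(2) ch])
      fix x assume x: "x \<in> K"
      have "1 \<le> norm (h y - h x)" if y: "y \<in> K" "h y \<noteq> h x" for y
      proof -
        obtain m where m: "h y = of_int m" using Ints[OF y(1)] by (elim Ints_cases)
        obtain n where n: "h x = of_int n" using Ints[OF x] by (elim Ints_cases)
        have "m \<noteq> n" using y m n by auto
        then have "1 \<le> \<bar>m - n\<bar>" by linarith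
        then show ?thesis unfolding m n of_int_diff[symmetric] norm_of_int by linarith
      qed
      then show "\<exists>e>0. \<forall>y. y \<in> K \<and> h y \<noteq> h x \<longrightarrow> e \<le> norm (h y - h x)"
        by (intro exI[of _ 1]) auto
    qed
    then have h0: "h z = 0" if "z \<in> K" for z
      using that K(3) unfolding constant_on_def h_def by (metis (mono_tags, lifting))
    have z0: "z0 \<noteq> 0" "d + inverse z0 \<in> K" using g by (auto simp: \<Omega>_def)
    then have "h (d + inverse z0) = winding_number g z0" by (simp add: h_def)
    then show "winding_number g z0 = 0" using h0[OF z0(2)] by simp
  qed
qed

text \<open>A Riemann map of the inverted complement sends infinity to \<open>f 0\<close> and the
  boundary of \<open>K\<close> towards the unit circle. A circle whose disc contains
  \<open>f 0\<close> and the images of \<open>F\<close> pulls back to a curve with \<open>K\<close>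
  on one side and with \<open>F\<close> and infinity on the other.\<close>

lemma separating_simple_closed_curve:
  fixes K F :: "complex set"
  assumes K: "compact K" "topological_space_class.connected K" "d \<in> K" "d' \<in> K" "d \<noteq> d'" and conn: "topological_space_class.connected (- K)"
    and F: "finite F" "F \<inter> K = {}"
  obtains c where "simple_path c" "pathfinish c = pathstart c" "path_image c \<subseteq> - K"
    "K \<subseteq> inside (path_image c)" "F \<inter> inside (path_image c) = {}"
proof -
  let ?i = "\<lambda>z. inverse (z - d)"
  define \<Omega> where "\<Omega> = {w. w = 0 \<or> d + inverse w \<notin> K}"
  have \<Omega>: "open \<Omega>" "simply_connected \<Omega>"
    unfolding \<Omega>_def using inversion_of_complement[OF K(1-3) conn] by blast+
  \<comment> \<open>A second point of \<open>K\<close> ensures that \<open>\<Omega>\<close> is not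
    the whole plane, as the Riemann mapping theorem requires.\<close>
  have "?i d' \<notin> \<Omega>" using K by (auto simp: \<Omega>_def)
  moreover have z\<Omega>: "0 \<in> \<Omega>" by (simp add: \<Omega>_def)
  ultimately obtain f g where f: "f holomorphic_on \<Omega>" and g: "g holomorphic_on ball 0 1"
    and fg: "\<And>z. z \<in> \<Omega> \<Longrightarrow> f z \<in> ball 0 1 \<and> g (f z) = z"
    and gf: "\<And>w. w \<in> ball 0 1 \<Longrightarrow> g w \<in> \<Omega> \<and> f (g w) = w"
    using Riemann_mapping_theorem[of \<Omega>] \<Omega> by (metis UNIV_I empty_iff)
  have cf: "continuous_on \<Omega> f" and cg: "continuous_on (ball 0 1) g"
    using f g holomorphic_on_imp_continuous_on by blast+
  define P where "P = insert (f 0) ((\<lambda>z. f (?i z)) ` F)"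
  have i\<Omega>: "?i z \<in> \<Omega>" if "z \<notin> K" for z using that by (auto simp: \<Omega>_def)
  have FK: "z \<notin> K" if "z \<in> F" for z using F that by blast
  have fB: "f (?i z) \<in> ball 0 1" if "z \<notin> K" for z using fg[OF i\<Omega>[OF that]] by blast
  have P: "finite P" "P \<subseteq> ball 0 1" "P \<noteq> {}" using F fB FK fg[OF z\<Omega>] by (auto simp: P_def)
  define s where "s = Max (norm ` P)"
  have s: "norm w \<le> s" if "w \<in> P" for w using that P by (simp add: s_def)
  have "s \<in> norm ` P" unfolding s_def using P by (intro Max_in) auto
  then have "0 \<le> s" "s < 1" using P by auto
  then obtain r where r: "s < r" "r < 1" "0 < r" using dense by (meson le_less_trans)
  have Pr: "norm w < r" if "w \<in> P" for w using s[OF that] r by simp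
  \<comment> \<open>The inverse of the conformal map from the complement of \<open>K\<close> onto
    the punctured disc; the puncture \<open>f 0\<close> stands for infinity.\<close>
  define \<psi> where "\<psi> w = d + inverse (g w)" for w
  let ?B = "ball (0::complex) 1 - {f 0}"
  have g0: "g w \<noteq> 0" if "w \<in> ?B" for w
  proof
    assume "g w = 0"
    moreover have "f (g w) = w" using gf that by blast
    ultimately show False using that by simp
  qed
  have c\<psi>: "continuous_on ?B \<psi>"
  proof -
    have "continuous_on ?B g" by (rule continuous_on_subset[OF cg]) (rule Diff_subset)
    then have "continuous_on ?B (\<lambda>w. inverse (g w))"
      by (rule continuous_on_inverse) (use g0 in blast)
    then show ?thesis
      unfolding \<psi>_def by (rule continuous_on_add[OF continuous_on_const])
  qed
  have inj\<psi>: "inj_on \<psi> ?B"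
  proof (rule inj_onI)
    fix x y assume xy: "x \<in> ?B" "y \<in> ?B" "\<psi> x = \<psi> y"
    then have "g x = g y" by (simp add: \<psi>_def)
    moreover have "f (g x) = x" "f (g y) = y" using xy gf by blast+
    ultimately show "x = y" by metis
  qed
  have \<psi>K: "\<psi> w \<notin> K" if "w \<in> ?B" for w
  proof -
    have "g w \<in> \<Omega>" using gf that by blast
    then show ?thesis using g0[OF that] by (simp add: \<psi>_def \<Omega>_def)
  qed
  have onto: "f (?i z) \<in> ?B \<and> \<psi> (f (?i z)) = z" if "z \<notin> K" for z
  proof -
    have zd: "z \<noteq> d" using that K by auto
    have "g (f (?i z)) = ?i z" "g (f 0) = 0" using fg i\<Omega>[OF that] z\<Omega> by auto
    moreover from this have "f (?i z) \<noteq> f 0" using zd by auto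
    ultimately show ?thesis using fg[OF i\<Omega>[OF that]] zd by (simp add: \<psi>_def)
  qed
  define c where "c = \<psi> \<circ> circlepath 0 r"
  have circ: "path_image (circlepath 0 r) = sphere 0 r" using r by simp
  have sB: "sphere 0 r \<subseteq> ?B" using r Pr[of "f 0"] by (auto simp: P_def)
  have sc: "simple_path c"
    unfolding c_def
  proof (rule simple_path_continuous_image)
    show "simple_path (circlepath 0 r)" using r by (simp add: simple_path_circlepath)
    show "continuous_on (path_image (circlepath 0 r)) \<psi>" "inj_on \<psi> (path_image (circlepath 0 r))"
      unfolding circ using continuous_on_subset[OF c\<psi> sB] inj_on_subset[OF inj\<psi> sB] by blast+
  qed
  have loop: "pathfinish c = pathstart c" by (simp add: c_def pathfinish_compose pathstart_compose)
  have J: "path_image c = \<psi> ` sphere 0 r" unfolding c_def path_image_compose circ ..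
  define Z where "Z = \<psi> ` (ball 0 r - {f 0})"
  define A where "A = \<psi> ` {w. r < norm w \<and> norm w < 1}"
  have subB: "ball 0 r - {f 0} \<subseteq> ?B" "{w. r < norm w \<and> norm w < 1} \<subseteq> ?B"
    using r Pr[of "f 0"] by (auto simp: P_def)
  have ZJ: "Z \<inter> path_image c = {}" and AJ: "A \<inter> path_image c = {}"
    unfolding Z_def A_def J using inj_onD[OF inj\<psi>] subB sB by (fastforce simp: image_iff)+
  have cover: "z \<in> K \<union> Z \<union> A \<union> path_image c" for z
  proof (cases "z \<in> K")
    case False
    define w where "w = f (?i z)"
    have w: "w \<in> ?B" "\<psi> w = z" using onto[OF False] by (auto simp: w_def)
    then have "norm w < 1" "w \<noteq> f 0" by auto
    then have "w \<in> ball 0 r - {f 0} \<or> w \<in> sphere 0 r \<or> w \<in> {w. r < norm w \<and> norm w < 1}" by auto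
    then show ?thesis unfolding Z_def A_def J using w by blast
  qed auto
  have KJ: "K \<inter> path_image c = {}" unfolding J using \<psi>K sB by blast
  have "topological_space_class.connected (ball 0 r - {f 0})" by (intro connected_open_delete) auto
  then have conZ: "topological_space_class.connected Z"
    unfolding Z_def by (intro connected_continuous_image continuous_on_subset[OF c\<psi>] subB)
  have conA: "topological_space_class.connected A"
    unfolding A_def using connected_annulus(1)[of r "0::complex" 1]
    by (intro connected_continuous_image continuous_on_subset[OF c\<psi>] subB) auto
  \<comment> \<open>Points far from \<open>d\<close> are inverted to points near 0 and hence mapped
    near \<open>f 0\<close>, inside the circle. So \<open>Z\<close> reaches infinity.\<close>
  have unbZ: "\<not> bounded Z"
  proof
    assume "bounded Z"
    then obtain M where M: "\<And>z. z \<in> Z \<Longrightarrow> norm z \<le> M" by (meson bounded_iff)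
    have "open (\<Omega> \<inter> f -` ball 0 r)" using continuous_open_preimage[OF cf \<Omega>(1) open_ball] .
    moreover have "0 \<in> \<Omega> \<inter> f -` ball 0 r" using z\<Omega> Pr[of "f 0"] by (simp add: P_def)
    ultimately obtain e where e: "e > 0" "ball 0 e \<subseteq> \<Omega> \<inter> f -` ball 0 r" by (meson openE)
    define z where "z = d + of_real (1 / e + \<bar>M\<bar> + norm d + 1)"
    have nz: "norm (z - d) = 1 / e + \<bar>M\<bar> + norm d + 1" using e by (simp add: z_def del: of_real_add)
    have "norm (?i z) < e"
    proof -
      have "1 / e < norm (z - d)" unfolding nz using norm_ge_zero[of d] by linarith
      moreover have "norm (?i z) = 1 / norm (z - d)" by (simp add: inverse_eq_divide norm_divide)
      moreover have "0 < 1 / e" using e by simp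
      ultimately show ?thesis using e by (simp add: divide_less_eq mult.commute)
    qed
    then have iz: "?i z \<in> \<Omega>" "norm (f (?i z)) < r" using e by auto
    have "norm (z - d) > 0" unfolding nz using norm_ge_zero[of d] e by (intro add_nonneg_pos) auto
    then have "z \<noteq> d" by auto
    then have "z \<notin> K" using iz(1) by (auto simp: \<Omega>_def)
    then have "z \<in> Z" unfolding Z_def using onto[of z] iz(2) by (intro image_eqI[of _ _ "f (?i z)"]) auto
    then have "norm z \<le> M" using M by blast
    moreover have "norm (z - d) \<le> norm z + norm d" by (rule norm_triangle_ineq4)
    moreover have "1 / e > 0" using e by simp
    ultimately show False using nz by linarith
  qed
  have Zout: "Z \<subseteq> outside (path_image c)"
  proof
    fix z assume z: "z \<in> Z"
    have "Z \<subseteq> connected_component_set (- path_image c) z"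
      using z conZ ZJ by (intro connected_component_maximal) auto
    then have "\<not> bounded (connected_component_set (- path_image c) z)" using unbZ bounded_subset by blast
    then show "z \<in> outside (path_image c)" by (simp add: outside)
  qed
  have insZ: "inside (path_image c) \<inter> Z = {}" using Zout inside_Int_outside by blast
  have insJ: "inside (path_image c) \<inter> path_image c = {}" by (rule inside_no_overlap)
  have cpJ: "compact (path_image c)" using sc by (simp add: compact_simple_path_image)
  have dich: "T \<subseteq> inside (path_image c)"
    if T: "topological_space_class.connected T" "T \<inter> path_image c = {}" "x \<in> T" "x \<in> inside (path_image c)" for T x
  proof
    fix y assume y: "y \<in> T"
    then have "connected_component (- path_image c) x y"
      using T unfolding connected_component_def by (intro exI[of _ T]) auto
    then show "y \<in> inside (path_image c)" using inside_same_component T(4) by blast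
  qed
  \<comment> \<open>Otherwise the inside of the curve would be filled by the annular part
    \<open>A\<close>, and together with the curve it would be a compact set disjoint from
    \<open>K\<close>. On it the norm of the Riemann map attains a maximum below 1, whereas
    \<open>A\<close> contains points of norm arbitrarily close to 1.\<close>
  have "K \<inter> inside (path_image c) \<noteq> {}"
  proof
    assume no: "K \<inter> inside (path_image c) = {}"
    obtain x where x: "x \<in> inside (path_image c)" using Jordan_inside_outside[OF sc loop] by blast
    then have xA: "x \<in> A" using cover[of x] no insZ insJ by blast
    have AI: "A \<subseteq> inside (path_image c)" using dich[OF conA AJ xA x] .
    let ?T = "path_image c \<union> inside (path_image c)"
    have TK: "?T \<inter> K = {}" using no KJ by blast
    have "bounded (inside (path_image c))" using cpJ by (simp add: bounded_inside compact_imp_bounded)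
    moreover have "closed ?T" unfolding union_with_inside using open_outside[OF compact_imp_closed[OF cpJ]] by auto
    ultimately have cT: "compact ?T" using cpJ by (simp add: compact_eq_bounded_closed compact_imp_bounded)
    have "continuous_on ?T (\<lambda>z. f (?i z))"
    proof (rule continuous_on_compose2[OF cf])
      show "continuous_on ?T ?i" using TK K(3) by (intro continuous_intros) auto
      show "?i ` ?T \<subseteq> \<Omega>" using TK i\<Omega> by blast
    qed
    then have "compact (norm ` (\<lambda>z. f (?i z)) ` ?T)"
      by (intro compact_continuous_image continuous_intros cT) auto
    moreover have "norm ` (\<lambda>z. f (?i z)) ` ?T \<noteq> {}" using x by blast
    ultimately obtain m where m: "m \<in> norm ` (\<lambda>z. f (?i z)) ` ?T" "\<And>q. q \<in> norm ` (\<lambda>z. f (?i z)) ` ?T \<Longrightarrow> q \<le> m"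
      using compact_attains_sup by metis
    then obtain z where z: "z \<in> ?T" "m = norm (f (?i z))" by blast
    have "m < 1" using z TK fg[OF i\<Omega>[of z]] by auto
    then obtain q where q: "max r m < q" "q < 1" using r dense[of "max r m" 1] by auto
    define w where "w = complex_of_real q"
    have nw: "norm w = q" using q r by (simp add: w_def)
    then have wA: "w \<in> {w. r < norm w \<and> norm w < 1}" using q by auto
    then have "\<psi> w \<in> ?T" using AI A_def by blast
    moreover have "f (?i (\<psi> w)) = w" using gf[of w] wA by (simp add: \<psi>_def)
    ultimately have "norm w \<le> m" by (intro m(2)) (metis image_eqI)
    then show False using nw q by simp
  qed
  then obtain x where "x \<in> K" "x \<in> inside (path_image c)" by blast
  then have Kin: "K \<subseteq> inside (path_image c)" using dich[OF K(2) KJ] by blast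
  have "F \<subseteq> Z"
  proof
    fix z assume z: "z \<in> F"
    then have "norm (f (?i z)) < r" using Pr by (simp add: P_def)
    moreover have "z \<notin> K" using z F by blast
    ultimately show "z \<in> Z" unfolding Z_def using onto[of z] by (intro image_eqI[of _ _ "f (?i z)"]) auto
  qed
  then have "F \<inter> inside (path_image c) = {}" using insZ by blast
  then show ?thesis using that sc loop Kin KJ by blast
qed

section \<open>Drawings of connected graphs\<close>

lemma pair_graphD:
  assumes "pair_graph G"
  shows "finite (pverts G)" "finite (parcs G)" "(u, v) \<in> parcs G \<Longrightarrow> u \<in> pverts G"
    "(u, v) \<in> parcs G \<Longrightarrow> v \<in> pverts G" "(u, v) \<in> parcs G \<Longrightarrow> u \<noteq> v"
    "(u, v) \<in> parcs G \<Longrightarrow> (v, u) \<in> parcs G"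
proof -
  interpret pair_graph G by fact
  show "finite (pverts G)" "finite (parcs G)" by (rule pair_finite_verts pair_finite_arcs)+
  show "(u, v) \<in> parcs G \<Longrightarrow> u \<in> pverts G" "(u, v) \<in> parcs G \<Longrightarrow> v \<in> pverts G"
    by (rule in_arcsD1 in_arcsD2; assumption)+
  show "(u, v) \<in> parcs G \<Longrightarrow> u \<noteq> v" using pair_no_loops by force
  show "(u, v) \<in> parcs G \<Longrightarrow> (v, u) \<in> parcs G"
    using pair_sym_arcs unfolding symmetric_def by (auto dest: symD)
qed

lemma connected_induct:
  assumes G: "pair_graph G" "Digraph_Component.connected G" and u: "u \<in> pverts G" "u \<in> S"
    and step: "\<And>x y. x \<in> S \<Longrightarrow> (x, y) \<in> parcs G \<Longrightarrow> y \<in> S"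
  shows "pverts G \<subseteq> S"
proof
  fix v assume v: "v \<in> pverts G"
  interpret pair_graph G by fact
  have "strongly_connected G"
    using G(2) symmetric_connected_imp_strongly_connected pair_sym_arcs by blast
  then have "u \<rightarrow>\<^sup>*\<^bsub>with_proj G\<^esub> v" using u v by auto
  then have "(u, v) \<in> rtrancl_on (pverts G) (parcs G)" unfolding reachable_def by simp
  then have "u \<in> S \<longrightarrow> v \<in> S" by (induction rule: rtrancl_on.induct) (use step in auto)
  then show "v \<in> S" using u(2) by blast
qed

lemma drawn_set_compact_connected:
  assumes G: "pair_graph G" "Digraph_Component.connected G" and dr: "plane_drawing G p \<gamma>"
  shows "compact (drawn_set G p \<gamma>)" "topological_space_class.connected (drawn_set G p \<gamma>)"
proof -
  note pg = pair_graphD[OF G(1)]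
  have "uedges G = (\<lambda>(u, v). {u, v}) ` parcs G" by (auto simp: uedges_def)
  then have fin: "finite (uedges G)" using pg(2) by simp
  have arc: "arc (\<gamma> e)" "{pathstart (\<gamma> e), pathfinish (\<gamma> e)} = p ` e" if "e \<in> uedges G" for e
    using dr that unfolding plane_drawing_def by blast+
  show "compact (drawn_set G p \<gamma>)"
    unfolding drawn_set_def
    by (intro compact_Un compact_UN finite_imp_compact finite_imageI fin pg(1) compact_arc_image arc)
  let ?D = "drawn_set G p \<gamma>"
  show "topological_space_class.connected ?D"
  proof (cases "pverts G = {}")
    case True
    then have "uedges G = {}" using pg(3) by (auto simp: uedges_def)
    then show ?thesis using True by (simp add: drawn_set_def)
  next
    case False
    then obtain u where u: "u \<in> pverts G" by blast
    have edge: "connected_component ?D x y" if "e \<in> uedges G" "x \<in> path_image (\<gamma> e)" "y \<in> path_image (\<gamma> e)" for e x y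
      unfolding connected_component_def
      using that arc[OF that(1)] by (intro exI[of _ "path_image (\<gamma> e)"])
        (auto simp: drawn_set_def intro: connected_arc_image)
    have ends: "p x \<in> path_image (\<gamma> e)" if "e \<in> uedges G" "x \<in> e" for e x
    proof -
      have "p x \<in> {pathstart (\<gamma> e), pathfinish (\<gamma> e)}" using arc(2)[OF that(1)] that(2) by blast
      then show ?thesis by auto
    qed
    have uD: "p u \<in> ?D" using u by (simp add: drawn_set_def)
    have "pverts G \<subseteq> {v. connected_component ?D (p u) (p v)}"
    proof (rule connected_induct[OF G u])
      show "u \<in> {v. connected_component ?D (p u) (p v)}" using uD by (simp add: connected_component_refl)
      fix x y assume x: "x \<in> {v. connected_component ?D (p u) (p v)}" and xy: "(x, y) \<in> parcs G"
      have e: "{x, y} \<in> uedges G" using xy by (auto simp: uedges_def)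
      have "connected_component ?D (p x) (p y)" by (rule edge[OF e ends[OF e] ends[OF e]]) auto
      then show "y \<in> {v. connected_component ?D (p u) (p v)}" using x connected_component_trans by blast
    qed
    then have vert: "connected_component ?D (p u) (p v)" if "v \<in> pverts G" for v using that by blast
    have "connected_component ?D (p u) z" if "z \<in> ?D" for z
    proof -
      consider v where "v \<in> pverts G" "z = p v" | e where "e \<in> uedges G" "z \<in> path_image (\<gamma> e)"
        using \<open>z \<in> ?D\<close> unfolding drawn_set_def by blast
      then show ?thesis
      proof cases
        case 1 then show ?thesis using vert by simp
      next
        case 2
        then obtain x y where xy: "(x, y) \<in> parcs G" "e = {x, y}" by (auto simp: uedges_def)
        then have "connected_component ?D (p x) z" using edge[OF 2(1) ends[OF 2(1)] 2(2)] by simp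
        moreover have "connected_component ?D (p u) (p x)" using vert pg(3)[OF xy(1)] by blast
        ultimately show ?thesis using connected_component_trans by blast
      qed
    qed
    then show ?thesis
      by (meson connected_iff_connected_component connected_component_sym connected_component_trans)
  qed
qed

lemma isolating_radius:
  fixes p :: "'a \<Rightarrow> complex"
  assumes "finite V" "\<And>v. v \<in> V \<Longrightarrow> closed (C v) \<and> p v \<notin> C v"
  obtains \<epsilon> where "\<epsilon> > 0" "\<And>v. v \<in> V \<Longrightarrow> ball (p v) \<epsilon> \<inter> C v = {}"
proof -
  have "\<exists>\<epsilon>>0. \<forall>v\<in>V. ball (p v) \<epsilon> \<inter> C v = {}"
    using assms
  proof (induction V rule: finite_induct)
    case (insert x V)
    then obtain e1 where e1: "e1 > 0" "\<forall>v\<in>V. ball (p v) e1 \<inter> C v = {}" by blast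
    have "open (- C x)" "p x \<in> - C x" using insert.prems[of x] by auto
    then obtain e2 where e2: "e2 > 0" "ball (p x) e2 \<subseteq> - C x" by (meson openE)
    have "ball (p v) (min e1 e2) \<subseteq> ball (p v) e1" "ball (p v) (min e1 e2) \<subseteq> ball (p v) e2" for v by auto
    then have "\<forall>v\<in>insert x V. ball (p v) (min e1 e2) \<inter> C v = {}" using e1(2) e2(2) by blast
    then show ?case using e1(1) e2(1) by (intro exI[of _ "min e1 e2"]) auto
  qed (auto intro: exI[of _ 1])
  then show ?thesis using that by blast
qed

lemma joined_path:
  fixes a b :: "real \<Rightarrow> complex"
  assumes "path a" "path b" "arc g" "pathstart a = x" "pathstart b = y"
    "{pathstart g, pathfinish g} = {x, y}" "x \<noteq> y"
  obtains q where "path q" "pathstart q = pathfinish a" "pathfinish q = pathfinish b"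
    "path_image q = path_image a \<union> path_image g \<union> path_image b"
proof -
  obtain h where h: "path h" "pathstart h = x" "pathfinish h = y" "path_image h = path_image g"
  proof (cases "pathstart g = x")
    case True
    then have "pathfinish g = y" using assms(6,7) by (auto simp: doubleton_eq_iff)
    then show ?thesis using that[of g] True assms(3) arc_imp_path by blast
  next
    case False
    then have "pathstart g = y" "pathfinish g = x" using assms(6,7) by (auto simp: doubleton_eq_iff)
    then show ?thesis using that[of "reversepath g"] assms(3) arc_imp_path by auto
  qed
  show ?thesis
    by (rule that[of "reversepath a +++ h +++ b"])
      (use h assms in \<open>auto simp: path_image_join\<close>)
qed

text \<open>Edges are prolonged at both ends to the separating curve within small discs around the
  vertices. The discs are disjoint and miss all edges not incident with their vertex, so two
  prolonged edges without a common end can only meet on the edges themselves, and each meeting point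
  is a crossing of the drawing.\<close>

lemma outer_1_planar_order:
  assumes G: "pair_graph G" "Digraph_Component.connected G" and o1p: "outer_1_planar G"
  shows "\<exists>pos :: 'a \<Rightarrow> real. inj_on pos (pverts G) \<and> one_crossing_order pos (nbhd G)"
\<comment> \<open>Without an edge the drawing need not contain the two points required for the
  separating curve; any injection of the vertices into the reals serves.\<close>
proof (cases "parcs G = {}")
  case True
  note pg = pair_graphD[OF G(1)]
  obtain f :: "'a \<Rightarrow> nat" where f: "inj_on f (pverts G)"
    using finite_imp_inj_to_nat_seg[OF pg(1)] by blast
  have "inj_on (\<lambda>v. real (f v)) (pverts G)" using f by (auto simp: inj_on_def)
  moreover have "one_crossing_order (\<lambda>v. real (f v)) (nbhd G)"
    using True by (simp add: one_crossing_order_def nbhd_def)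
  ultimately show ?thesis by (intro exI[of _ "\<lambda>v. real (f v)"] conjI)
next
  case False
  note pg = pair_graphD[OF G(1)]
  let ?V = "pverts G"
  obtain p \<gamma> where dr: "plane_drawing G p \<gamma>"
    and fr: "\<And>v. v \<in> ?V \<Longrightarrow> p v \<in> frontier (outside (drawn_set G p \<gamma>))"
    and cr: "\<And>e. e \<in> uedges G \<Longrightarrow> finite (crossings G p \<gamma> e) \<and> card (crossings G p \<gamma> e) \<le> 1"
    using o1p unfolding outer_1_planar_def by blast
  have injp: "inj_on p ?V"
    and arc: "\<And>e. e \<in> uedges G \<Longrightarrow> arc (\<gamma> e)"
    and ends: "\<And>e. e \<in> uedges G \<Longrightarrow> {pathstart (\<gamma> e), pathfinish (\<gamma> e)} = p ` e"
    and avoid: "\<And>e. e \<in> uedges G \<Longrightarrow> path_image (\<gamma> e) \<inter> p ` ?V = p ` e"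
    using dr unfolding plane_drawing_def by blast+
  have eV: "e \<subseteq> ?V" if "e \<in> uedges G" for e using that pg(3) pg(4) by (auto simp: uedges_def)
  have finE: "finite (uedges G)"
  proof -
    have "uedges G = (\<lambda>(u, v). {u, v}) ` parcs G" by (auto simp: uedges_def)
    then show ?thesis using pg(2) by simp
  qed
  have on_edge: "v \<in> e" if "e \<in> uedges G" "v \<in> ?V" "p v \<in> path_image (\<gamma> e)" for e v
  proof -
    have "p v \<in> p ` e" using avoid[OF that(1)] that by blast
    then show ?thesis using inj_on_image_mem_iff[OF injp that(2) eV[OF that(1)]] by blast
  qed
  define D where "D = drawn_set G p \<gamma>"
  note D = drawn_set_compact_connected[OF G dr, folded D_def]
  \<comment> \<open>Filling the bounded faces yields a compact connected set with connected
    complement and the same outer face.\<close>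
  define K where "K = - outside D"
  have K: "compact K" "topological_space_class.connected K" "topological_space_class.connected (- K)" "D \<subseteq> K"
  proof -
    have KD: "K = D \<union> inside D" unfolding K_def by (simp add: union_with_inside)
    have "closed K" unfolding K_def using open_outside[OF compact_imp_closed[OF D(1)]] by auto
    moreover have "bounded K"
      unfolding KD using D(1) by (simp add: bounded_inside compact_imp_bounded)
    ultimately show "compact K" by (simp add: compact_eq_bounded_closed)
    show "topological_space_class.connected K" unfolding KD using connected_with_inside[OF compact_imp_closed[OF D(1)] D(2)] .
    show "topological_space_class.connected (- K)" unfolding K_def using connected_outside[OF compact_imp_bounded[OF D(1)]] by simp
    show "D \<subseteq> K" unfolding KD by blast
  qed
  have VD: "p ` ?V \<subseteq> D" and ED: "\<And>e. e \<in> uedges G \<Longrightarrow> path_image (\<gamma> e) \<subseteq> D"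
    unfolding D_def drawn_set_def by blast+
  \<comment> \<open>What the disc around \<open>p v\<close> has to miss: the other vertices and the
    edges not incident with \<open>v\<close>.\<close>
  define C where "C v = p ` (?V - {v}) \<union> (\<Union>e\<in>{e \<in> uedges G. v \<notin> e}. path_image (\<gamma> e))" for v
  have "closed (C v) \<and> p v \<notin> C v" if "v \<in> ?V" for v
  proof
    show "closed (C v)" unfolding C_def
      using finE arc pg(1)
      by (intro closed_Un closed_UN finite_imp_closed) (auto intro: closed_arc_image)
    show "p v \<notin> C v" unfolding C_def using on_edge[OF _ that] inj_onD[OF injp] that by auto
  qed
  then obtain \<epsilon>0 where \<epsilon>0: "\<epsilon>0 > 0" "\<And>v. v \<in> ?V \<Longrightarrow> ball (p v) \<epsilon>0 \<inter> C v = {}"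
    using isolating_radius[OF pg(1), of C p] by blast
  \<comment> \<open>Halving the radius makes discs around different vertices disjoint, not merely
    free of each other's centres.\<close>
  define \<epsilon> where "\<epsilon> = \<epsilon>0 / 2"
  have \<epsilon>: "\<epsilon> > 0" "\<epsilon> \<le> \<epsilon>0" using \<epsilon>0 by (auto simp: \<epsilon>_def)
  have balls: "ball (p v) \<epsilon> \<inter> ball (p w) \<epsilon> = {}" if "v \<in> ?V" "w \<in> ?V" "v \<noteq> w" for v w
  proof -
    have "p w \<in> C v" using that by (auto simp: C_def)
    then have "\<epsilon>0 \<le> dist (p v) (p w)" using \<epsilon>0(2)[OF that(1)] by (force simp: disjoint_iff)
    then show ?thesis by (intro disjoint_ballI) (simp add: \<epsilon>_def)
  qed
  have ball_edge: "ball (p v) \<epsilon> \<inter> path_image (\<gamma> e) = {}" if "v \<in> ?V" "e \<in> uedges G" "v \<notin> e" for v e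
  proof -
    have "path_image (\<gamma> e) \<subseteq> C v" using that by (auto simp: C_def)
    then show ?thesis using \<epsilon>0(2)[OF that(1)] \<epsilon>(2) subset_ball[OF \<epsilon>(2), of "p v"] by blast
  qed
  have "\<exists>q. q \<in> outside D \<and> dist q (p v) < \<epsilon>" if "v \<in> ?V" for v
  proof -
    have "p v \<in> closure (outside D)" using fr[OF that] by (simp add: frontier_def D_def)
    then show ?thesis using \<epsilon>(1) by (meson closure_approachable)
  qed
  then obtain q where q: "\<And>v. v \<in> ?V \<Longrightarrow> q v \<in> outside D \<and> dist (q v) (p v) < \<epsilon>" by metis
  obtain x0 y0 where xy0: "(x0, y0) \<in> parcs G" using False by (metis equals0I surj_pair)
  have ne0: "p x0 \<in> K" "p y0 \<in> K" "p x0 \<noteq> p y0"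
    using VD K(4) pg(3)[OF xy0] pg(4)[OF xy0] pg(5)[OF xy0] inj_onD[OF injp] by auto
  have qK: "q ` ?V \<inter> K = {}" using q by (auto simp: K_def)
  obtain c where c: "simple_path c" "pathfinish c = pathstart c" "path_image c \<subseteq> - K"
    and Kin: "K \<subseteq> inside (path_image c)" and qin: "q ` ?V \<inter> inside (path_image c) = {}"
    using separating_simple_closed_curve[OF K(1,2) ne0 K(3) _ qK] pg(1) by blast
  let ?I = "inside (path_image c)"
  have clc: "closed (path_image c)" using c(1) by (simp add: closed_path_image simple_path_imp_path)
  have opI: "open ?I" using open_inside[OF clc] .
  have frI: "frontier ?I \<subseteq> path_image c" using frontier_inside_subset[OF clc] .
  have "\<exists>n. path n \<and> pathstart n = p v \<and> path_image n \<subseteq> ball (p v) \<epsilon> \<and>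
      pathfinish n \<in> path_image c \<and> path_image n - {pathfinish n} \<subseteq> ?I" if v: "v \<in> ?V" for v
  proof -
    have pv: "p v \<in> ?I" using v VD K(4) Kin by blast
    have "q v \<notin> ?I" using qin v by blast
    then obtain n where n: "path n" "pathstart n = pathstart (linepath (p v) (q v))"
        "path_image n \<subseteq> path_image (linepath (p v) (q v))"
        "path_image n - {pathfinish n} \<subseteq> interior ?I" "pathfinish n \<in> frontier ?I"
      using exists_path_subpath_to_frontier[of "linepath (p v) (q v)" ?I] pv closure_subset by auto
    have "closed_segment (p v) (q v) \<subseteq> ball (p v) \<epsilon>"
      using q[OF v] \<epsilon>(1) by (intro closed_segment_subset) (auto simp: dist_commute)
    moreover have "path_image n - {pathfinish n} \<subseteq> ?I" using n(4) interior_subset by blast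
    ultimately show ?thesis using n(1,2,3,5) frI by (intro exI[of _ n]) auto
  qed
  then obtain n where n: "\<And>v. v \<in> ?V \<Longrightarrow> path (n v) \<and> pathstart (n v) = p v \<and>
      path_image (n v) \<subseteq> ball (p v) \<epsilon> \<and> pathfinish (n v) \<in> path_image c \<and>
      path_image (n v) - {pathfinish (n v)} \<subseteq> ?I" by metis
  \<comment> \<open>Excluding parameter 1, where the closed curve returns to its start, keeps the
    positions comparable as points of the curve.\<close>
  have "\<exists>t. 0 \<le> t \<and> t < 1 \<and> c t = pathfinish (n v)" if v: "v \<in> ?V" for v
  proof -
    obtain t where t: "t \<in> {0..1}" "c t = pathfinish (n v)" using n[OF v] by (auto simp: path_image_def)
    have "c 1 = c 0" using c(2) by (simp add: pathstart_def pathfinish_def)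
    then show ?thesis using t by (cases "t = 1") (auto intro: exI[of _ 0] exI[of _ t])
  qed
  then obtain pos where pos: "\<And>v. v \<in> ?V \<Longrightarrow> 0 \<le> pos v \<and> pos v < 1 \<and> c (pos v) = pathfinish (n v)" by metis
  have nb: "pathfinish (n v) \<in> ball (p v) \<epsilon>" if "v \<in> ?V" for v using n[OF that] by blast
  have "inj_on pos ?V"
  proof (rule inj_onI, rule ccontr)
    fix v w assume vw: "v \<in> ?V" "w \<in> ?V" "pos v = pos w" "v \<noteq> w"
    then have "pathfinish (n v) = pathfinish (n w)" using pos by metis
    then show False using balls[OF vw(1,2,4)] nb[OF vw(1)] nb[OF vw(2)] by auto
  qed
  moreover
  have P: "\<exists>h. path h \<and> pathstart h = c (pos x) \<and> pathfinish h = c (pos y) \<and>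
      path_image h = path_image (n x) \<union> path_image (\<gamma> {x, y}) \<union> path_image (n y) \<and>
      path_image h - {c (pos x), c (pos y)} \<subseteq> ?I" if xy: "(x, y) \<in> parcs G" for x y
  proof -
    have V: "x \<in> ?V" "y \<in> ?V" "x \<noteq> y" using pg(3)[OF xy] pg(4)[OF xy] pg(5)[OF xy] by auto
    have e: "{x, y} \<in> uedges G" using xy by (auto simp: uedges_def)
    have "p x \<noteq> p y" using inj_onD[OF injp] V by blast
    then obtain h where h: "path h" "pathstart h = pathfinish (n x)" "pathfinish h = pathfinish (n y)"
        "path_image h = path_image (n x) \<union> path_image (\<gamma> {x, y}) \<union> path_image (n y)"
      using joined_path[of "n x" "n y" "\<gamma> {x, y}" "p x" "p y"] n[OF V(1)] n[OF V(2)] arc[OF e] ends[OF e] by auto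
    have "path_image (\<gamma> {x, y}) \<subseteq> ?I" using ED[OF e] K(4) Kin by blast
    then have "path_image h - {c (pos x), c (pos y)} \<subseteq> ?I"
      unfolding h(4) using n[OF V(1)] n[OF V(2)] pos[OF V(1)] pos[OF V(2)] by auto
    then show ?thesis using h pos[OF V(1)] pos[OF V(2)] by (intro exI[of _ h]) auto
  qed
  have cross: "\<exists>g. ({z, w}, g) \<in> crossings G p \<gamma> {x, y}"
    if xy: "(x, y) \<in> parcs G" and zw: "(z, w) \<in> parcs G" and lt: "pos x < pos z" "pos z < pos y"
      "pos w < pos x \<or> pos y < pos w" for x y z w
  proof -
    have V: "x \<in> ?V" "y \<in> ?V" "z \<in> ?V" "w \<in> ?V"
      using pg(3)[OF xy] pg(4)[OF xy] pg(3)[OF zw] pg(4)[OF zw] by auto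
    have ne: "x \<noteq> z" "x \<noteq> w" "y \<noteq> z" "y \<noteq> w" using lt by auto
    have e: "{x, y} \<in> uedges G" "{z, w} \<in> uedges G" using xy zw by (auto simp: uedges_def)
    obtain a where a: "path a" "pathstart a = c (pos x)" "pathfinish a = c (pos y)"
      "path_image a = path_image (n x) \<union> path_image (\<gamma> {x, y}) \<union> path_image (n y)"
      "path_image a - {c (pos x), c (pos y)} \<subseteq> ?I" using P[OF xy] by blast
    obtain b where b: "path b" "pathstart b = c (pos z)" "pathfinish b = c (pos w)"
      "path_image b = path_image (n z) \<union> path_image (\<gamma> {z, w}) \<union> path_image (n w)"
      "path_image b - {c (pos z), c (pos w)} \<subseteq> ?I" using P[OF zw] by blast
    have "path_image a \<inter> path_image b \<noteq> {}"
    proof (cases "pos y < pos w")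
      case True
      show ?thesis
        using interleaved_paths_meet[OF c(1,2) _ lt(1,2) True _ a(1-3,5) b(1-3,5)] pos[OF V(1)] pos[OF V(4)] by blast
    next
      case False
      then have w: "pos w < pos x" using lt(3) by blast
      have r: "path (reversepath b)" "pathstart (reversepath b) = c (pos w)" "pathfinish (reversepath b) = c (pos z)"
        "path_image (reversepath b) - {c (pos w), c (pos z)} \<subseteq> ?I" using b by auto
      have "path_image (reversepath b) \<inter> path_image a \<noteq> {}"
        using interleaved_paths_meet[OF c(1,2) _ w lt(1,2) _ r a(1-3,5)] pos[OF V(4)] pos[OF V(2)] by blast
      then show ?thesis by auto
    qed
    \<comment> \<open>The common point of the prolonged edges lies on none of the prolongations,
      because discs around distinct vertices are disjoint and miss non-incident edges.\<close>
    then obtain g where g: "g \<in> path_image a" "g \<in> path_image b" by blast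
    have nb': "path_image (n v) \<subseteq> ball (p v) \<epsilon>" if "v \<in> ?V" for v using n[OF that] by blast
    have nn: "path_image (n v) \<inter> path_image (n u) = {}" if "v \<in> {x, y}" "u \<in> {z, w}" for v u
      using balls[of v u] nb'[of v] nb'[of u] V ne that by blast
    have ng: "path_image (n v) \<inter> path_image (\<gamma> {z, w}) = {}" if "v \<in> {x, y}" for v
      using ball_edge[OF _ e(2), of v] nb'[of v] V ne that by blast
    have gn: "path_image (n v) \<inter> path_image (\<gamma> {x, y}) = {}" if "v \<in> {z, w}" for v
      using ball_edge[OF _ e(1), of v] nb'[of v] V ne that by blast
    have gg: "g \<in> path_image (\<gamma> {x, y})" "g \<in> path_image (\<gamma> {z, w})"
      using g nn ng gn unfolding a(4) b(4) by blast+
    have "g \<notin> p ` {x, y}"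
      using on_edge[OF e(2), of x] on_edge[OF e(2), of y] gg(2) V ne by auto
    moreover have "g \<notin> p ` {z, w}"
      using on_edge[OF e(1), of z] on_edge[OF e(1), of w] gg(1) V ne by auto
    moreover have "{z, w} \<noteq> {x, y}" using ne by blast
    ultimately show ?thesis unfolding crossings_def using gg e by blast
  qed
  have "one_crossing_order pos (nbhd G)"
    unfolding one_crossing_order_def
  proof (intro allI impI)
    fix x y z w z' w'
    assume h: "y \<in> nbhd G x" "w \<in> nbhd G z" "w' \<in> nbhd G z'" "pos x < pos z" "pos z < pos y"
      "pos w < pos x \<or> pos y < pos w" "pos x < pos z'" "pos z' < pos y" "pos w' < pos x \<or> pos y < pos w'"
    then have a: "(x, y) \<in> parcs G" "(z, w) \<in> parcs G" "(z', w') \<in> parcs G" by (auto simp: nbhd_def)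
    then have e: "{x, y} \<in> uedges G" by (auto simp: uedges_def)
    obtain g g' where gg: "({z, w}, g) \<in> crossings G p \<gamma> {x, y}" "({z', w'}, g') \<in> crossings G p \<gamma> {x, y}"
      using cross[OF a(1,2) h(4-6)] cross[OF a(1,3) h(7-9)] by blast
    have "{z, w} = {z', w'}"
    proof (rule ccontr)
      assume "{z, w} \<noteq> {z', w'}"
      then have "card {({z, w}, g), ({z', w'}, g')} = 2" by simp
      moreover have "card {({z, w}, g), ({z', w'}, g')} \<le> card (crossings G p \<gamma> {x, y})"
        using cr[OF e] gg by (intro card_mono) auto
      ultimately show False using cr[OF e] by simp
    qed
    \<comment> \<open>Both \<open>z\<close> and \<open>z'\<close> are the ends positioned between
      \<open>x\<close> and \<open>y\<close>, so equal edges are equal as ordered pairs.\<close>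
    then show "z' = z \<and> w' = w" using h by (auto simp: doubleton_eq_iff)
  qed
  ultimately show ?thesis by blast
qed

section \<open>Back to digraphs and the exceptional cycle\<close>

lemma out_degree_nbhd: "out_degree (with_proj G) v = card (nbhd G v)"
proof -
  have "out_arcs (with_proj G) v = Pair v ` nbhd G v"
    by (auto simp: out_arcs_def nbhd_def)
  then show ?thesis unfolding out_degree_def by (simp add: card_image inj_on_def)
qed

text \<open>The vertices of a tight pentagon have no neighbours outside of it, so in a connected
  graph they are all the vertices.\<close>

lemma tight_pentagon_iso_C5:
  assumes G: "pair_graph G" "Digraph_Component.connected G" and cs: "tight_pentagon (nbhd G) L cs"
  shows "digraph_iso G (cycle_graph 5)"
proof -
  note pg = pair_graphD[OF G(1)]
  have d: "distinct cs" "length cs = 5"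
    and N: "\<And>i. i < 5 \<Longrightarrow> nbhd G (cs ! i) = {cs ! ((i + 1) mod 5), cs ! ((i + 4) mod 5)}"
    using cs unfolding tight_pentagon_def by blast+
  have V: "pverts G = set cs"
  proof
    have 0: "cs ! 0 \<in> set cs" using d by simp
    have "(cs ! 0, cs ! 1) \<in> parcs G" using N[of 0] by (auto simp: nbhd_def)
    then have "cs ! 0 \<in> pverts G" using pg(3) by blast
    then show "pverts G \<subseteq> set cs"
    proof (rule connected_induct[OF G _ 0])
      fix x y assume "x \<in> set cs" "(x, y) \<in> parcs G"
      then obtain i where i: "i < 5" "x = cs ! i" "y \<in> nbhd G x"
        using d by (auto simp: in_set_conv_nth nbhd_def)
      then have "y = cs ! ((i + 1) mod 5) \<or> y = cs ! ((i + 4) mod 5)" using N[OF i(1)] by auto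
      then show "y \<in> set cs" using d by auto
    qed
    show "set cs \<subseteq> pverts G"
    proof
      fix x assume "x \<in> set cs"
      then obtain i where "i < 5" "x = cs ! i" using d by (auto simp: in_set_conv_nth)
      then have "(x, cs ! ((i + 1) mod 5)) \<in> parcs G" using N[of i] by (auto simp: nbhd_def)
      then show "x \<in> pverts G" using pg(3) by blast
    qed
  qed
  have adj: "(cs ! i, cs ! j) \<in> parcs G \<longleftrightarrow> j = Suc i mod 5 \<or> i = Suc j mod 5" if ij: "i < 5" "j < 5" for i j
  proof -
    have "(cs ! i, cs ! j) \<in> parcs G \<longleftrightarrow> cs ! j \<in> nbhd G (cs ! i)" by (simp add: nbhd_def)
    also have "\<dots> \<longleftrightarrow> j = (i + 1) mod 5 \<or> j = (i + 4) mod 5"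
      using N[OF ij(1)] d ij by (simp add: nth_eq_iff_index_eq)
    also have "\<dots> \<longleftrightarrow> j = Suc i mod 5 \<or> i = Suc j mod 5"
    proof -
      have "i \<in> {0, 1, 2, 3, 4}" "j \<in> {0, 1, 2, 3, 4}" using ij by auto
      then show ?thesis by (elim insertE emptyE) simp_all
    qed
    finally show ?thesis .
  qed
  define ix where "ix v = (THE i. i < 5 \<and> cs ! i = v)" for v
  have ix: "ix (cs ! i) = i" if "i < 5" for i
    unfolding ix_def using that d by (intro the_equality) (auto simp: nth_eq_iff_index_eq)
  have nth: "\<exists>i<5. v = cs ! i" if "v \<in> pverts G" for v
    using that d unfolding V by (metis in_set_conv_nth)
  have inj: "inj_on ix (pverts G)"
    by (rule inj_onI) (metis nth ix)
  have img: "ix ` pverts G = {..<5}"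
  proof
    show "ix ` pverts G \<subseteq> {..<5}" using nth ix by force
    show "{..<5} \<subseteq> ix ` pverts G"
    proof
      fix i :: nat assume "i \<in> {..<5}"
      then have "ix (cs ! i) = i" "cs ! i \<in> pverts G" using ix d unfolding V by auto
      then show "i \<in> ix ` pverts G" by (metis imageI)
    qed
  qed
  define F where "F = (\<lambda>(a, b). (ix a, ix b))"
  have injF: "inj_on F (parcs G)"
  proof (rule inj_onI)
    fix e f assume ef: "e \<in> parcs G" "f \<in> parcs G" "F e = F f"
    obtain a b c d where [simp]: "e = (a, b)" "f = (c, d)" by (metis surj_pair)
    have "a \<in> pverts G" "b \<in> pverts G" "c \<in> pverts G" "d \<in> pverts G" using ef pg(3,4) by auto
    moreover have "ix a = ix c" "ix b = ix d" using ef(3) by (simp_all add: F_def)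
    ultimately show "e = f" using inj_onD[OF inj] by auto
  qed
  have arcs: "F ` parcs G = parcs (cycle_graph 5)"
  proof
    show "F ` parcs G \<subseteq> parcs (cycle_graph 5)"
    proof
      fix x assume "x \<in> F ` parcs G"
      then obtain a b where ab: "(a, b) \<in> parcs G" "x = (ix a, ix b)" by (auto simp: F_def)
      obtain i j where "i < 5" "j < 5" "a = cs ! i" "b = cs ! j" using nth pg(3,4) ab(1) by metis
      then show "x \<in> parcs (cycle_graph 5)" using ab adj ix by (simp add: cycle_graph_def)
    qed
    show "parcs (cycle_graph 5) \<subseteq> F ` parcs G"
    proof
      fix x assume "x \<in> parcs (cycle_graph 5)"
      then obtain i j where ij: "x = (i, j)" "i < 5" "j < 5" "j = Suc i mod 5 \<or> i = Suc j mod 5"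
        by (auto simp: cycle_graph_def)
      then have "(cs ! i, cs ! j) \<in> parcs G" using adj by blast
      moreover have "x = F (cs ! i, cs ! j)" using ij ix by (simp add: F_def)
      ultimately show "x \<in> F ` parcs G" by blast
    qed
  qed
  define h where "h = \<lparr>iso_verts = ix, iso_arcs = F, iso_head = snd, iso_tail = fst\<rparr>"
  have "wf_digraph (with_proj G)" using G(1) pg by (auto simp: wf_digraph_def)
  then have "pre_digraph.digraph_isomorphism (with_proj G) h"
    unfolding pre_digraph.digraph_isomorphism_def using inj injF by (auto simp: h_def F_def)
  moreover have "with_proj (cycle_graph 5) = app_iso h (with_proj G)"
    unfolding app_iso_def with_proj_def using img arcs by (simp add: h_def cycle_graph_def)
  ultimately show ?thesis unfolding digraph_iso_def by blast
qed

theorem theorem1p7: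
  fixes G :: "'a pair_pre_digraph"
  assumes "pair_graph G"
    and "Digraph_Component.connected G"
    and "outer_1_planar G"
    and "\<forall>v \<in> pverts G. out_degree G v \<le> 4"
    and "\<not> digraph_iso G (cycle_graph 5)"
  shows "pcf_degree_plus_choosable TYPE('c) 2 G"
  unfolding pcf_degree_plus_choosable_def
proof (intro allI impI)
  fix L :: "'a \<Rightarrow> 'c set"
  assume L: "\<forall>v\<in>pverts G. finite (L v) \<and> card (L v) = out_degree G v + 2"
  note pg = pair_graphD[OF assms(1)]
  interpret list_graph "pverts G" "nbhd G" L
  proof
    show "nbhd G v \<subseteq> pverts G" for v using pg(4) by (auto simp: nbhd_def)
    show empty: "v \<notin> pverts G \<Longrightarrow> nbhd G v = {}" for v using pg(3) by (auto simp: nbhd_def)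
    show "card (nbhd G v) \<le> 4" for v
      using assms(4) empty[of v] by (cases "v \<in> pverts G") (auto simp: out_degree_nbhd)
    show "v \<in> pverts G \<Longrightarrow> card (nbhd G v) + 2 \<le> card (L v)" for v
      using L by (simp add: out_degree_nbhd)
    show "v \<notin> nbhd G v" for v using pg(5)[of v v] by (auto simp: nbhd_def)
  qed (use pg in \<open>auto simp: nbhd_def\<close>)
  obtain pos :: "'a \<Rightarrow> real" where pos: "inj_on pos (pverts G)" "one_crossing_order pos (nbhd G)"
    using outer_1_planar_order[OF assms(1-3)] by blast
  have "\<nexists>cs. tight_pentagon (nbhd G) L cs"
    using tight_pentagon_iso_C5[OF assms(1,2)] assms(5) by blast
  then obtain \<phi> where \<phi>: "sub (pverts G) \<phi>" using colorable[OF pos(2,1)] by blast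
  have N: "nbhd G v \<inter> pverts G = nbhd G v" for v using N_sub by blast
  have col: "\<phi> v \<in> L v" "\<And>u. u \<in> nbhd G v \<Longrightarrow> \<phi> u \<noteq> \<phi> v" "nbhd G v \<noteq> {} \<Longrightarrow> conflict_free \<phi> (nbhd G v)"
    if "v \<in> pverts G" for v
    using \<phi> that unfolding sub_def N by blast+
  have "proper_conflict_free_coloring G \<phi>"
    unfolding proper_conflict_free_coloring_def
  proof (intro conjI ballI impI)
    fix e assume "e \<in> parcs G"
    then show "case e of (u, v) \<Rightarrow> \<phi> u \<noteq> \<phi> v"
      using col(2)[of "snd e" "fst e"] pg(4,6) by (cases e) (auto simp: nbhd_def)
  next
    fix v assume v: "v \<in> pverts G" "nbhd G v \<noteq> {}"
    then obtain u where u: "u \<in> nbhd G v" "\<And>w. w \<in> nbhd G v \<Longrightarrow> \<phi> w = \<phi> u \<Longrightarrow> w = u"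
      using col(3) unfolding conflict_free_def by blast
    then show "\<exists>c. \<exists>!u. u \<in> nbhd G v \<and> \<phi> u = c"
      by (intro exI[of _ "\<phi> u"] ex1I[of _ u]) auto
  qed
  then show "\<exists>\<phi>. proper_conflict_free_coloring G \<phi> \<and> (\<forall>v\<in>pverts G. \<phi> v \<in> L v)"
    using col(1) by blast
qed

end
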